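(* Let $(\mu_1,\mu_2,\mu_3,\delta_1,\delta_2,\delta_3)\in(\mathbb{Z}_+)^3\times\mathbb{N}^3$. There exists a $\Sigma$-graph $G$ with $(M_1(G),M_2(G),M_3(G),d_1(G),d_2(G),d_3(G))=(\mu_1,\mu_2,\mu_3,\delta_1,\delta_2,\delta_3)$ if and only if for every $1\le i\le 3$ (indices modulo $3$): (1) $\max(\mu_{i+1},\mu_{i+2})\leq \delta_i\leq \mu_{i+1}+\mu_{i+2}$, and (2) $\delta_{i+1}+\delta_{i+2}\leq 2\mu_i+\delta_i+1$.
   Context: Let $\mathbb{S}^2$ be the sphere and $P_1,P_2,P_3$ three distinct points; $\Sigma=\mathbb{S}^2\setminus\{P_1,P_2,P_3\}$. Indices are modulo $3$. For a simple closed curve $C$ avoiding the $P_i$, $H_i(C)$ (resp. $H'_i(C)$) is the component of $\mathbb{S}^2\setminus C$ containing (resp. not containing) $P_i$; $C$ is of type $i$ if $H_i(C)=H'_{i+1}(C)=H'_{i+2}(C)$. A $\Sigma$-graph is a connected nonempty graph $G$ embedded in $\mathbb{S}^2$ having three distinct faces $F_1,F_2,F_3$ with $P_i$ in the interior of $F_i$. The face distance $d_G$ is the graph distance in the graph on faces obtained from the dual graph by adding an edge between any two faces that share a vertex. $d_1(G)=d_G(F_2,F_3)$, $d_2(G)=d_G(F_1,F_3)$, $d_3(G)=d_G(F_1,F_2)$, and $M_i(G)$ is the maximal number of pairwise vertex-disjoint simple loops of $G$ of type $i$. Here $\mathbb{Z}_+=\{0,1,2,\dots\}$ and $\mathbb{N}=\{1,2,\dots\}$.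 *)

theory Defs
  imports "HOL-Analysis.Analysis" "HOL-Library.Extended_Nat"
begin

text \<open>Indices modulo 3 are elements of the numeral type \<^typ>\<open>3\<close>, whose arithmetic is that of
  the integers modulo 3 (so the index 3 is 0).\<close>

abbreviation S2 :: "(real^3) set" where
  "S2 \<equiv> sphere 0 1"

text \<open>An edge is recorded as its point set, endpoints included. Graphs are multigraphs: parallel
  edges are different point sets with the same endpoints, and a graph loop is an edge traced by a
  closed \<^const>\<open>simple_path\<close>.\<close>

record sphere_graph =
  verts :: "(real^3) set"
  edges :: "(real^3) set set"

definition embedded_graph :: "sphere_graph \<Rightarrow> bool" where
  "embedded_graph G \<longleftrightarrow>
     finite (verts G) \<and> finite (edges G) \<and> verts G \<subseteq> S2 \<and>
     (\<forall>e\<in>edges G. e \<subseteq> S2 \<and>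
        (\<exists>g. simple_path g \<and> path_image g = e \<and> e \<inter> verts G = {pathstart g, pathfinish g})) \<and>
     (\<forall>e\<in>edges G. \<forall>e'\<in>edges G. e \<noteq> e' \<longrightarrow> e \<inter> e' \<subseteq> verts G)"

definition graph_adj :: "sphere_graph \<Rightarrow> (real^3) rel" where
  "graph_adj G = {(u, v). u \<in> verts G \<and> v \<in> verts G \<and> (\<exists>e\<in>edges G. u \<in> e \<and> v \<in> e)}"

definition graph_connected :: "sphere_graph \<Rightarrow> bool" where
  "graph_connected G \<longleftrightarrow> (\<forall>u\<in>verts G. \<forall>v\<in>verts G. (u, v) \<in> (graph_adj G)\<^sup>*)"

definition support :: "sphere_graph \<Rightarrow> (real^3) set" where
  "support G = verts G \<union> \<Union>(edges G)"

definition faces :: "sphere_graph \<Rightarrow> (real^3) set set" where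
  "faces G = components (S2 - support G)"

text \<open>Faces are open in the sphere, so lying in the interior of a face is lying in it.\<close>

definition sigma_graph :: "(3 \<Rightarrow> real^3) \<Rightarrow> sphere_graph \<Rightarrow> bool" where
  "sigma_graph P G \<longleftrightarrow>
     embedded_graph G \<and> verts G \<noteq> {} \<and> graph_connected G \<and>
     (\<exists>F :: 3 \<Rightarrow> (real^3) set. inj F \<and> (\<forall>i. F i \<in> faces G \<and> P i \<in> F i))"

definition sigma_face :: "(3 \<Rightarrow> real^3) \<Rightarrow> sphere_graph \<Rightarrow> 3 \<Rightarrow> (real^3) set" where
  "sigma_face P G i = connected_component_set (S2 - support G) (P i)"

text \<open>Loops of the dual graph are dropped; they do not affect distances.\<close>

definition dual_adj :: "sphere_graph \<Rightarrow> (real^3) set rel" where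
  "dual_adj G = {(F, F'). F \<in> faces G \<and> F' \<in> faces G \<and> F \<noteq> F' \<and>
     (\<exists>e\<in>edges G. e \<subseteq> closure F \<and> e \<subseteq> closure F')}"

definition vertex_adj :: "sphere_graph \<Rightarrow> (real^3) set rel" where
  "vertex_adj G = {(F, F'). F \<in> faces G \<and> F' \<in> faces G \<and> F \<noteq> F' \<and>
     (\<exists>v\<in>verts G. v \<in> closure F \<and> v \<in> closure F')}"

definition face_dist :: "sphere_graph \<Rightarrow> (real^3) set \<Rightarrow> (real^3) set \<Rightarrow> enat" where
  "face_dist G F F' = (INF n \<in> {n. (F, F') \<in> (dual_adj G \<union> vertex_adj G) ^^ n}. enat n)"

definition d_sigma :: "(3 \<Rightarrow> real^3) \<Rightarrow> sphere_graph \<Rightarrow> 3 \<Rightarrow> enat" where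
  "d_sigma P G i = face_dist G (sigma_face P G (i + 1)) (sigma_face P G (i + 2))"

definition simple_closed_curve :: "(real^3) set \<Rightarrow> bool" where
  "simple_closed_curve C \<longleftrightarrow>
     C \<subseteq> S2 \<and> (\<exists>c. simple_path c \<and> pathfinish c = pathstart c \<and> path_image c = C)"

definition side_with :: "real^3 \<Rightarrow> (real^3) set \<Rightarrow> (real^3) set" where
  "side_with p C = (THE K. K \<in> components (S2 - C) \<and> p \<in> K)"

definition side_without :: "real^3 \<Rightarrow> (real^3) set \<Rightarrow> (real^3) set" where
  "side_without p C = (THE K. K \<in> components (S2 - C) \<and> p \<notin> K)"

definition curve_of_type :: "(3 \<Rightarrow> real^3) \<Rightarrow> 3 \<Rightarrow> (real^3) set \<Rightarrow> bool" where
  "curve_of_type P i C \<longleftrightarrow>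
     simple_closed_curve C \<and> (\<forall>j. P j \<notin> C) \<and>
     side_with (P i) C = side_without (P (i + 1)) C \<and>
     side_without (P (i + 1)) C = side_without (P (i + 2)) C"

definition simple_loop :: "sphere_graph \<Rightarrow> (real^3) set \<Rightarrow> bool" where
  "simple_loop G C \<longleftrightarrow> simple_closed_curve C \<and> (\<exists>A \<subseteq> edges G. C = \<Union>A)"

definition M_sigma :: "(3 \<Rightarrow> real^3) \<Rightarrow> sphere_graph \<Rightarrow> 3 \<Rightarrow> nat" where
  "M_sigma P G i = Max {card L | L.
     (\<forall>C\<in>L. simple_loop G C \<and> curve_of_type P i C) \<and>
     pairwise (\<lambda>C D. C \<inter> D \<inter> verts G = {}) L}"

end

theory Submission
  imports Defs
begin

text \<open>Both numbers attached to a \<open>\<Sigma>\<close>-graph count simple closed curves in its support. For the \<open>M_i\<close> this is the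
  definition. The face distance of two points is the maximal number of disjoint curves in the support that
  separate them: a geodesic of faces meets the support in \<open>d\<close> points only, and conversely, by Janiszewski's theorem,
  the boundary of each ball of faces around the first point contains a separating curve, where balls of
  different radii give disjoint curves.

  A curve separating \<open>P_(i+1)\<close> from \<open>P_(i+2)\<close> is of type \<open>i + 1\<close> or \<open>i + 2\<close>, which gives (1). If (2) fails, then
  a geodesic from \<open>P_(i+1)\<close> to \<open>P_(i+2)\<close> stays so far away from \<open>P_i\<close> that the first \<open>\<mu>_i + 1\<close> level
  curves around \<open>P_i\<close> do not meet it, and so they are all of type \<open>i\<close>.

  Conversely, a small loop around \<open>P_i\<close>, joined to the graph by an edge, adds one to \<open>M_i\<close> and to the two distances from
  \<open>P_i\<close>. Up to such loops and a permutation of the indices only the triples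
  \<open>M = (s, T, T)\<close>, \<open>d = (T, T, s + \<rho>)\<close> remain. These are realized by a drawing consisting of three families of
  triangles in the plane, with \<open>P_3\<close> at infinity and the other points on the real axis. The
  real axis bounds the distances from above, and a closed curve through \<open>P_1\<close> that meets the drawing in \<open>2 s + 1\<close>
  points bounds \<open>M_1\<close>.\<close>

section \<open>Topology of the sphere\<close>

text \<open>Counting curves in the support makes vertices and edges disappear: edges may be
  subdivided at will, and a construction only has to produce a finite union of arcs. The price is
  that an arbitrary closed curve in the support must be shown to run along whole edges, and that two
  faces touching at an inner point of an edge must share all of it. Edges are arbitrary topological
  arcs, so no local picture of the embedding is used; both facts come from Janiszewski's theorem,
  applied to an edge in which a gap has been cut.

  With the slacks t_i = \<mu>_(i+1) + \<mu>_(i+2) - \<delta>_i the conditions read 0 \<le> t_i \<le>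
  \<mu>_j for j \<noteq> i, and t_i \<le> t_(i+1) + t_(i+2) + 1. The additional 1 is a parity
  effect. A crossing point of a geodesic is shared by two of its faces, which costs one step; in the
  construction, 2 s + 1 crossing points leave room for only s curves that need two points
  each.\<close>

declare mem_sphere [simp del] mem_sphere_0 [simp del]

section \<open>Charts of the punctured sphere and open subsets of the sphere\<close>

lemma sphere_chart:
  assumes "q \<in> S2"
  obtains h :: "complex \<Rightarrow> real^3" and k where "homeomorphism (S2 - {q}) UNIV k h"
proof -
  have "(S2 - {q}) homeomorphic (UNIV :: complex set)"
    by (rule homeomorphic_punctured_sphere_affine) (use assms in auto)
  then show thesis
    using that unfolding homeomorphic_def by blast
qed

lemma chartD:
  assumes "homeomorphism (S2 - {q}) (UNIV :: complex set) k h"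
  shows "\<And>z. h z \<in> S2" "\<And>z. h z \<noteq> q" "\<And>z. k (h z) = z" "\<And>x. x \<in> S2 \<Longrightarrow> x \<noteq> q \<Longrightarrow> h (k x) = x"
    and "continuous_on UNIV h" "continuous_on (S2 - {q}) k" "inj h" "range h = S2 - {q}"
proof -
  have kh: "k (h z) = z" for z
    using homeomorphism_apply2[OF assms] by simp
  then show "\<And>z. k (h z) = z" "inj h"
    by (auto intro: injI) (metis injI)
  show rh: "range h = S2 - {q}"
    using homeomorphism_image2[OF assms] by simp
  then show "\<And>z. h z \<in> S2" "\<And>z. h z \<noteq> q"
    by blast+
  show "\<And>x. x \<in> S2 \<Longrightarrow> x \<noteq> q \<Longrightarrow> h (k x) = x"
    using homeomorphism_apply1[OF assms] by simp
  show "continuous_on UNIV h" "continuous_on (S2 - {q}) k"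
    using homeomorphism_cont1[OF assms] homeomorphism_cont2[OF assms] by auto
qed

lemma chart_open_image:
  assumes "homeomorphism (S2 - {q}) (UNIV :: complex set) k h" "open U"
  shows "openin (top_of_set S2) (h ` U)"
proof -
  have "openin (top_of_set (S2 - {q})) (h ` U)"
    using homeomorphism_imp_open_map[OF homeomorphism_symD[OF assms(1)]] assms(2) by auto
  moreover have "openin (top_of_set S2) (S2 - {q})"
    by (simp add: openin_delete)
  ultimately show ?thesis
    using openin_trans by blast
qed

lemma chart_open_vimage:
  assumes "homeomorphism (S2 - {q}) (UNIV :: complex set) k h" "openin (top_of_set S2) U" "q \<notin> U"
  shows "open (k ` U)"
proof -
  have "openin (top_of_set (S2 - {q})) U"
    using assms(2,3) openin_imp_subset[OF assms(2)]
    by (metis Diff_subset openin_subset_trans subset_Diff_insert Diff_empty)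
  then show ?thesis
    using homeomorphism_imp_open_map[OF assms(1)] by auto
qed

lemma islimpt_S2: "x \<in> S2 \<Longrightarrow> x islimpt S2"
proof -
  assume x: "x \<in> S2"
  have "connected S2"
    by (rule connected_sphere) auto
  moreover have "S2 \<noteq> {a}" for a :: "real^3"
  proof
    assume "S2 = {a}"
    moreover have "- x \<in> S2" using x by (simp add: mem_sphere_0)
    ultimately have "x = - x" using x by (metis singletonD)
    then have "x = 0" by (metis add.right_inverse scaleR_2 scaleR_eq_0_iff zero_neq_numeral)
    then show False using x by (simp add: mem_sphere_0)
  qed
  ultimately show ?thesis
    using connected_imp_perfect x by blast
qed

lemma infinite_openin_S2:
  assumes "openin (top_of_set S2) U" "x \<in> U"
  shows "infinite U"
proof (rule infinite_openin)
  show "x islimpt S2"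
    using assms openin_imp_subset[OF assms(1)] islimpt_S2 by blast
qed (use assms in auto)

lemma connected_punctured_S2:
  assumes "q \<in> S2"
  shows "connected (S2 - {q})"
proof -
  obtain h k where hk: "homeomorphism (S2 - {q}) (UNIV :: complex set) k h"
    using sphere_chart assms by blast
  have "connected (range h)"
    by (rule connected_continuous_image[OF chartD(5)[OF hk] connected_UNIV])
  then show ?thesis
    by (simp add: chartD(8)[OF hk])
qed

text \<open>A chart at a point off \<open>U\<close> turns \<open>U\<close> into a connected open set
  of the plane, which stays connected when countably many points are removed.\<close>

lemma connected_openin_S2_diff_finite:
  assumes "openin (top_of_set S2) U" "connected U" "finite X"
  shows "connected (U - X)"
proof -
  have *: "connected (U - X)"
    if U: "openin (top_of_set S2) U" "connected U" and q: "q \<in> S2" "q \<notin> U" for U and q :: "real^3"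
  proof -
    have US: "U \<subseteq> S2" using U openin_imp_subset by blast
    obtain h k where hk: "homeomorphism (S2 - {q}) (UNIV :: complex set) k h"
      using sphere_chart q by blast
    have "connected (k ` U)"
      by (rule connected_continuous_image[OF continuous_on_subset[OF chartD(6)[OF hk]] U(2)])
        (use US q in auto)
    then have "connected (k ` U - k ` (X \<inter> U))"
      using connected_open_diff_countable[OF _ chart_open_vimage[OF hk U(1) q(2)]] assms(3)
      by (simp add: countable_finite)
    moreover have "U - X = h ` (k ` U - k ` (X \<inter> U))"
    proof -
      have "h (k x) = x" if "x \<in> U" for x
        using that US q chartD(4)[OF hk] by auto
      then have "inj_on k U" "h ` k ` U = U"
        by (auto intro: inj_on_inverseI simp: image_image)
      then have "h ` (k ` U - k ` (X \<inter> U)) = h ` k ` (U - X \<inter> U)"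
        by (metis Int_lower2 inj_on_image_set_diff[of k U U "X \<inter> U"] Diff_subset)
      also have "\<dots> = U - X"
        using \<open>\<And>x. x \<in> U \<Longrightarrow> h (k x) = x\<close> by (auto simp: image_image)
      finally show ?thesis by simp
    qed
    ultimately show ?thesis
      by (metis chartD(5)[OF hk] connected_continuous_image continuous_on_subset subset_UNIV)
  qed
  show ?thesis
  \<comment> \<open>The whole sphere has no point to spare for a chart, so one point of
    \<open>X\<close> is removed beforehand.\<close>
  proof (cases "U = S2")
    case False
    then show ?thesis
      using *[OF assms(1,2)] openin_imp_subset[OF assms(1)] by blast
  next
    case True
    show ?thesis
    proof (cases "X \<inter> S2 = {}")
      case True
      then show ?thesis using assms(2) \<open>U = S2\<close> by (metis Diff_triv Int_commute)
    next
      case False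
      then obtain q where q: "q \<in> X" "q \<in> S2" by blast
      have "connected (S2 - {q} - X)"
        using *[OF _ connected_punctured_S2[OF q(2)] q(2)] by (simp add: openin_delete)
      moreover have "S2 - {q} - X = U - X" using q True by auto
      ultimately show ?thesis by simp
    qed
  qed
qed

lemma openin_S2_Diff: "closed S \<Longrightarrow> openin (top_of_set S2) (S2 - S)"
  by (simp add: Diff_eq openin_open_Int open_Compl)

lemma openin_component_S2:
  assumes "closed S"
  shows "openin (top_of_set S2) (connected_component_set (S2 - S) a)"
proof -
  have "locally connected S2"
    using locally_path_connected_sphere locally_path_connected_imp_locally_connected by blast
  then have "locally connected (S2 - S)"
    using openin_S2_Diff[OF assms] locally_open_subset by blast
  then have "openin (top_of_set (S2 - S)) (connected_component_set (S2 - S) a)"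
    by (rule openin_connected_component_locally_connected)
  then show ?thesis
    using openin_S2_Diff[OF assms] openin_trans by blast
qed

text \<open>Nonempty open sets of the sphere are infinite. This brings back the point that a chart
  omits.\<close>

lemma closure_openin_S2_diff_finite:
  assumes U: "openin (top_of_set S2) U" and X: "finite X"
  shows "U \<subseteq> closure (U - X)"
proof
  fix q assume q: "q \<in> U"
  show "q \<in> closure (U - X)"
    unfolding closure_iff_nhds_not_empty
  proof (intro allI impI)
    fix A V assume V: "V \<subseteq> A" "open V" "q \<in> V"
    have "openin (top_of_set S2) (U \<inter> V)"
      using U V by (simp add: openin_Int_open)
    then have "infinite (U \<inter> V)"
      using infinite_openin_S2 q V by blast
    then have "\<not> U \<inter> V \<subseteq> X"
      using X finite_subset by blast
    then show "(U - X) \<inter> A \<noteq> {}" using V by blast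
  qed
qed

section \<open>Janiszewski's theorem, arcs and the Jordan curve theorem on the sphere\<close>

text \<open>The planar theorem in a chart at a point \<open>q\<close> off \<open>S\<close>,
  \<open>T\<close>, \<open>a\<close> and \<open>b\<close>. Such a \<open>q\<close> exists because
  the open complement is infinite, and removing it from a component does not disconnect that
  component.\<close>

lemma Janiszewski_S2:
  assumes "compact S" "compact T" "S \<subseteq> S2" "T \<subseteq> S2" "connected (S \<inter> T)"
    and "connected_component (S2 - S) a b" "connected_component (S2 - T) a b"
  shows "connected_component (S2 - (S \<union> T)) a b"
proof -
  have cl: "closed S" "closed T" using assms compact_imp_closed by auto
  have a: "a \<in> S2 - (S \<union> T)"
    using connected_component_in[OF assms(6)] connected_component_in[OF assms(7)] by auto
  have b: "b \<in> S2 - (S \<union> T)"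
    using connected_component_in[OF assms(6)] connected_component_in[OF assms(7)] by auto
  have "infinite (S2 - (S \<union> T))"
    using infinite_openin_S2[OF openin_S2_Diff[OF closed_Un[OF cl]]] a by blast
  then have "\<not> S2 - (S \<union> T) \<subseteq> {a, b}"
    using finite_subset by auto
  then obtain q where q: "q \<in> S2" "q \<notin> S" "q \<notin> T" "q \<noteq> a" "q \<noteq> b" by blast
  obtain h k where hk: "homeomorphism (S2 - {q}) (UNIV :: complex set) k h"
    using sphere_chart[OF q(1)] by blast
  note ch = chartD[OF hk]
  have inj: "inj_on k (S2 - {q})"
    using ch(4) by (intro inj_on_inverseI[where g = h]) auto
  have cont: "continuous_on X k" if "X \<subseteq> S2 - {q}" for X
    using ch(6) that continuous_on_subset by blast
  have cc: "connected_component (- k ` X) (k a) (k b)"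
    if X: "compact X" "X \<subseteq> S2" "q \<notin> X" and X': "connected_component (S2 - X) a b" for X
  proof -
    define U where "U = connected_component_set (S2 - X) a"
    have U: "U \<subseteq> S2 - X" "connected U" "a \<in> U" "b \<in> U" "openin (top_of_set S2) U"
      using X' connected_component_in[OF X'] openin_component_S2[OF compact_imp_closed[OF X(1)]]
        connected_component_subset unfolding U_def by auto
    have "connected (U - {q})"
      by (rule connected_openin_S2_diff_finite) (use U in auto)
    moreover have "continuous_on (U - {q}) k"
      by (rule cont) (use U(1) in auto)
    ultimately have 1: "connected (k ` (U - {q}))"
      by (metis connected_continuous_image)
    have 2: "k ` (U - {q}) \<subseteq> - k ` X"
    proof -
      have "k x \<noteq> k y" if "x \<in> U - {q}" "y \<in> X" for x y
      proof -
        have "x \<in> S2 - {q}" "y \<in> S2 - {q}" "x \<noteq> y" using that U(1) X by auto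
        then show ?thesis using inj by (meson inj_onD)
      qed
      then show ?thesis by auto
    qed
    show ?thesis
      unfolding connected_component_def using 1 2 U q by blast
  qed
  have "connected_component (- (k ` S \<union> k ` T)) (k a) (k b)"
  proof (rule Janiszewski)
    show "compact (k ` S)" "closed (k ` T)"
      using cont[of S] cont[of T] assms q
      by (auto intro!: compact_continuous_image compact_imp_closed)
    have "k ` S \<inter> k ` T = k ` (S \<inter> T)"
      by (rule inj_on_image_Int[OF inj, symmetric]) (use assms q in auto)
    then show "connected (k ` S \<inter> k ` T)"
      using cont[of "S \<inter> T"] assms q by (auto intro!: connected_continuous_image)
    show "connected_component (- k ` S) (k a) (k b)" "connected_component (- k ` T) (k a) (k b)"
      using cc assms q by blast+
  qed
  then obtain Y where Y: "connected Y" "Y \<subseteq> - (k ` S \<union> k ` T)" "k a \<in> Y" "k b \<in> Y"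
    unfolding connected_component_def by blast
  have "connected (h ` Y)"
    using Y(1) ch(5) by (metis connected_continuous_image continuous_on_subset subset_UNIV)
  moreover have "h ` Y \<subseteq> S2 - (S \<union> T)"
  proof (rule image_subsetI)
    fix y assume "y \<in> Y"
    then have "k (h y) \<notin> k ` S" "k (h y) \<notin> k ` T" using Y(2) ch(3) by auto
    then show "h y \<in> S2 - (S \<union> T)" using ch(1) by blast
  qed
  moreover have "a \<in> h ` Y" "b \<in> h ` Y"
    using Y ch(4)[of a] ch(4)[of b] a b q by (metis DiffD1 image_eqI)+
  ultimately show ?thesis
    unfolding connected_component_def by blast
qed

lemma empty_interior_Un_S2:
  assumes "closed X"
    and X: "\<And>U. openin (top_of_set S2) U \<Longrightarrow> U \<subseteq> X \<Longrightarrow> U = {}"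
    and Y: "\<And>U. openin (top_of_set S2) U \<Longrightarrow> U \<subseteq> Y \<Longrightarrow> U = {}"
    and U: "openin (top_of_set S2) U" "U \<subseteq> X \<union> Y"
  shows "U = {}"
proof -
  have "openin (top_of_set S2) (U - X)"
    using U(1) assms(1) by (simp add: Diff_eq openin_Int_open open_Compl)
  then have "U - X = {}" using Y U(2) by blast
  then show ?thesis using X U(1) by blast
qed

text \<open>A disc inside the arc would embed into an interval, contrary to invariance of
  dimension.\<close>

lemma empty_interior_arc_S2:
  fixes g :: "real \<Rightarrow> real^3"
  assumes "arc g" and U: "openin (top_of_set S2) U" "U \<subseteq> path_image g"
  shows "U = {}"
proof (rule ccontr)
  assume "U \<noteq> {}"
  then obtain q where q: "q \<in> U" by blast
  have qS: "q \<in> S2" using q U(1) openin_imp_subset by blast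
  obtain h k where hk: "homeomorphism (S2 - {q}) (UNIV :: complex set) k h"
    using sphere_chart[OF qS] by blast
  note ch = chartD[OF hk]
  have o: "openin (top_of_set S2) (U - {q})"
    using U(1) by (simp add: openin_delete)
  have "infinite U" using infinite_openin_S2 U(1) q by blast
  then have "\<not> U \<subseteq> {q}" using finite_subset by auto
  then obtain x where "x \<in> U - {q}" by blast
  moreover have "open (k ` (U - {q}))"
    by (rule chart_open_vimage[OF hk o]) auto
  ultimately obtain e where e: "e > 0" "ball (k x) e \<subseteq> k ` (U - {q})"
    by (meson imageI openE)
  have hU: "h ` ball (k x) e \<subseteq> U"
  proof (rule image_subsetI)
    fix y assume "y \<in> ball (k x) e"
    then obtain u where "u \<in> U - {q}" "y = k u" using e(2) by blast
    then show "h y \<in> U" using ch(4) U(1) openin_imp_subset by fastforce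
  qed
  have "path_image g homeomorphic {0..1::real}"
    by (rule homeomorphic_arc_image_interval[OF assms(1)]) simp
  then obtain f f' where ff: "homeomorphism (path_image g) {0..1::real} f f'"
    unfolding homeomorphic_def by blast
  have "aff_dim (ball (k x) e) \<le> aff_dim (UNIV :: real set)"
  proof (rule invariance_of_dimension_convex_domain)
    show "continuous_on (ball (k x) e) (f \<circ> h)"
      using hU U(2) homeomorphism_cont1[OF ff] ch(5)
      by (intro continuous_on_compose) (auto intro: continuous_on_subset)
    show "inj_on (f \<circ> h) (ball (k x) e)"
    proof (rule comp_inj_on)
      show "inj_on h (ball (k x) e)" using ch(7) inj_on_subset by blast
      have "inj_on f (path_image g)"
        using homeomorphism_apply1[OF ff] by (meson inj_on_inverseI)
      then show "inj_on f (h ` ball (k x) e)"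
        using hU U(2) by (meson inj_on_subset subset_trans)
    qed
  qed auto
  then show False using e(1) by (simp add: aff_dim_open)
qed

lemma simple_path_start_neq_half:
  assumes "simple_path g"
  shows "g 0 \<noteq> g (1/2)"
proof
  assume "g 0 = g (1/2)"
  moreover have "loop_free g" using assms simple_path_def by blast
  ultimately have "(0::real) = 1/2 \<or> (0::real) = 0 \<and> (1/2::real) = 1 \<or> (0::real) = 1 \<and> (1/2::real) = 0"
    unfolding loop_free_def by (metis atLeastAtMost_iff half_gt_zero_iff less_eq_real_def order_refl zero_less_one
        zero_le_one field_sum_of_halves add_le_same_cancel1 linorder_not_le)
  then show False by simp
qed

lemma empty_interior_simple_path_S2:
  fixes g :: "real \<Rightarrow> real^3"
  assumes "simple_path g" and U: "openin (top_of_set S2) U" "U \<subseteq> path_image g"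
  shows "U = {}"
proof (cases "arc g")
  case True
  then show ?thesis using empty_interior_arc_S2 U by blast
next
  case False
  then have loop: "pathfinish g = pathstart g"
    using assms(1) simple_path_eq_arc by blast
  note simple_path_start_neq_half[OF assms(1)]
  moreover have "g 0 \<in> path_image g" "g (1/2) \<in> path_image g"
    unfolding path_image_def by auto
  ultimately obtain u d where ud: "arc u" "arc d" "path_image u \<union> path_image d = path_image g"
    using exists_double_arc[OF assms(1) loop] by blast
  show ?thesis
  proof (rule empty_interior_Un_S2)
    show "closed (path_image u)" using ud closed_arc_image by blast
    show "openin (top_of_set S2) U" "U \<subseteq> path_image u \<union> path_image d"
      using U ud by auto
  qed (use empty_interior_arc_S2 ud in blast)+
qed

lemma chart_arc:
  assumes "homeomorphism (S2 - {q}) (UNIV :: complex set) k h" "path_image g \<subseteq> S2 - {q}"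
  shows "arc g \<Longrightarrow> arc (k \<circ> g)" and "simple_path g \<Longrightarrow> simple_path (k \<circ> g)"
proof -
  note ch = chartD[OF assms(1)]
  have inj: "inj_on k (path_image g)"
    using ch(4) assms(2) by (intro inj_on_inverseI[where g = h]) auto
  have cont: "continuous_on (path_image g) k"
    using ch(6) assms(2) continuous_on_subset by blast
  show "arc (k \<circ> g)" if "arc g"
    using that inj cont path_continuous_image[of g k] comp_inj_on[of g "{0..1}" k]
    unfolding arc_def path_image_def by auto
  show "simple_path (k \<circ> g)" if "simple_path g"
    using that inj path_continuous_image[OF _ cont]
    unfolding simple_path_def loop_free_def path_image_def inj_on_def by (fastforce simp: o_def)
qed

lemma connected_S2_arc_complement:
  fixes g :: "real \<Rightarrow> real^3"
  assumes "arc g" "path_image g \<subseteq> S2"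
  shows "connected (S2 - path_image g)"
proof -
  have cl: "closed (path_image g)" using assms(1) closed_arc_image by blast
  have "openin (top_of_set S2) S2" by simp
  then have "\<not> S2 \<subseteq> path_image g"
    using empty_interior_arc_S2[OF assms(1)] by fastforce
  then obtain q where q: "q \<in> S2" "q \<notin> path_image g" by blast
  obtain h k where hk: "homeomorphism (S2 - {q}) (UNIV :: complex set) k h"
    using sphere_chart[OF q(1)] by blast
  note ch = chartD[OF hk]
  have gq: "path_image g \<subseteq> S2 - {q}" using assms(2) q by blast
  have "connected (- path_image (k \<circ> g))"
    by (rule connected_arc_complement[OF chart_arc(1)[OF hk gq assms(1)]]) simp
  then have con: "connected (h ` (- path_image (k \<circ> g)))"
    using ch(5) by (metis connected_continuous_image continuous_on_subset subset_UNIV)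
  have eq: "h ` (- path_image (k \<circ> g)) = S2 - path_image g - {q}"
  proof (intro equalityI subsetI)
    fix x assume "x \<in> h ` (- path_image (k \<circ> g))"
    then obtain z where z: "x = h z" "z \<notin> k ` path_image g"
      by (auto simp: path_image_compose)
    have "h z \<notin> path_image g" using z(2) ch(3) by (metis imageI)
    then show "x \<in> S2 - path_image g - {q}" using z(1) ch(1,2) by auto
  next
    fix x assume x: "x \<in> S2 - path_image g - {q}"
    have "k x \<notin> k ` path_image g"
    proof
      assume "k x \<in> k ` path_image g"
      then obtain y where y: "y \<in> path_image g" "k x = k y" by blast
      moreover have "h (k y) = y" using y(1) gq ch(4)[of y] by blast
      moreover have "h (k x) = x" using x ch(4)[of x] by blast
      ultimately show False using x by auto
    qed
    then show "x \<in> h ` (- path_image (k \<circ> g))"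
      using x ch(4)[of x] by (metis ComplI DiffD1 DiffD2 image_eqI path_image_compose singletonI)
  qed
  show ?thesis
  \<comment> \<open>The chart shows the complement of the arc to be connected only without
    \<open>q\<close>, but \<open>q\<close> lies in the closure of the rest.\<close>
  proof (rule connected_intermediate_closure[OF con])
    show "h ` (- path_image (k \<circ> g)) \<subseteq> S2 - path_image g" using eq by blast
    show "S2 - path_image g \<subseteq> closure (h ` (- path_image (k \<circ> g)))"
      unfolding eq by (rule closure_openin_S2_diff_finite[OF openin_S2_Diff[OF cl]]) simp
  qed
qed

lemma simple_closed_curveD:
  assumes "simple_closed_curve C"
  shows "C \<subseteq> S2" "compact C" "closed C" "connected C" "C \<noteq> {}" "infinite C"
proof -
  obtain c where c: "simple_path c" "path_image c = C" and CS: "C \<subseteq> S2"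
    using assms unfolding simple_closed_curve_def by blast
  have "path c" using c simple_path_imp_path by blast
  show "C \<subseteq> S2" by fact
  show "compact C" using compact_path_image[OF \<open>path c\<close>] c by simp
  then show "closed C" using compact_imp_closed by blast
  show "connected C" using connected_path_image[OF \<open>path c\<close>] c by simp
  show "C \<noteq> {}" using c by (metis path_image_nonempty)
  note simple_path_start_neq_half[OF c(1)]
  moreover have "c 0 \<in> C" "c (1/2) \<in> C" using c(2) unfolding path_image_def by auto
  ultimately show "infinite C"
    using \<open>connected C\<close> connected_finite_iff_sing[of C] by auto
qed

text \<open>One side is the image of the bounded Jordan domain \<open>I\<close>. The other is taken
  to be the complement of the image of \<open>closure I\<close>, so that it contains
  \<open>q\<close> besides the image of \<open>J\<close>.\<close>

lemma Jordan_curve_S2: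
  assumes "simple_closed_curve C"
  obtains A B where "openin (top_of_set S2) A" "openin (top_of_set S2) B" "connected A" "connected B"
    "A \<noteq> {}" "B \<noteq> {}" "A \<inter> B = {}" "A \<union> B = S2 - C"
proof -
  obtain c where c: "simple_path c" "pathfinish c = pathstart c" "path_image c = C" and CS: "C \<subseteq> S2"
    using assms unfolding simple_closed_curve_def by blast
  have "openin (top_of_set S2) S2" by simp
  then have "\<not> S2 \<subseteq> C"
    using empty_interior_simple_path_S2[OF c(1)] c(3) by fastforce
  then obtain q where q: "q \<in> S2" "q \<notin> C" by blast
  obtain h k where hk: "homeomorphism (S2 - {q}) (UNIV :: complex set) k h"
    using sphere_chart[OF q(1)] by blast
  note ch = chartD[OF hk]
  have Cq: "path_image c \<subseteq> S2 - {q}" using CS c(3) q by auto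
  have loop: "pathfinish (k \<circ> c) = pathstart (k \<circ> c)"
    using c(2) by (simp add: pathfinish_def pathstart_def)
  obtain I J where IJ: "I \<noteq> {}" "open I" "connected I" "J \<noteq> {}" "open J" "connected J"
    "bounded I" "I \<inter> J = {}" "I \<union> J = - path_image (k \<circ> c)" "frontier I = path_image (k \<circ> c)"
    using Jordan_curve[OF chart_arc(2)[OF hk Cq c(1)] loop] by metis
  have pic: "path_image (k \<circ> c) = k ` C" using c(3) by (simp add: path_image_compose)
  have hkC: "h ` k ` C = C"
    using ch(4) CS q(2) by (force simp: image_image)
  have conth: "continuous_on X h" for X using ch(5) continuous_on_subset by blast
  let ?A = "h ` I" and ?B = "S2 - h ` (closure I)"
  have clI: "closure I = I \<union> k ` C"
    using IJ(10) IJ(2) pic by (auto simp: frontier_def interior_open closure_def)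
  have "compact (closure I)" using IJ(7) by simp
  then have cl: "closed (h ` closure I)"
    using compact_continuous_image[OF conth] compact_imp_closed by blast
  have B: "?B - {q} = h ` J"
  proof -
    have IJ': "I \<union> J = - k ` C" using IJ(9) pic by simp
    have "J = - (I \<union> k ` C)"
    proof (intro equalityI subsetI)
      show "x \<in> - (I \<union> k ` C)" if "x \<in> J" for x using that IJ' IJ(8) by blast
      show "x \<in> J" if "x \<in> - (I \<union> k ` C)" for x using that IJ' by blast
    qed
    then have "J = UNIV - closure I" by (simp add: clI Compl_eq_Diff_UNIV)
    then have "h ` J = range h - h ` closure I"
      by (simp add: image_set_diff[OF ch(7)])
    then show ?thesis unfolding ch(8) by (metis Diff_insert Diff_insert2)
  qed
  show thesis
  proof (rule that[of ?A ?B])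
    show "openin (top_of_set S2) ?A" by (rule chart_open_image[OF hk IJ(2)])
    show oB: "openin (top_of_set S2) ?B" by (rule openin_S2_Diff[OF cl])
    show "connected ?A" by (rule connected_continuous_image[OF conth IJ(3)])
    show "connected ?B"
    proof (rule connected_intermediate_closure)
      show "connected (h ` J)" by (rule connected_continuous_image[OF conth IJ(6)])
      show "h ` J \<subseteq> ?B" using B by blast
      show "?B \<subseteq> closure (h ` J)"
        unfolding B[symmetric] by (rule closure_openin_S2_diff_finite[OF oB]) simp
    qed
    show "?A \<noteq> {}" using IJ(1) by blast
    show "?B \<noteq> {}" using B IJ(4) by blast
    show "?A \<inter> ?B = {}" using closure_subset by blast
    show "?A \<union> ?B = S2 - C"
    proof -
      have "h ` closure I = h ` I \<union> C" using clI hkC by (metis image_Un)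
      moreover have "h ` I \<inter> C = {}"
      proof -
        have "I \<inter> k ` C = {}" using IJ(9) pic by blast
        then have "h ` I \<inter> h ` k ` C = {}" using ch(7) by (metis image_Int image_empty)
        then show ?thesis using hkC by simp
      qed
      moreover have "h ` I \<subseteq> S2" using ch(1) by blast
      ultimately show ?thesis by blast
    qed
  qed
qed

section \<open>Separation by curves\<close>

definition sep :: "(real^3) set \<Rightarrow> real^3 \<Rightarrow> real^3 \<Rightarrow> bool" where
  "sep X p q \<longleftrightarrow> p \<in> S2 - X \<and> q \<in> S2 - X \<and> \<not> connected_component (S2 - X) p q"

lemma sepD: "sep X p q \<Longrightarrow> p \<in> S2 \<and> q \<in> S2 \<and> p \<notin> X \<and> q \<notin> X"
  by (auto simp: sep_def)

lemma sep_commute: "sep X p q \<longleftrightarrow> sep X q p"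
  by (auto simp: sep_def connected_component_sym_eq)

lemma sep_mono: "sep X p q \<Longrightarrow> X \<subseteq> Y \<Longrightarrow> p \<notin> Y \<Longrightarrow> q \<notin> Y \<Longrightarrow> sep Y p q"
  unfolding sep_def using connected_component_of_subset[of "S2 - Y" p q "S2 - X"] by blast

lemma sep_cases: "sep X p q \<Longrightarrow> r \<in> S2 \<Longrightarrow> r \<notin> X \<Longrightarrow> sep X p r \<or> sep X r q"
  unfolding sep_def using connected_component_trans by blast

lemma sep_meets_connected:
  "sep X p q \<Longrightarrow> connected Y \<Longrightarrow> p \<in> Y \<Longrightarrow> q \<in> Y \<Longrightarrow> Y \<subseteq> S2 \<Longrightarrow> Y \<inter> X \<noteq> {}"
  unfolding sep_def connected_component_def by blast

lemma not_sep_connected: "connected Y \<Longrightarrow> p \<in> Y \<Longrightarrow> q \<in> Y \<Longrightarrow> Y \<subseteq> S2 - X \<Longrightarrow> \<not> sep X p q"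
  unfolding sep_def connected_component_def by blast

lemma sep_openI:
  assumes "openin (top_of_set S2) A" "openin (top_of_set S2) B" "A \<inter> B = {}" "S2 - X \<subseteq> A \<union> B"
    and "p \<in> A" "q \<in> B" "p \<notin> X" "q \<notin> X"
  shows "sep X p q"
proof -
  have AB: "A \<subseteq> S2" "B \<subseteq> S2" using assms(1,2) openin_imp_subset by blast+
  have "\<not> connected_component (S2 - X) p q"
  proof
    assume "connected_component (S2 - X) p q"
    then obtain Y where Y: "connected Y" "Y \<subseteq> S2 - X" "p \<in> Y" "q \<in> Y"
      unfolding connected_component_def by blast
    obtain A' B' where o: "open A'" "A = S2 \<inter> A'" "open B'" "B = S2 \<inter> B'"
      using assms(1,2) unfolding openin_open by blast
    have "Y \<subseteq> S2" using Y(2) by blast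
    have "A' \<inter> B' \<inter> Y = {}" using \<open>Y \<subseteq> S2\<close> o assms(3) by blast
    moreover have "Y \<subseteq> A' \<union> B'" using Y(2) assms(4) o by blast
    ultimately have "A' \<inter> Y = {} \<or> B' \<inter> Y = {}"
      using connectedD[OF Y(1) o(1,3)] by blast
    moreover have "p \<in> A'" "q \<in> B'" using assms(5,6) o by auto
    ultimately show False using Y(3,4) by blast
  qed
  then show ?thesis using AB assms unfolding sep_def by blast
qed

text \<open>Contrapositive of Janiszewski's theorem. The intersection is usually empty, a point or
  an arc, and then two pieces cannot jointly separate what neither separates.\<close>

lemma sep_Un:
  assumes "sep (S \<union> T) p q" "compact S" "compact T" "S \<subseteq> S2" "T \<subseteq> S2" "connected (S \<inter> T)"
  shows "sep S p q \<or> sep T p q"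
  using Janiszewski_S2[OF assms(2-6)] assms(1) unfolding sep_def by blast

lemma connected_subset_singleton: "X \<subseteq> {x} \<Longrightarrow> connected X"
  by (metis connected_empty connected_sing subset_singleton_iff)

lemma not_sep_empty: "\<not> sep {} p q"
proof -
  have "connected S2" by (rule connected_sphere) auto
  then show ?thesis using not_sep_connected[of S2 p q "{}"] sepD[of "{}" p q] by auto
qed

lemma not_sep_arc: "arc g \<Longrightarrow> path_image g \<subseteq> S2 \<Longrightarrow> \<not> sep (path_image g) p q"
  unfolding sep_def using connected_S2_arc_complement[of g] by (metis connected_iff_connected_component)

text \<open>The component of \<open>p\<close> off \<open>X\<close> is open, hence remains connected
  without \<open>V\<close>. Vertices added to a union of edges can thus be dropped again.\<close>

lemma sep_remove_finite:
  assumes "sep (X \<union> V) p q" "closed X" "finite V"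
  shows "sep X p q"
proof (rule ccontr)
  assume "\<not> sep X p q"
  then have cc: "connected_component (S2 - X) p q" using assms(1) unfolding sep_def by blast
  define U where "U = connected_component_set (S2 - X) p"
  have U: "U \<subseteq> S2 - X" "connected U" "p \<in> U" "q \<in> U" "openin (top_of_set S2) U"
    using cc connected_component_in[OF cc] openin_component_S2[OF assms(2)]
      connected_component_subset unfolding U_def by auto
  have "connected (U - V)"
    by (rule connected_openin_S2_diff_finite) (use U assms in auto)
  then show False
    using not_sep_connected[of "U - V" p q "X \<union> V"] U assms(1) sepD[OF assms(1)] by blast
qed

text \<open>A curve has only two sides. Hence a loop around one of the three points does not
  separate the two others.\<close>

lemma sep_side_unique:
  assumes "simple_closed_curve C" "sep C p q" "sep C p r"
  shows "\<not> sep C q r"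
proof -
  obtain A B where AB: "connected A" "connected B" "A \<union> B = S2 - C"
    using Jordan_curve_S2[OF assms(1)] by metis
  have pt: "p \<in> A \<union> B" "q \<in> A \<union> B" "r \<in> A \<union> B"
    using sepD[OF assms(2)] sepD[OF assms(3)] AB by auto
  have "\<not> sep C x y" if "x \<in> A \<and> y \<in> A \<or> x \<in> B \<and> y \<in> B" for x y
    using that not_sep_connected[OF AB(1)] not_sep_connected[OF AB(2)] AB(3) by blast
  then show ?thesis using pt assms(2,3) by blast
qed

text \<open>Both sides of the curve are open and so not contained in \<open>X\<close>. The resulting
  test points allow separation by \<open>C\<close> to be compared with separation by other subsets
  of \<open>X\<close>.\<close>

lemma curve_separates_off_nowhere_dense:
  assumes "simple_closed_curve C" "closed X"
    and X: "\<And>U. openin (top_of_set S2) U \<Longrightarrow> U \<subseteq> X \<Longrightarrow> U = {}"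
  obtains p q where "sep C p q" "p \<notin> X" "q \<notin> X"
proof -
  obtain A B where AB: "openin (top_of_set S2) A" "openin (top_of_set S2) B" "A \<noteq> {}" "B \<noteq> {}"
    "A \<inter> B = {}" "A \<union> B = S2 - C"
    using Jordan_curve_S2[OF assms(1)] by metis
  obtain p q where "p \<in> A - X" "q \<in> B - X"
    using X[OF AB(1)] X[OF AB(2)] AB(3,4) by blast
  then show thesis
    using that sep_openI[OF AB(1,2,5), of C p q] AB(6) by blast
qed

text \<open>A compact part of an arc on either side of \<open>w\<close> consists of two dangling pieces, so adding it to
  \<open>T\<close> does not separate any new pair of points (Janiszewski's theorem, once for each piece).\<close>

lemma path_gap:
  fixes g :: "real \<Rightarrow> real^3"
  assumes "simple_path g" "path_image g \<subseteq> S2" "compact T" "T \<subseteq> S2"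
    and gT: "path_image g \<inter> T \<subseteq> {pathstart g, pathfinish g}"
    and "closed D" "w \<in> path_image g" "w \<notin> D" "w \<noteq> pathstart g" "w \<noteq> pathfinish g"
  obtains E where "compact E" "E \<subseteq> path_image g" "w \<notin> E" "path_image g \<inter> D \<subseteq> E"
    "\<And>p q. sep (T \<union> E) p q \<Longrightarrow> sep T p q"
proof -
  have cg: "continuous_on {0..1} g" and inj: "\<And>x y. x \<in> {0..1} \<Longrightarrow> y \<in> {0..1} \<Longrightarrow> g x = g y \<Longrightarrow>
      x = y \<or> x = 0 \<and> y = 1 \<or> x = 1 \<and> y = 0"
    using assms(1) unfolding simple_path_def path_def loop_free_def by auto
  obtain t where t: "0 \<le> t" "t \<le> 1" "w = g t" using assms(7) by (auto simp: path_image_def)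
  have t01: "0 < t" "t < 1"
    using t assms(9,10) unfolding pathstart_def pathfinish_def by (metis less_eq_real_def)+
  have "\<exists>e>0. \<forall>s\<in>{0..1}. dist s t < e \<longrightarrow> g s \<notin> D"
  proof -
    have "open (- D)" "g t \<in> - D" using assms(6,8) t by auto
    then obtain r where r: "r > 0" "ball (g t) r \<subseteq> - D" using openE by blast
    obtain e where "e > 0" "\<forall>s\<in>{0..1}. dist s t < e \<longrightarrow> dist (g s) (g t) < r"
      using cg r(1) t unfolding continuous_on_iff by (metis atLeastAtMost_iff)
    moreover have "g s \<notin> D" if "dist (g s) (g t) < r" for s
      using that r(2) by (auto simp: dist_commute)
    ultimately show ?thesis by blast
  qed
  then obtain e where e: "e > 0" "\<And>s. s \<in> {0..1} \<Longrightarrow> dist s t < e \<Longrightarrow> g s \<notin> D" by blast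
  \<comment> \<open>Points of \<open>D\<close> have parameters at distance at least
    \<open>e > d\<close> from \<open>t\<close>, so the gap misses them; the other two bounds keep
    both remaining pieces nondegenerate.\<close>
  define d where "d = min (e/2) (min (t/2) ((1-t)/2))"
  have d: "0 < d" "d < e" "d < t" "t + d < 1"
    using e(1) t01 by (auto simp: d_def min_def field_simps)
  define E1 where "E1 = g ` {0..t-d}"
  define E2 where "E2 = g ` {t+d..1}"
  have E1: "E1 = path_image (subpath 0 (t-d) g)" "arc (subpath 0 (t-d) g)"
    using d t01 assms(1) by (auto simp: E1_def path_image_subpath intro: arc_simple_path_subpath_interior)
  have E2: "E2 = path_image (subpath (t+d) 1 g)" "arc (subpath (t+d) 1 g)"
    using d t01 assms(1) by (auto simp: E2_def path_image_subpath intro!: arc_simple_path_subpath_interior)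
  have sub: "E1 \<subseteq> path_image g" "E2 \<subseteq> path_image g"
    unfolding E1_def E2_def path_image_def using d t01 by auto
  have cp: "compact E1" "compact E2"
    using E1 E2 compact_arc_image by auto
  have "x = g 0" if "x \<in> E1" "x \<in> T" for x
  proof -
    obtain s where s: "0 \<le> s" "s \<le> t - d" "x = g s" using \<open>x \<in> E1\<close> E1_def by auto
    have "x = g 0 \<or> x = g 1"
      using gT that sub unfolding pathstart_def pathfinish_def by blast
    moreover have "s = 0" if "g s = g 1" using inj[of s 1] that s d t01 by auto
    ultimately show ?thesis using s by auto
  qed
  then have i1: "E1 \<inter> T \<subseteq> {g 0}" by blast
  \<comment> \<open>If the path is closed, the two pieces touch each other at
    \<open>g 0 = g 1\<close>, which is still a single point.\<close>
  have "x = g 1" if "x \<in> E2" "x \<in> T \<union> E1" for x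
  proof -
    obtain s where s: "t + d \<le> s" "s \<le> 1" "x = g s" using \<open>x \<in> E2\<close> E2_def by auto
    have "x = g 0 \<or> x = g 1 \<or> x \<in> E1"
      using gT that sub unfolding pathstart_def pathfinish_def by blast
    moreover have "s = 1" if "g s = g 0" using inj[of s 0] that s d t01 by auto
    moreover have "s = 1" if "g s \<in> E1"
      using that s d t01 inj[of s] unfolding E1_def by force
    ultimately show ?thesis using s by auto
  qed
  then have i2: "E2 \<inter> (T \<union> E1) \<subseteq> {g 1}" by blast
  show thesis
  proof (rule that[of "E1 \<union> E2"])
    show "compact (E1 \<union> E2)" using cp by blast
    show "E1 \<union> E2 \<subseteq> path_image g" using sub by blast
    show "w \<notin> E1 \<union> E2"
    proof
      assume "w \<in> E1 \<union> E2"
      then obtain s where "s \<in> {0..t-d} \<union> {t+d..1}" "g s = g t"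
        using t(3) unfolding E1_def E2_def by (metis (no_types, lifting) UnCI UnE imageE)
      then show False using inj[of s t] t d t01 by auto
    qed
    show "path_image g \<inter> D \<subseteq> E1 \<union> E2"
    proof
      fix x assume x: "x \<in> path_image g \<inter> D"
      then obtain s where s: "s \<in> {0..1}" "x = g s" by (auto simp: path_image_def)
      then have "\<not> dist s t < e" using e(2) x by blast
      then have "s \<le> t - d \<or> t + d \<le> s" using d by (auto simp: dist_real_def)
      then show "x \<in> E1 \<union> E2" using s unfolding E1_def E2_def by auto
    qed
    fix p q assume a: "sep (T \<union> (E1 \<union> E2)) p q"
    \<comment> \<open>The pieces are peeled off one at a time, since together they may meet
      \<open>T\<close> in two points, a disconnected set.\<close>
    have "sep (T \<union> E1) p q"
    proof (rule ccontr)
      assume n: "\<not> sep (T \<union> E1) p q"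
      have "sep E2 p q \<or> sep (T \<union> E1) p q"
      proof (rule sep_Un)
        show "connected (E2 \<inter> (T \<union> E1))" using connected_subset_singleton[OF i2] .
        show "sep (E2 \<union> (T \<union> E1)) p q" using a by (simp add: Un_ac)
      qed (use cp sub assms in auto)
      then show False using n not_sep_arc[OF E2(2)] E2(1) sub assms(2) by auto
    qed
    moreover have "sep (E1 \<union> T) p q \<Longrightarrow> sep E1 p q \<or> sep T p q"
      by (rule sep_Un) (use cp sub assms connected_subset_singleton[OF i1] in auto)
    ultimately show "sep T p q"
      using not_sep_arc[OF E1(2)] E1(1) sub assms(2) by (auto simp: Un_commute)
  qed
qed

section \<open>Curves inside curves and arcs, and cut points\<close>

text \<open>Away from a point \<open>w\<close> outside \<open>X\<close> the curve consists of two
  dangling pieces. By the case \<open>T = {}\<close> of \<open>path_gap\<close> they separate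
  nothing, and they contain \<open>X\<close>.\<close>

lemma not_sep_proper_subset:
  assumes "simple_closed_curve C" "closed X" "X \<subset> C" "p \<notin> C" "q \<notin> C"
  shows "\<not> sep X p q"
proof
  assume s: "sep X p q"
  obtain c where c: "simple_path c" "pathfinish c = pathstart c" "path_image c = C" and CS: "C \<subseteq> S2"
    using assms(1) unfolding simple_closed_curve_def by blast
  note CD = simple_closed_curveD[OF assms(1)]
  \<comment> \<open>The gap must not be at the base point of the parametrization. If only that point
    were missing from \<open>X\<close>, it would be isolated in the connected set
    \<open>C\<close>.\<close>
  have "\<not> C \<subseteq> X \<union> {pathstart c}"
  proof
    assume a: "C \<subseteq> X \<union> {pathstart c}"
    then have "pathstart c \<notin> X" using assms(3) by auto
    moreover have "pathstart c \<in> C" using c(3) pathstart_in_path_image by blast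
    moreover have "X \<noteq> {}" using a CD(6) finite_subset by auto
    ultimately show False
      using connected_closedD[OF CD(4), of X "{pathstart c}"] a assms(2,3) by auto
  qed
  then obtain w where w: "w \<in> C" "w \<notin> X" "w \<noteq> pathstart c" by blast
  have "\<exists>E. compact E \<and> E \<subseteq> path_image c \<and> path_image c \<inter> X \<subseteq> E \<and> (\<forall>p q. sep ({} \<union> E) p q \<longrightarrow> sep {} p q)"
    using path_gap[of c "{}" X w] c CS w assms(2) by (metis Int_empty_right compact_empty empty_subsetI)
  then obtain E where E: "E \<subseteq> C" "X \<subseteq> E" "\<And>p q. sep E p q \<Longrightarrow> sep {} p q"
    using c(3) assms(3) by auto
  have "sep E p q" using sep_mono[OF s E(2)] E(1) assms(4,5) by blast
  then show False using E(3) not_sep_empty by blast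
qed

text \<open>The inner curve separates two points off the outer one, which no closed proper subset of
  the outer one can do.\<close>

lemma curve_in_curve_eq:
  assumes "simple_closed_curve C" "simple_closed_curve Z" "C \<subseteq> Z"
  shows "C = Z"
proof (rule ccontr)
  assume "C \<noteq> Z"
  obtain c where c: "simple_path c" "path_image c = Z"
    using assms(2) unfolding simple_closed_curve_def by blast
  obtain p q where "sep C p q" "p \<notin> Z" "q \<notin> Z"
    using curve_separates_off_nowhere_dense[OF assms(1) simple_closed_curveD(3)[OF assms(2)]]
      empty_interior_simple_path_S2[OF c(1)] c(2) by metis
  then show False
    using not_sep_proper_subset[OF assms(2) simple_closed_curveD(3)[OF assms(1)]] \<open>C \<noteq> Z\<close> assms(3) by blast
qed

lemma no_curve_in_arc:
  assumes "arc g" "path_image g \<subseteq> S2" "C \<subseteq> path_image g"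
  shows "\<not> simple_closed_curve C"
proof
  assume C: "simple_closed_curve C"
  obtain p q where "sep C p q" "p \<notin> path_image g" "q \<notin> path_image g"
    using curve_separates_off_nowhere_dense[OF C closed_arc_image[OF assms(1)]]
      empty_interior_arc_S2[OF assms(1)] by metis
  then have "sep (path_image g) p q" using sep_mono assms(3) by blast
  then show False using not_sep_arc assms(1,2) by blast
qed

lemma connected_simple_closed_curve_delete:
  assumes "simple_closed_curve C"
  shows "connected (C - {w})"
proof (cases "w \<in> C")
  case False
  then show ?thesis using simple_closed_curveD(4)[OF assms] by simp
next
  case True
  obtain c where c: "simple_path c" "pathfinish c = pathstart c" "path_image c = C"
    using assms unfolding simple_closed_curve_def by blast
  obtain t where t: "0 \<le> t" "t \<le> 1" "w = c t" using True c(3) by (auto simp: path_image_def)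
  \<comment> \<open>Rotating the parametrization to begin at \<open>w\<close> makes the rest of the
    curve the image of an open interval.\<close>
  define f where "f = shiftpath t c"
  have f: "simple_path f" "path_image f = C" "f 0 = w" "f 1 = w"
    using simple_path_shiftpath[OF c(1,2)] path_image_shiftpath[OF _ c(2), of t] t c(2,3)
      pathstart_shiftpath[of t c] pathfinish_shiftpath[of t c]
    unfolding f_def pathstart_def pathfinish_def by auto
  have inj: "\<And>x y. x \<in> {0..1} \<Longrightarrow> y \<in> {0..1} \<Longrightarrow> f x = f y \<Longrightarrow>
      x = y \<or> x = 0 \<and> y = 1 \<or> x = 1 \<and> y = 0"
    using f(1) unfolding simple_path_def loop_free_def by auto
  have "C - {w} = f ` {0<..<1}"
  proof (intro equalityI subsetI)
    fix x assume x: "x \<in> C - {w}"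
    then obtain s where s: "s \<in> {0..1}" "x = f s" using f(2) by (auto simp: path_image_def)
    then have "s \<noteq> 0" "s \<noteq> 1" using x f by auto
    then show "x \<in> f ` {0<..<1}" using s by auto
  next
    fix x assume "x \<in> f ` {0<..<1}"
    then obtain s where s: "0 < s" "s < 1" "x = f s" by auto
    then have "f s \<noteq> f 0" using inj[of s 0] by auto
    then show "x \<in> C - {w}" using s f by (auto simp: path_image_def)
  qed
  moreover have "continuous_on {0<..<1} f"
    using f(1) unfolding simple_path_def path_def
    by (meson continuous_on_subset greaterThanLessThan_subseteq_atLeastAtMost_iff order_refl)
  ultimately show ?thesis
    by (metis connected_continuous_image connected_Ioo)
qed

text \<open>Without \<open>w\<close> the curve is still connected, hence contained in one of the
  sets, and \<open>w\<close> is a limit of the rest. This confines the curves in a drawing that has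
  a cut point.\<close>

lemma simple_closed_curve_cut_point:
  assumes "simple_closed_curve C" "closed X" "closed Y" "C \<subseteq> X \<union> Y" "X \<inter> Y \<subseteq> {w}"
  shows "C \<subseteq> X \<or> C \<subseteq> Y"
proof -
  have con: "connected (C - {w})" by (rule connected_simple_closed_curve_delete[OF assms(1)])
  have "X \<inter> (C - {w}) = {} \<or> Y \<inter> (C - {w}) = {}"
    using connected_closedD[OF con _ _ assms(2,3)] assms(4,5) by blast
  then have "C - {w} \<subseteq> X \<or> C - {w} \<subseteq> Y" using assms(4) by blast
  moreover have "w \<in> closure (C - {w})" if "w \<in> C"
  proof -
    note CD = simple_closed_curveD[OF assms(1)]
    have "C \<noteq> {a}" for a using CD(6) by auto
    then have "w islimpt C" using connected_imp_perfect[OF CD(4)] that by blast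
    then show ?thesis using closure_def islimpt_in_closure by blast
  qed
  moreover have "closure (C - {w}) \<subseteq> Z" if "C - {w} \<subseteq> Z" "closed Z" for Z
    using that closure_minimal by blast
  ultimately show ?thesis using assms(2,3) by blast
qed

text \<open>Take a minimal separating subfamily and one of its arcs \<open>e\<close>. If the ends of \<open>e\<close> are joined by an
  arc \<open>f\<close> in the union \<open>T\<close> of the others, then \<open>C = e \<union> f\<close> meets \<open>T\<close> in the connected set \<open>f\<close>, so
  Janiszewski's theorem forces \<open>C\<close> or \<open>T\<close> to separate. If they are not joined, the same theorem, applied
  to the two parts of \<open>T\<close>, shows that the family does not separate at all.\<close>

lemma separating_curve_in_arcs:
  fixes A :: "(real^3) set set" and \<gamma> :: "(real^3) set \<Rightarrow> real \<Rightarrow> real^3"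
  assumes "finite A"
    and "\<And>e. e \<in> A \<Longrightarrow> simple_path (\<gamma> e) \<and> path_image (\<gamma> e) = e \<and> e \<subseteq> S2"
    and "\<And>e e'. e \<in> A \<Longrightarrow> e' \<in> A \<Longrightarrow> e' \<noteq> e \<Longrightarrow> e \<inter> e' \<subseteq> {pathstart (\<gamma> e), pathfinish (\<gamma> e)}"
    and "sep (\<Union>A) p q"
  shows "\<exists>C \<subseteq> \<Union>A. simple_closed_curve C \<and> sep C p q"
  using assms
proof (induction A rule: finite_psubset_induct)
  case (psubset A)
  show ?case
  proof (cases "\<exists>B. B \<subset> A \<and> sep (\<Union>B) p q")
    case True
    then obtain B where B: "B \<subset> A" "sep (\<Union>B) p q" by blast
    have "\<exists>C \<subseteq> \<Union>B. simple_closed_curve C \<and> sep C p q"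
    proof (rule psubset.IH[OF B(1) _ _ B(2)])
      have sub: "e \<in> A" if "e \<in> B" for e using that B(1) by blast
      show "simple_path (\<gamma> e) \<and> path_image (\<gamma> e) = e \<and> e \<subseteq> S2" if "e \<in> B" for e
        by (rule psubset.prems(1)[OF sub[OF that]])
      show "e \<inter> e' \<subseteq> {pathstart (\<gamma> e), pathfinish (\<gamma> e)}" if "e \<in> B" "e' \<in> B" "e' \<noteq> e" for e e'
        by (rule psubset.prems(2)[OF sub[OF that(1)] sub[OF that(2)] that(3)])
    qed
    moreover have "\<Union>B \<subseteq> \<Union>A" using B(1) by (simp add: Union_mono psubset_imp_subset)
    ultimately show ?thesis by (meson subset_trans)
  next
    case False
    then have min: "\<And>B. B \<subset> A \<Longrightarrow> \<not> sep (\<Union>B) p q" by blast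
    have "A \<noteq> {}" using psubset.prems(3) not_sep_empty by auto
    then obtain e where e: "e \<in> A" by blast
    define g where "g = \<gamma> e"
    have g: "simple_path g" "path_image g = e"
      "\<And>e'. e' \<in> A \<Longrightarrow> e' \<noteq> e \<Longrightarrow> e \<inter> e' \<subseteq> {pathstart g, pathfinish g}"
      using psubset.prems(1,2) e unfolding g_def by auto
    have pc: "compact e'" "path_connected e'" "e' \<subseteq> S2" if "e' \<in> A" for e'
      using psubset.prems(1)[OF that] compact_simple_path_image[of "\<gamma> e'"]
        path_connected_path_image[OF simple_path_imp_path, of "\<gamma> e'"] by auto
    define T where "T = \<Union>(A - {e})"
    have AT: "\<Union>A = e \<union> T" using e T_def by blast
    have T: "compact T" "T \<subseteq> S2"
      using pc psubset.hyps(1) unfolding T_def by (auto intro!: compact_Union)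
    have nT: "\<not> sep T p q" unfolding T_def by (rule min) (use e in blast)
    have eT: "e \<inter> T \<subseteq> {pathstart g, pathfinish g}"
      using g(3) unfolding T_def by blast
    have eS: "e \<subseteq> S2" using pc e by blast
    have sepeT: "sep (e \<union> T) p q" using psubset.prems(3) AT by simp
    show ?thesis
    proof (cases "pathfinish g = pathstart g")
      case True
      then have "simple_closed_curve e"
        using g(1,2) eS unfolding simple_closed_curve_def by blast
      moreover have "sep e p q"
        using sep_Un[OF sepeT pc(1)[OF e] T(1) eS T(2)] nT connected_subset_singleton[of "e \<inter> T"] eT True
        by auto
      ultimately show ?thesis using e by blast
    next
      case False
      then have "arc g" using g(1) simple_path_eq_arc by blast
      then have ne: "\<not> sep e p q" using not_sep_arc g(2) eS by blast
      define x y where "x = pathstart g" and "y = pathfinish g"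
      have xy: "x \<noteq> y" "e \<inter> T \<subseteq> {x, y}" using False eT unfolding x_def y_def by auto
      show ?thesis
      proof (cases "path_component T x y")
        case True
        then obtain f0 where f0: "path f0" "path_image f0 \<subseteq> T" "pathstart f0 = x" "pathfinish f0 = y"
          unfolding path_component_def by blast
        obtain f where f: "arc f" "path_image f \<subseteq> path_image f0" "pathstart f = x" "pathfinish f = y"
          by (rule path_contains_arc[OF f0(1,3,4) xy(1)])
        define C where "C = e \<union> path_image f"
        have fT: "path_image f \<subseteq> T" using f(2) f0(2) by blast
        have xyf: "x \<in> path_image f" "y \<in> path_image f"
          using f(3,4) pathstart_in_path_image pathfinish_in_path_image by metis+
        have "simple_path (g +++ reversepath f)"
        proof (rule simple_path_join_loop)
          show "path_image g \<inter> path_image (reversepath f) \<subseteq> {pathstart g, pathstart (reversepath f)}"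
            using xy(2) g(2) fT f(4) unfolding x_def y_def by auto
        qed (use \<open>arc g\<close> f x_def y_def arc_reversepath in auto)
        moreover have "path_image (g +++ reversepath f) = C"
          using g(2) f(4) by (simp add: C_def path_image_join y_def)
        moreover have "C \<subseteq> S2" using eS fT T(2) C_def by blast
        ultimately have scc: "simple_closed_curve C"
          unfolding simple_closed_curve_def using f(3) x_def
          by (intro conjI exI[of _ "g +++ reversepath f"]) auto
        have "C \<inter> T = path_image f"
          using xy(2) fT xyf unfolding C_def by blast
        then have "connected (C \<inter> T)"
          using f(1) by (simp add: connected_arc_image)
        moreover have "C \<union> T = e \<union> T" using fT C_def by blast
        ultimately have "sep C p q"
          using sep_Un[of C T p q] sepeT nT T \<open>C \<subseteq> S2\<close> simple_closed_curveD(2)[OF scc] by auto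
        moreover have "C \<subseteq> \<Union>A" using AT fT C_def by blast
        ultimately show ?thesis using scc by blast
      next
        case False
        \<comment> \<open>Each remaining arc is path connected, so it lies in the path component of
          \<open>x\<close> or misses it.\<close>
        define A1 where "A1 = {e' \<in> A - {e}. e' \<subseteq> path_component_set T x}"
        define A2 where "A2 = (A - {e}) - A1"
        define T1 T2 where "T1 = \<Union>A1" and "T2 = \<Union>A2"
        have TT: "T = T1 \<union> T2" unfolding T_def T1_def T2_def A1_def A2_def by blast
        have disj: "z \<notin> path_component_set T x" if "z \<in> T2" for z
        proof
          assume z: "z \<in> path_component_set T x"
          obtain e' where e': "e' \<in> A - {e}" "z \<in> e'" "\<not> e' \<subseteq> path_component_set T x"
            using \<open>z \<in> T2\<close> unfolding T2_def A2_def A1_def by blast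
          have "e' \<subseteq> T" using e' unfolding T_def by blast
          then have "e' \<subseteq> path_component_set T z"
            using path_component_maximal[OF e'(2) pc(2)] e'(1) by blast
          moreover have "path_component_set T z = path_component_set T x"
            using z by (metis mem_Collect_eq path_component_eq)
          ultimately show False using e'(3) by simp
        qed
        have T1sub: "T1 \<subseteq> path_component_set T x" unfolding T1_def A1_def by blast
        have "y \<notin> T1" using T1sub False by blast
        then have i1: "e \<inter> T1 \<subseteq> {x}" using xy(2) TT by blast
        have "x \<notin> T2"
        proof
          assume "x \<in> T2"
          then have "x \<in> T" using TT by blast
          then show False using disj[OF \<open>x \<in> T2\<close>] path_component_refl by auto
        qed
        \<comment> \<open>Since \<open>y\<close> is not in \<open>T1\<close> and \<open>x\<close> is
          not in \<open>T2\<close>, joining first \<open>e\<close> and \<open>T1\<close>, then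
          \<open>T2\<close>, produces an intersection of at most one point each time.\<close>
        then have i2: "(e \<union> T1) \<inter> T2 \<subseteq> {y}" using xy(2) TT disj T1sub by blast
        have cp: "compact T1" "compact T2" "T1 \<subseteq> S2" "T2 \<subseteq> S2"
          using pc psubset.hyps(1) unfolding T1_def T2_def A1_def A2_def by (auto intro!: compact_Union)
        have n12: "\<not> sep T1 p q" "\<not> sep T2 p q"
          unfolding T1_def T2_def A1_def A2_def using e by (auto intro!: min)
        have "\<not> sep (e \<union> T1) p q"
          using sep_Un[of e T1 p q] pc(1)[OF e] cp eS ne n12 connected_subset_singleton[OF i1] by blast
        then have "\<not> sep ((e \<union> T1) \<union> T2) p q"
          using sep_Un[of "e \<union> T1" T2 p q] pc(1)[OF e] cp eS n12 connected_subset_singleton[OF i2] by blast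
        then show ?thesis using sepeT TT by (simp add: Un_assoc)
      qed
    qed
  qed
qed

section \<open>Embedded graphs\<close>

text \<open>A connected set with more than one point has no isolated points. What holds on an edge
  or curve off finitely many vertices thus passes to all of it.\<close>

lemma closure_diff_finite_of_connected:
  fixes X :: "'a::euclidean_space set"
  assumes "connected X" "infinite X" "finite V"
  shows "X \<subseteq> closure (X - V)"
proof
  fix x assume x: "x \<in> X"
  have "X \<noteq> {a}" for a using assms(2) by auto
  then have "x islimpt X" using connected_imp_perfect assms(1) x by blast
  then have "x islimpt ((X - V) \<union> (X \<inter> V))" by (metis Int_Diff_Un Un_commute)
  then have "x islimpt (X - V)"
    using assms(3) by (metis finite_Int islimpt_Un islimpt_finite)
  then show "x \<in> closure (X - V)" by (simp add: closure_def)
qed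

lemma open_arc_of_simple_path:
  assumes "simple_path g"
  shows "path_image g - {pathstart g, pathfinish g} = g ` {0<..<1}"
    and "connected (path_image g - {pathstart g, pathfinish g})"
proof -
  have inj: "\<And>x y. x \<in> {0..1} \<Longrightarrow> y \<in> {0..1} \<Longrightarrow> g x = g y \<Longrightarrow>
      x = y \<or> x = 0 \<and> y = 1 \<or> x = 1 \<and> y = 0"
    using assms unfolding simple_path_def loop_free_def by auto
  show eq: "path_image g - {pathstart g, pathfinish g} = g ` {0<..<1}"
  proof (intro equalityI subsetI)
    fix x assume x: "x \<in> path_image g - {pathstart g, pathfinish g}"
    then obtain s where s: "s \<in> {0..1}" "x = g s" by (auto simp: path_image_def)
    then have "s \<noteq> 0" "s \<noteq> 1" using x by (auto simp: pathstart_def pathfinish_def)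
    then show "x \<in> g ` {0<..<1}" using s by auto
  next
    fix x assume "x \<in> g ` {0<..<1}"
    then obtain s where s: "0 < s" "s < 1" "x = g s" by auto
    then have "g s \<noteq> g 0" "g s \<noteq> g 1" using inj[of s 0] inj[of s 1] by auto
    then show "x \<in> path_image g - {pathstart g, pathfinish g}"
      using s by (auto simp: path_image_def pathstart_def pathfinish_def)
  qed
  have "continuous_on {0<..<1} g"
    using assms unfolding simple_path_def path_def
    by (meson continuous_on_subset greaterThanLessThan_subseteq_atLeastAtMost_iff order_refl)
  then show "connected (path_image g - {pathstart g, pathfinish g})"
    unfolding eq by (metis connected_continuous_image connected_Ioo)
qed

lemma infinite_simple_path_image:
  fixes g :: "real \<Rightarrow> real^3"
  assumes "simple_path g"
  shows "infinite (path_image g)"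
proof -
  have "connected (path_image g)" using assms connected_simple_path_image by blast
  moreover have "g 0 \<in> path_image g" "g (1/2) \<in> path_image g" unfolding path_image_def by auto
  ultimately show ?thesis
    using simple_path_start_neq_half[OF assms] connected_finite_iff_sing[of "path_image g"] by auto
qed

definition edge_path :: "sphere_graph \<Rightarrow> (real^3) set \<Rightarrow> real \<Rightarrow> real^3" where
  "edge_path G e = (SOME g. simple_path g \<and> path_image g = e \<and> e \<inter> verts G = {pathstart g, pathfinish g})"

text \<open>All vertices are kept, so \<open>e\<close> meets \<open>rest G e\<close> exactly in its
  ends, as \<open>path_gap\<close> requires.\<close>

definition rest :: "sphere_graph \<Rightarrow> (real^3) set \<Rightarrow> (real^3) set" where
  "rest G e = verts G \<union> \<Union>(edges G - {e})"

text \<open>Adjacency of faces without reference to edges or vertices; \<open>face_adj_eq\<close>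
  identifies it with the adjacency behind the face distance.\<close>

definition face_adj :: "sphere_graph \<Rightarrow> (real^3) set rel" where
  "face_adj G = {(F, F'). F \<in> faces G \<and> F' \<in> faces G \<and> F \<noteq> F' \<and> closure F \<inter> closure F' \<noteq> {}}"

context
  fixes G :: sphere_graph
  assumes emb: "embedded_graph G"
begin

lemma graph_finite: "finite (verts G)" "finite (edges G)" and verts_S2: "verts G \<subseteq> S2"
  using emb by (auto simp: embedded_graph_def)

lemma edge_pathD:
  assumes "e \<in> edges G"
  shows "simple_path (edge_path G e)" "path_image (edge_path G e) = e"
    "e \<inter> verts G = {pathstart (edge_path G e), pathfinish (edge_path G e)}"
    "e \<subseteq> S2" "compact e" "connected e" "infinite e"
proof -
  have "\<exists>g. simple_path g \<and> path_image g = e \<and> e \<inter> verts G = {pathstart g, pathfinish g}" and "e \<subseteq> S2"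
    using emb assms unfolding embedded_graph_def by blast+
  note ex = this
  from ex(1) have *: "simple_path (edge_path G e) \<and> path_image (edge_path G e) = e \<and>
      e \<inter> verts G = {pathstart (edge_path G e), pathfinish (edge_path G e)}"
    unfolding edge_path_def by (rule someI_ex[where P = "\<lambda>g. simple_path g \<and> path_image g = e \<and>
      e \<inter> verts G = {pathstart g, pathfinish g}"])
  then show "simple_path (edge_path G e)" "path_image (edge_path G e) = e"
    "e \<inter> verts G = {pathstart (edge_path G e), pathfinish (edge_path G e)}" "e \<subseteq> S2"
    using \<open>e \<subseteq> S2\<close> by blast+
  show "compact e" "connected e" "infinite e"
    using * compact_simple_path_image connected_simple_path_image infinite_simple_path_image by metis+
qed

lemma edges_meet_in_verts: "e \<in> edges G \<Longrightarrow> e' \<in> edges G \<Longrightarrow> e \<noteq> e' \<Longrightarrow> e \<inter> e' \<subseteq> verts G"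
  using emb unfolding embedded_graph_def by blast

lemma support_facts: "support G \<subseteq> S2" "compact (support G)" "closed (support G)"
proof -
  show "support G \<subseteq> S2" using verts_S2 edge_pathD(4) unfolding support_def by blast
  have "compact (\<Union>(edges G))" using edge_pathD(5) graph_finite by (intro compact_Union) auto
  then show "compact (support G)"
    unfolding support_def using compact_Un finite_imp_compact[OF graph_finite(1)] by blast
  then show "closed (support G)" by (rule compact_imp_closed)
qed

lemma rest_facts:
  assumes "e \<in> edges G"
  shows "compact (rest G e)" "rest G e \<subseteq> S2" "rest G e \<union> e = support G"
    "e \<inter> rest G e = {pathstart (edge_path G e), pathfinish (edge_path G e)}"
    "rest G e \<inter> e = e \<inter> verts G"
proof -
  have "compact (\<Union>(edges G - {e}))" using edge_pathD(5) graph_finite by (intro compact_Union) auto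
  then show "compact (rest G e)"
    unfolding rest_def using compact_Un finite_imp_compact[OF graph_finite(1)] by blast
  show "rest G e \<subseteq> S2" using verts_S2 edge_pathD(4) unfolding rest_def by blast
  show "rest G e \<union> e = support G" unfolding rest_def support_def using assms by blast
  show *: "rest G e \<inter> e = e \<inter> verts G"
    unfolding rest_def using edges_meet_in_verts[OF assms] by blast
  show "e \<inter> rest G e = {pathstart (edge_path G e), pathfinish (edge_path G e)}"
    using * edge_pathD(3)[OF assms] by (simp add: Int_commute)
qed

lemma empty_interior_support:
  assumes "openin (top_of_set S2) U" "U \<subseteq> support G"
  shows "U = {}"
proof -
  have "U = {}" if "finite A" "A \<subseteq> edges G" "openin (top_of_set S2) U" "U \<subseteq> verts G \<union> \<Union>A" for A U
    using that
  proof (induction A arbitrary: U rule: finite_induct)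
    case empty
    then show ?case using infinite_openin_S2 graph_finite finite_subset by fastforce
  next
    case (insert e A)
    show ?case
    proof (rule empty_interior_Un_S2)
      show "closed e" using insert.prems edge_pathD(5) compact_imp_closed by blast
      show "U' = {}" if "openin (top_of_set S2) U'" "U' \<subseteq> e" for U'
        using empty_interior_simple_path_S2[of "edge_path G e" U'] edge_pathD[of e] insert.prems that by auto
      show "U' = {}" if "openin (top_of_set S2) U'" "U' \<subseteq> verts G \<union> \<Union>A" for U'
        using insert.IH that insert.prems(1) by blast
      show "openin (top_of_set S2) U" by fact
      show "U \<subseteq> e \<union> (verts G \<union> \<Union>A)" using insert.prems by auto
    qed
  qed
  then show ?thesis using graph_finite assms unfolding support_def by blast
qed

lemma faceD:
  assumes "F \<in> faces G"
  shows "openin (top_of_set S2) F" "connected F" "F \<noteq> {}" "F \<subseteq> S2 - support G" "closure F \<subseteq> S2"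
    "closure F \<subseteq> F \<union> support G"
proof -
  obtain x where x: "x \<in> S2 - support G" "F = connected_component_set (S2 - support G) x"
    using assms unfolding faces_def components_iff by blast
  show "openin (top_of_set S2) F"
    unfolding x(2) by (rule openin_component_S2[OF support_facts(3)])
  show "connected F" "F \<noteq> {}" "F \<subseteq> S2 - support G"
    using assms unfolding faces_def
    by (auto dest: in_components_connected in_components_nonempty in_components_subset)
  then show S: "closure F \<subseteq> S2"
    using closure_minimal[of F S2] closed_sphere by blast
  have "closedin (top_of_set (S2 - support G)) F"
    using assms closedin_component unfolding faces_def by blast
  then obtain T where "closed T" "F = (S2 - support G) \<inter> T"
    unfolding closedin_closed by blast
  then have "closure F \<inter> (S2 - support G) \<subseteq> F"
    using closure_minimal[of F T] by blast
  then show "closure F \<subseteq> F \<union> support G" using S by blast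
qed

text \<open>Some face \<open>F\<close> of the family has a point \<open>r\<close> in the component
  \<open>U\<close> of \<open>z\<close> off \<open>T\<close>, and \<open>U\<close> contains the open
  edge. Suppose that \<open>w\<close> on the open edge is not in \<open>closure F\<close>. With
  \<open>D = closure F\<close> in \<open>path_gap\<close>, the set \<open>T \<union> E\<close>
  contains the boundary of \<open>F\<close> and so separates \<open>r\<close> from \<open>w\<close>.
  Then \<open>T\<close> alone separates them, although both lie in \<open>U\<close>.\<close>

lemma edge_subset_closure_face:
  assumes e: "e \<in> edges G" and z: "z \<in> e" "z \<notin> verts G"
    and FF: "FF \<subseteq> faces G" "z \<in> closure (\<Union>FF)"
  shows "\<exists>F\<in>FF. e \<subseteq> closure F"
proof -
  define T where "T = rest G e"
  note Tf = rest_facts[OF e, folded T_def] and ef = edge_pathD[OF e]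
  let ?g = "edge_path G e"
  have zT: "z \<notin> T" using z Tf(5) by blast
  define U where "U = connected_component_set (S2 - T) z"
  have "openin (top_of_set S2) U"
    unfolding U_def by (rule openin_component_S2[OF compact_imp_closed[OF Tf(1)]])
  then obtain W where W: "open W" "U = S2 \<inter> W" unfolding openin_open by blast
  have "z \<in> U" unfolding U_def using zT z ef(4) by auto
  then have "W \<inter> \<Union>FF \<noteq> {}"
    using FF(2) W by (metis IntD2 closure_iff_nhds_not_empty inf_commute order_refl)
  then obtain r F where r: "r \<in> W" "r \<in> F" "F \<in> FF" by blast
  have F: "F \<in> faces G" using FF r by blast
  note Ff = faceD[OF F]
  have rU: "r \<in> U" using r W Ff(4) by blast
  have oe: "e - {pathstart ?g, pathfinish ?g} \<subseteq> U"
    unfolding U_def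
  proof (rule connected_component_maximal)
    show "z \<in> e - {pathstart ?g, pathfinish ?g}" using z ef(3) by blast
    show "connected (e - {pathstart ?g, pathfinish ?g})"
      using open_arc_of_simple_path(2)[OF ef(1)] ef(2) by simp
    show "e - {pathstart ?g, pathfinish ?g} \<subseteq> S2 - T"
      using Tf(4) ef(4) by blast
  qed
  have "w \<in> closure F" if w: "w \<in> e - {pathstart ?g, pathfinish ?g}" for w
  proof (rule ccontr)
    assume wF: "w \<notin> closure F"
    obtain E where E: "compact E" "E \<subseteq> e" "w \<notin> E" "e \<inter> closure F \<subseteq> E"
      "\<And>p q. sep (T \<union> E) p q \<Longrightarrow> sep T p q"
    proof (rule path_gap[OF ef(1) _ Tf(1,2) _ closed_closure _ wF], unfold ef(2))
      show "e \<subseteq> S2" by (rule ef(4))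
      show "e \<inter> T \<subseteq> {pathstart ?g, pathfinish ?g}" using Tf(4) by simp
      show "w \<in> e" "w \<noteq> pathstart ?g" "w \<noteq> pathfinish ?g" using w by auto
    qed (rule that)
    have "sep (T \<union> E) r w"
    proof (rule sep_openI)
      show "openin (top_of_set S2) F" by (rule Ff(1))
      show "openin (top_of_set S2) (S2 - closure F)" by (rule openin_S2_Diff) simp
      show "F \<inter> (S2 - closure F) = {}" using closure_subset by blast
      show "S2 - (T \<union> E) \<subseteq> F \<union> (S2 - closure F)"
        using Ff(6) E(4) Tf(3) by blast
      show "r \<in> F" by (rule r(2))
      show "w \<in> S2 - closure F" using wF w ef(4) by blast
      show "r \<notin> T \<union> E" using r(2) Ff(4) Tf(3) E(2) by blast
      show "w \<notin> T \<union> E" using E(3) w Tf(4) by blast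
    qed
    then have "sep T r w" by (rule E(5))
    moreover have "connected U" "U \<subseteq> S2 - T" unfolding U_def using connected_component_subset by auto
    ultimately show False
      using not_sep_connected[of U r w T] rU oe w by blast
  qed
  then have "e - {pathstart ?g, pathfinish ?g} \<subseteq> closure F" by blast
  then have "closure (e - {pathstart ?g, pathfinish ?g}) \<subseteq> closure F"
    using closure_minimal closed_closure by blast
  then have "e \<subseteq> closure F"
    using closure_diff_finite_of_connected[OF ef(6,7), of "{pathstart ?g, pathfinish ?g}"] by blast
  then show ?thesis using r(3) by blast
qed

lemma edge_has_vertex: "e \<in> edges G \<Longrightarrow> \<exists>v\<in>verts G. v \<in> e"
  using edge_pathD(3) by blast

lemma faces_disjoint: "F \<in> faces G \<Longrightarrow> F' \<in> faces G \<Longrightarrow> F \<noteq> F' \<Longrightarrow> F \<inter> F' = {}"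
  unfolding faces_def using components_nonoverlap by blast

lemma faces_cover: "x \<in> S2 - support G \<Longrightarrow> \<exists>F\<in>faces G. x \<in> F"
  unfolding faces_def by (metis UnionE Union_components)

text \<open>Disjoint open faces can touch only in the support. If they touch inside an edge, both
  closures contain the whole edge and therefore its ends, so sharing an edge is a special case of
  sharing a vertex.\<close>

lemma face_adj_eq: "dual_adj G \<union> vertex_adj G = face_adj G"
proof (intro equalityI subsetI)
  fix x assume "x \<in> dual_adj G \<union> vertex_adj G"
  then show "x \<in> face_adj G"
    unfolding dual_adj_def vertex_adj_def face_adj_def using edge_has_vertex by auto
next
  fix x assume "x \<in> face_adj G"
  then obtain F F' z where x: "x = (F, F')" "F \<in> faces G" "F' \<in> faces G" "F \<noteq> F'"
    "z \<in> closure F" "z \<in> closure F'"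
    unfolding face_adj_def by blast
  have disj: "F \<inter> F' = {}" using x faces_disjoint by blast
  have no: "z \<notin> A" if AB: "z \<in> closure B" "A \<inter> B = {}" "openin (top_of_set S2) A" "B \<subseteq> S2"
    for A B :: "(real^3) set"
  proof
    assume "z \<in> A"
    obtain W where W: "open W" "A = S2 \<inter> W" using AB(3) unfolding openin_open by blast
    then have "W \<inter> B = {}" using AB(2,4) by blast
    then have "W \<inter> closure B = {}" using W(1) open_Int_closure_eq_empty by blast
    then show False using \<open>z \<in> A\<close> W(2) AB(1) by blast
  qed
  have "z \<notin> F"
    using no[OF x(6) disj faceD(1)[OF x(2)]] faceD(4)[OF x(3)] by blast
  then have "z \<in> support G" using faceD(6)[OF x(2)] x(5) by blast
  then consider "z \<in> verts G" | e where "e \<in> edges G" "z \<in> e" "z \<notin> verts G"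
    unfolding support_def by blast
  then have "\<exists>v\<in>verts G. v \<in> closure F \<and> v \<in> closure F'"
  proof cases
    case 1
    then show ?thesis using x by blast
  next
    case 2
    have "e \<subseteq> closure F" "e \<subseteq> closure F'"
      using edge_subset_closure_face[OF 2, of "{F}"] edge_subset_closure_face[OF 2, of "{F'}"] x by auto
    then show ?thesis using edge_has_vertex[OF 2(1)] by blast
  qed
  then show "x \<in> dual_adj G \<union> vertex_adj G"
    using x unfolding vertex_adj_def by blast
qed

text \<open>The point is that \<open>C\<close> contains every edge of which it contains an inner
  point \<open>z\<close>. If it missed another inner point \<open>w\<close>, a gap at
  \<open>w\<close> would give \<open>C \<subseteq> T \<union> E\<close> with
  \<open>T = C \<inter> rest G e\<close>, so already \<open>T\<close> would separate; but
  \<open>T\<close> is a closed proper subset of \<open>C\<close>.\<close>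

lemma simple_loop_iff: "simple_loop G C \<longleftrightarrow> simple_closed_curve C \<and> C \<subseteq> support G"
proof
  assume "simple_loop G C"
  then show "simple_closed_curve C \<and> C \<subseteq> support G"
    unfolding simple_loop_def support_def by blast
next
  assume C: "simple_closed_curve C \<and> C \<subseteq> support G"
  then have scc: "simple_closed_curve C" and CK: "C \<subseteq> support G" by auto
  note CD = simple_closed_curveD[OF scc]
  define A where "A = {e \<in> edges G. e \<subseteq> C}"
  have whole: "e \<subseteq> C" if e: "e \<in> edges G" and z: "z \<in> e" "z \<notin> verts G" "z \<in> C" for e z
  proof -
    define T where "T = C \<inter> rest G e"
    note ef = edge_pathD[OF e] and rf = rest_facts[OF e]
    let ?g = "edge_path G e"
    have T: "compact T" "T \<subseteq> S2" unfolding T_def using CD rf(1,2) by (auto intro: closed_Int_compact)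
    have eT: "e \<inter> T \<subseteq> {pathstart ?g, pathfinish ?g}" using rf(4) unfolding T_def by blast
    have zT: "z \<notin> T" using z rf(5) unfolding T_def by blast
    have "w \<in> C" if w: "w \<in> e - {pathstart ?g, pathfinish ?g}" for w
    proof (rule ccontr)
      assume wC: "w \<notin> C"
      obtain E where E: "compact E" "E \<subseteq> e" "w \<notin> E" "e \<inter> C \<subseteq> E"
        "\<And>p q. sep (T \<union> E) p q \<Longrightarrow> sep T p q"
      proof (rule path_gap[OF ef(1) _ T _ CD(3) _ wC], unfold ef(2))
        show "e \<subseteq> S2" by (rule ef(4))
        show "e \<inter> T \<subseteq> {pathstart ?g, pathfinish ?g}" by (rule eT)
        show "w \<in> e" "w \<noteq> pathstart ?g" "w \<noteq> pathfinish ?g" using w by auto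
      qed (rule that)
      obtain p q where pq: "sep C p q" "p \<notin> support G" "q \<notin> support G"
        using curve_separates_off_nowhere_dense[OF scc support_facts(3) empty_interior_support] by blast
      have sub: "T \<union> E \<subseteq> support G" "C \<subseteq> T \<union> E"
        using rf(3) E(2,4) CK unfolding T_def by blast+
      have "sep (T \<union> E) p q"
        by (rule sep_mono[OF pq(1) sub(2)]) (use sub(1) pq in auto)
      then have "sep T p q" by (rule E(5))
      moreover have "T \<subset> C" using zT z(3) unfolding T_def by blast
      ultimately show False
        using not_sep_proper_subset[OF scc compact_imp_closed[OF T(1)]] pq CK by blast
    qed
    then have "e - {pathstart ?g, pathfinish ?g} \<subseteq> C" by blast
    then have "closure (e - {pathstart ?g, pathfinish ?g}) \<subseteq> C"
      using closure_minimal CD(3) by blast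
    then show ?thesis
      using closure_diff_finite_of_connected[OF ef(6,7), of "{pathstart ?g, pathfinish ?g}"] by blast
  qed
  have "C - verts G \<subseteq> \<Union>A"
  proof
    fix z assume z: "z \<in> C - verts G"
    then obtain e where "e \<in> edges G" "z \<in> e" using CK unfolding support_def by blast
    then show "z \<in> \<Union>A" using whole[of e z] z unfolding A_def by auto
  qed
  moreover have "closed (\<Union>A)"
    using edge_pathD(5) graph_finite unfolding A_def by (intro closed_Union) (auto intro: compact_imp_closed)
  ultimately have "closure (C - verts G) \<subseteq> \<Union>A" by (rule closure_minimal)
  then have "C \<subseteq> \<Union>A"
    using closure_diff_finite_of_connected[OF CD(4,6) graph_finite(1)] by blast
  then have "C = \<Union>A" unfolding A_def by auto
  moreover have "A \<subseteq> edges G" unfolding A_def by blast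
  ultimately show "simple_loop G C" using scc unfolding simple_loop_def by blast
qed

lemma finite_loops: "finite {C. simple_closed_curve C \<and> C \<subseteq> support G}"
proof (rule finite_subset)
  show "{C. simple_closed_curve C \<and> C \<subseteq> support G} \<subseteq> Union ` Pow (edges G)"
  proof
    fix C assume "C \<in> {C. simple_closed_curve C \<and> C \<subseteq> support G}"
    then have "simple_loop G C" using simple_loop_iff by simp
    then obtain A where "A \<subseteq> edges G" "C = \<Union>A" unfolding simple_loop_def by metis
    then show "C \<in> Union ` Pow (edges G)" by simp
  qed
qed (use graph_finite in auto)

text \<open>A common point inside an edge belongs to no other edge, so both curves contain that edge
  and share its ends.\<close>

lemma loops_disjoint_iff:
  assumes "simple_loop G C" "simple_loop G D"
  shows "C \<inter> D \<inter> verts G = {} \<longleftrightarrow> C \<inter> D = {}"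
proof -
  have "\<exists>v. v \<in> C \<inter> D \<inter> verts G" if z: "z \<in> C \<inter> D" for z
  proof -
    obtain A B where AB: "A \<subseteq> edges G" "C = \<Union>A" "B \<subseteq> edges G" "D = \<Union>B"
      using assms unfolding simple_loop_def by metis
    obtain e where e: "e \<in> edges G" "z \<in> e" "e \<subseteq> C" using AB z by auto
    obtain e' where e': "e' \<in> edges G" "z \<in> e'" "e' \<subseteq> D" using AB z by auto
    show ?thesis
    proof (cases "e = e'")
      case True
      then show ?thesis using e e' edge_has_vertex[OF e(1)] by blast
    next
      case False
      then show ?thesis using edges_meet_in_verts[OF e(1) e'(1)] e e' by blast
    qed
  qed
  then show ?thesis by blast
qed

end

section \<open>Packings of curves and face distance\<close>

definition packing :: "(real^3) set \<Rightarrow> ((real^3) set \<Rightarrow> bool) \<Rightarrow> (real^3) set set \<Rightarrow> bool" where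
  "packing K Q L \<longleftrightarrow> finite L \<and> (\<forall>C\<in>L. simple_closed_curve C \<and> C \<subseteq> K \<and> Q C) \<and> pairwise disjnt L"

text \<open>A relation rather than a function: existence of the maximum is part of what is proved,
  and the same notion serves for the \<open>M_i\<close> and for the distances.\<close>

definition max_packing :: "(real^3) set \<Rightarrow> ((real^3) set \<Rightarrow> bool) \<Rightarrow> nat \<Rightarrow> bool" where
  "max_packing K Q n \<longleftrightarrow> (\<exists>L. packing K Q L \<and> card L = n) \<and> (\<forall>L. packing K Q L \<longrightarrow> card L \<le> n)"

definition encircles :: "(3 \<Rightarrow> real^3) \<Rightarrow> 3 \<Rightarrow> (real^3) set \<Rightarrow> bool" where
  "encircles P i C \<longleftrightarrow> sep C (P i) (P (i + 1)) \<and> sep C (P i) (P (i + 2))"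

lemma max_packing_unique: "max_packing K Q m \<Longrightarrow> max_packing K Q n \<Longrightarrow> m = n"
  unfolding max_packing_def by (metis le_antisym)

lemma max_packing_le:
  assumes "max_packing K Q m" "max_packing K Q' n" "\<And>C. simple_closed_curve C \<Longrightarrow> Q C \<Longrightarrow> Q' C"
  shows "m \<le> n"
proof -
  obtain L where "packing K Q L" "card L = m" using assms(1) max_packing_def by auto
  moreover have "packing K Q' L" using calculation(1) assms(3) unfolding packing_def by blast
  ultimately show ?thesis using assms(2) max_packing_def by auto
qed

lemma packing_family:
  assumes "\<And>k. k < (n::nat) \<Longrightarrow> simple_closed_curve (c k) \<and> c k \<subseteq> K \<and> Q (c k)"
    and "\<And>j k. j < k \<Longrightarrow> k < n \<Longrightarrow> c j \<inter> c k = {}"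
  shows "packing K Q (c ` {..<n})" "card (c ` {..<n}) = n"
proof -
  have disj: "c j \<inter> c k = {}" if "j \<noteq> k" "j < n" "k < n" for j k
    using assms(2)[of j k] assms(2)[of k j] that by (cases "j < k") auto
  then have "inj_on c {..<n}"
    using assms(1) simple_closed_curveD(5) by (intro inj_onI) (metis Int_absorb lessThan_iff)
  then show "card (c ` {..<n}) = n" by (simp add: card_image)
  show "packing K Q (c ` {..<n})"
    unfolding packing_def pairwise_def disjnt_def
  proof (intro conjI ballI impI)
    fix C D assume CD: "C \<in> c ` {..<n}" "D \<in> c ` {..<n}" "C \<noteq> D"
    then obtain j k where "C = c j" "j < n" "D = c k" "k < n" by auto
    then show "C \<inter> D = {}" using disj[of j k] CD(3) by auto
  qed (use assms(1) in auto)
qed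

text \<open>Each curve has to cross \<open>Y\<close>, and disjoint curves do so at different points
  of \<open>W\<close>. Chains of faces and pieces of the real axis are used as
  \<open>Y\<close>.\<close>

lemma packing_le_connected:
  assumes L: "packing K (\<lambda>C. sep C p q) L" and Y: "connected Y" "p \<in> Y" "q \<in> Y" "Y \<subseteq> S2"
    and W: "Y \<inter> K \<subseteq> W" "finite W"
  shows "card L \<le> card W"
proof -
  have "\<exists>x. x \<in> W \<and> x \<in> C" if "C \<in> L" for C
  proof -
    have "sep C p q" "C \<subseteq> K" using that L unfolding packing_def by auto
    then have "Y \<inter> C \<noteq> {}" using sep_meets_connected[of C p q Y] Y by auto
    then show ?thesis using W(1) \<open>C \<subseteq> K\<close> by auto
  qed
  then obtain x where x: "\<And>C. C \<in> L \<Longrightarrow> x C \<in> W \<and> x C \<in> C" by metis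
  have "inj_on x L"
    using x L unfolding packing_def pairwise_def disjnt_def by (intro inj_onI) (metis IntI empty_iff)
  then show ?thesis using x W(2) by (intro card_inj_on_le) auto
qed

lemma index3: "(i::3) + 1 + 1 = i + 2" "i + 1 + 2 = i" "i + 2 + 1 = i" "i + 2 + 2 = i + 1"
    "i \<noteq> i + 1" "i \<noteq> i + 2" "i + 1 \<noteq> i + 2" "i + 1 \<noteq> i" "i + 2 \<noteq> i" "i + 2 \<noteq> i + 1"
    "j = i \<or> j = i + 1 \<or> j = i + 2"
proof -
  have a: "(1::3) + 1 = 2" "(1::3) + 2 = 0" "(2::3) + 1 = 0" "(2::3) + 2 = 1" by simp_all
  have n: "(1::3) \<noteq> 0" "(2::3) \<noteq> 0" "(2::3) \<noteq> 1" by simp_all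
  show "i + 1 + 1 = i + 2" "i + 1 + 2 = i" "i + 2 + 1 = i" "i + 2 + 2 = i + 1"
    using a by (simp_all add: add.assoc)
  show "i \<noteq> i + 1" "i \<noteq> i + 2" "i + 1 \<noteq> i + 2" "i + 1 \<noteq> i" "i + 2 \<noteq> i" "i + 2 \<noteq> i + 1"
    using n by auto
  show "j = i \<or> j = i + 1 \<or> j = i + 2"
    using exhaust_3[of i] exhaust_3[of j] by auto
qed

text \<open>The complement has exactly two components, so the definite descriptions in
  \<open>side_with\<close> and \<open>side_without\<close> are determined by the membership of the
  points in \<open>A\<close>.\<close>

lemma curve_of_type_iff:
  assumes "simple_closed_curve C" "range P \<subseteq> S2"
  shows "curve_of_type P i C \<longleftrightarrow> encircles P i C"
proof -
  obtain A B where AB: "openin (top_of_set S2) A" "openin (top_of_set S2) B" "connected A" "connected B"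
    "A \<noteq> {}" "B \<noteq> {}" "A \<inter> B = {}" "A \<union> B = S2 - C"
    using Jordan_curve_S2[OF assms(1)] by metis
  have sepAB: "sep C p q" if "p \<in> A \<and> q \<in> B \<or> p \<in> B \<and> q \<in> A" for p q
  proof -
    have 1: "sep C p q" if "p \<in> A" "q \<in> B" for p q
      by (rule sep_openI[OF AB(1,2,7)]) (use that AB(8) in auto)
    then show ?thesis using that sep_commute by blast
  qed
  have nsep: "\<not> sep C p q" if "p \<in> A \<and> q \<in> A \<or> p \<in> B \<and> q \<in> B" for p q
    using that not_sep_connected[OF AB(3)] not_sep_connected[OF AB(4)] AB(8) by blast
  have comp: "connected_component_set (S2 - C) p = U"
    if "U = A \<and> V = B \<or> U = B \<and> V = A" "p \<in> U" for U V p
  proof (intro equalityI)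
    have U: "connected U" "U \<subseteq> S2 - C" "U \<union> V = S2 - C" using that AB by auto
    show "U \<subseteq> connected_component_set (S2 - C) p"
      by (rule connected_component_maximal) (use U that in auto)
    show "connected_component_set (S2 - C) p \<subseteq> U"
    proof
      fix x assume "x \<in> connected_component_set (S2 - C) p"
      then have x: "connected_component (S2 - C) p x" by simp
      then have "\<not> sep C p x" unfolding sep_def by blast
      moreover have "x \<in> U \<union> V" using U(3) connected_component_in[OF x] by blast
      ultimately show "x \<in> U" using sepAB[of p x] that by blast
    qed
  qed
  have comps: "components (S2 - C) = {A, B}"
  proof (intro equalityI subsetI)
    fix K assume "K \<in> components (S2 - C)"
    then obtain x where x: "x \<in> A \<union> B" "K = connected_component_set (S2 - C) x"
      unfolding components_iff AB(8) by blast
    then show "K \<in> {A, B}" using comp[of A B x] comp[of B A x] by auto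
  next
    fix K assume K: "K \<in> {A, B}"
    then obtain x where x: "x \<in> K" using AB(5,6) by blast
    then have "K = connected_component_set (S2 - C) x" "x \<in> S2 - C"
      using K comp[of A B x] comp[of B A x] AB(8) by auto
    then show "K \<in> components (S2 - C)" unfolding components_iff by blast
  qed
  have sides: "side_with p C = (if p \<in> A then A else B)" "side_without p C = (if p \<in> A then B else A)"
    if "p \<in> A \<union> B" for p
    unfolding side_with_def side_without_def comps using that AB(7) by (auto intro!: the_equality)
  have AneB: "A \<noteq> B" using AB(5,7) by blast
  have *: "curve_of_type P i C \<longleftrightarrow> encircles P i C" if "\<forall>j. P j \<notin> C"
  proof -
    have inAB: "P j \<in> A \<union> B" for j using that assms(2) AB(8) by blast
    then have iff: "sep C (P j) (P k) \<longleftrightarrow> (P j \<in> A) \<noteq> (P k \<in> A)" for j k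
      using sepAB[of "P j" "P k"] nsep[of "P j" "P k"] AB(7) by blast
    show ?thesis
      unfolding curve_of_type_def encircles_def iff using assms(1) that AneB sides[OF inAB] by auto
  qed
  moreover have "\<forall>j. P j \<notin> C" if "encircles P i C"
  proof
    fix j
    show "P j \<notin> C"
      using that index3(11)[of j i] sepD unfolding encircles_def by blast
  qed
  moreover have "\<forall>j. P j \<notin> C" if "curve_of_type P i C"
    using that unfolding curve_of_type_def by blast
  ultimately show ?thesis by blast
qed

section \<open>Balls of faces, their level curves and face distance\<close>

text \<open>Powers of the reflexive closure are balls and grow with the radius, whereas
  \<open>R ^^ n\<close> only knows walks of length exactly \<open>n\<close>.\<close>

lemma relpow_reflcl_iff: "(x, y) \<in> (R\<^sup>=) ^^ n \<longleftrightarrow> (\<exists>m\<le>n. (x, y) \<in> R ^^ m)"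
proof (induction n arbitrary: y)
  case 0
  then show ?case by auto
next
  case (Suc n)
  have "(x, y) \<in> (R\<^sup>=) ^^ Suc n \<longleftrightarrow> (\<exists>z. (\<exists>m\<le>n. (x, z) \<in> R ^^ m) \<and> ((z, y) \<in> R \<or> z = y))"
    using Suc.IH by auto
  also have "\<dots> \<longleftrightarrow> (\<exists>m\<le>Suc n. (x, y) \<in> R ^^ m)"
  proof
    assume "\<exists>z. (\<exists>m\<le>n. (x, z) \<in> R ^^ m) \<and> ((z, y) \<in> R \<or> z = y)"
    then obtain z m where "m \<le> n" "(x, z) \<in> R ^^ m" "(z, y) \<in> R \<or> z = y" by blast
    then show "\<exists>m\<le>Suc n. (x, y) \<in> R ^^ m"
      by (metis Suc_le_mono le_SucI relpow_Suc_I)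
  next
    assume "\<exists>m\<le>Suc n. (x, y) \<in> R ^^ m"
    then obtain m where m: "m \<le> Suc n" "(x, y) \<in> R ^^ m" by blast
    show "\<exists>z. (\<exists>m\<le>n. (x, z) \<in> R ^^ m) \<and> ((z, y) \<in> R \<or> z = y)"
    proof (cases m)
      case 0
      then have "(x, y) \<in> R ^^ 0" using m by simp
      then show ?thesis by (metis relpow_0_E le0)
    next
      case (Suc k)
      then show ?thesis using m by (metis Suc_le_mono relpow_Suc_E)
    qed
  qed
  finally show ?case .
qed

lemma relpow_reflcl_trans:
  "(x, y) \<in> (R\<^sup>=) ^^ m \<Longrightarrow> (y, z) \<in> (R\<^sup>=) ^^ n \<Longrightarrow> (x, z) \<in> (R\<^sup>=) ^^ (m + n)"
  unfolding relpow_add by blast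

lemma relpow_reflcl_mono: "(x, y) \<in> (R\<^sup>=) ^^ m \<Longrightarrow> m \<le> n \<Longrightarrow> (x, y) \<in> (R\<^sup>=) ^^ n"
  unfolding relpow_reflcl_iff by (meson le_trans)

lemma sym_relpow_reflcl: "sym R \<Longrightarrow> (x, y) \<in> (R\<^sup>=) ^^ n \<Longrightarrow> (y, x) \<in> (R\<^sup>=) ^^ n"
proof (induction n arbitrary: x)
  case (Suc n)
  then obtain z where "(x, z) \<in> R\<^sup>=" "(z, y) \<in> (R\<^sup>=) ^^ n" by (metis relpow_Suc_E2)
  then have "(y, z) \<in> (R\<^sup>=) ^^ n" "(z, x) \<in> R\<^sup>=" using Suc by (auto dest: symD)
  then show ?case by auto
qed simp

abbreviation face_at :: "sphere_graph \<Rightarrow> real^3 \<Rightarrow> (real^3) set" where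
  "face_at G x \<equiv> connected_component_set (S2 - support G) x"

context
  fixes G :: sphere_graph
  assumes emb: "embedded_graph G"
begin

lemma face_atD: "x \<in> S2 \<Longrightarrow> x \<notin> support G \<Longrightarrow> face_at G x \<in> faces G \<and> x \<in> face_at G x"
  unfolding faces_def components_iff by auto

lemma sym_face_adj: "sym (face_adj G)"
  unfolding face_adj_def sym_def by blast

lemma face_adj_reflclI:
  "F \<in> faces G \<Longrightarrow> F' \<in> faces G \<Longrightarrow> z \<in> closure F \<Longrightarrow> z \<in> closure F' \<Longrightarrow> (F, F') \<in> (face_adj G)\<^sup>="
  unfolding face_adj_def by blast

lemma open_disjoint_closure:
  assumes "openin (top_of_set S2) U" "Y \<subseteq> S2" "U \<inter> Y = {}"
  shows "U \<inter> closure Y = {}"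
proof -
  obtain W where W: "open W" "U = S2 \<inter> W" using assms(1) unfolding openin_open by blast
  then have "W \<inter> Y = {}" using assms(2,3) by blast
  then show ?thesis using W open_Int_closure_eq_empty by blast
qed

lemma separating_loop_between_faces:
  assumes NN: "NN \<subseteq> faces G" and p: "p \<in> \<Union>NN" and q: "q \<in> \<Union>(faces G - NN)"
  obtains C where "simple_closed_curve C" "C \<subseteq> support G" "sep C p q"
    "\<And>z. z \<in> C \<Longrightarrow> (\<exists>F\<in>NN. z \<in> closure F) \<and> (\<exists>F\<in>faces G - NN. z \<in> closure F)"
proof -
  note ff = faceD[OF emb]
  define FF where "FF = faces G - NN"
  define A where "A = {e \<in> edges G. (\<exists>F\<in>NN. e \<subseteq> closure F) \<and> (\<exists>F\<in>FF. e \<subseteq> closure F)}"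
  have far: "FF \<subseteq> faces G" unfolding FF_def by blast
  have UU: "\<Union>(faces G) \<subseteq> S2" using ff(4) by blast
  have disj: "F \<inter> \<Union>FF = {}" if "F \<in> NN" for F
    using that faces_disjoint[OF emb] NN unfolding FF_def by blast
  have disj': "F \<inter> \<Union>NN = {}" if "F \<in> FF" for F
    using that faces_disjoint[OF emb] NN unfolding FF_def by blast
  have cl: "F \<inter> closure (\<Union>FF) = {}" if "F \<in> NN" for F
    by (rule open_disjoint_closure[OF ff(1) _ disj[OF that]]) (use that NN far UU in auto)
  have cl': "F \<inter> closure (\<Union>NN) = {}" if "F \<in> FF" for F
    by (rule open_disjoint_closure[OF ff(1) _ disj'[OF that]]) (use that NN far UU in auto)
  have dense: "S2 \<subseteq> closure (\<Union>NN) \<union> closure (\<Union>FF)"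
  proof -
    have "openin (top_of_set S2) (S2 - closure (S2 - support G))" by (rule openin_S2_Diff) simp
    moreover have "S2 - closure (S2 - support G) \<subseteq> support G"
      using closure_subset[of "S2 - support G"] by blast
    ultimately have "S2 - closure (S2 - support G) = {}" by (rule empty_interior_support[OF emb])
    moreover have "S2 - support G \<subseteq> \<Union>NN \<union> \<Union>FF"
      using faces_cover[OF emb] unfolding FF_def by blast
    moreover have "closure (\<Union>NN \<union> \<Union>FF) = closure (\<Union>NN) \<union> closure (\<Union>FF)" by (rule closure_Un)
    ultimately show ?thesis using closure_mono[of "S2 - support G" "\<Union>NN \<union> \<Union>FF"] by auto
  qed
  have sub: "\<Union>A \<subseteq> support G" "verts G \<subseteq> support G" unfolding A_def support_def by auto
  have p': "p \<in> S2" "p \<notin> support G" "p \<notin> closure (\<Union>FF)"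
    using p cl NN ff(4) by blast+
  have q': "q \<in> S2" "q \<notin> support G" "q \<notin> closure (\<Union>NN)"
    using q cl' ff(4) unfolding FF_def by blast+
  have "sep (\<Union>A \<union> verts G) p q"
  proof (rule sep_openI)
    show "openin (top_of_set S2) (S2 - closure (\<Union>FF))" "openin (top_of_set S2) (S2 - closure (\<Union>NN))"
      by (simp_all add: openin_S2_Diff)
    show "(S2 - closure (\<Union>FF)) \<inter> (S2 - closure (\<Union>NN)) = {}" using dense by blast
    show "S2 - (\<Union>A \<union> verts G) \<subseteq> (S2 - closure (\<Union>FF)) \<union> (S2 - closure (\<Union>NN))"
    proof (rule ccontr)
      assume "\<not> ?thesis"
      then obtain x where x: "x \<in> S2" "x \<notin> \<Union>A" "x \<notin> verts G" "x \<in> closure (\<Union>FF)" "x \<in> closure (\<Union>NN)"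
        by blast
      show False
      proof (cases "x \<in> support G")
        case True
        then obtain e where e: "e \<in> edges G" "x \<in> e" using x(3) unfolding support_def by blast
        then have "e \<in> A"
          using edge_subset_closure_face[OF emb e x(3) NN x(5)] edge_subset_closure_face[OF emb e x(3) far x(4)]
          unfolding A_def by auto
        then show False using x(2) e(2) by blast
      next
        case False
        then obtain F where "F \<in> faces G" "x \<in> F" using faces_cover[OF emb] x(1) by blast
        then show False using cl[of F] cl'[of F] x(4,5) unfolding FF_def by blast
      qed
    qed
  qed (use p' q' sub in auto)
  moreover have fA: "finite A" using graph_finite[OF emb] unfolding A_def by auto
  moreover have "closed (\<Union>A)"
    using edge_pathD(5)[OF emb] fA compact_imp_closed unfolding A_def by (intro closed_Union) auto
  ultimately have "sep (\<Union>A) p q" using sep_remove_finite graph_finite[OF emb] by blast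
  moreover have "simple_path (edge_path G e) \<and> path_image (edge_path G e) = e \<and> e \<subseteq> S2" if "e \<in> A" for e
    using that edge_pathD[OF emb, of e] unfolding A_def by auto
  moreover have "e \<inter> e' \<subseteq> {pathstart (edge_path G e), pathfinish (edge_path G e)}"
    if "e \<in> A" "e' \<in> A" "e' \<noteq> e" for e e'
    using that edge_pathD(3)[OF emb, of e] edges_meet_in_verts[OF emb, of e e'] unfolding A_def by blast
  ultimately obtain C where C: "C \<subseteq> \<Union>A" "simple_closed_curve C" "sep C p q"
    using separating_curve_in_arcs[OF fA, of "edge_path G" p q] by blast
  show thesis
  proof (rule that[OF C(2) _ C(3)])
    show "C \<subseteq> support G" using C(1) sub(1) by blast
    fix z assume "z \<in> C"
    then obtain e where "e \<in> A" "z \<in> e" using C(1) by blast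
    then show "(\<exists>F\<in>NN. z \<in> closure F) \<and> (\<exists>F\<in>faces G - NN. z \<in> closure F)"
      unfolding A_def FF_def by blast
  qed
qed

definition loop_at_level :: "real^3 \<Rightarrow> nat \<Rightarrow> (real^3) set \<Rightarrow> bool" where
  "loop_at_level p k C \<longleftrightarrow> (\<forall>z\<in>C.
     (\<exists>F\<in>faces G. (face_at G p, F) \<in> ((face_adj G)\<^sup>=) ^^ k \<and> z \<in> closure F) \<and>
     (\<exists>F\<in>faces G. (face_at G p, F) \<notin> ((face_adj G)\<^sup>=) ^^ k \<and> z \<in> closure F))"

lemma loop_at_level_exists:
  assumes "p \<in> S2 - support G" "q \<in> S2 - support G" "(face_at G p, face_at G q) \<notin> ((face_adj G)\<^sup>=) ^^ k"
  obtains C where "simple_closed_curve C" "C \<subseteq> support G" "sep C p q" "loop_at_level p k C"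
proof -
  define NN where "NN = {F \<in> faces G. (face_at G p, F) \<in> ((face_adj G)\<^sup>=) ^^ k}"
  have p: "face_at G p \<in> faces G" "p \<in> face_at G p" using assms(1) face_atD by auto
  have q: "face_at G q \<in> faces G" "q \<in> face_at G q" using assms(2) face_atD by auto
  have "(face_at G p, face_at G p) \<in> ((face_adj G)\<^sup>=) ^^ k"
    unfolding relpow_reflcl_iff by (rule exI[of _ 0]) auto
  then have "p \<in> \<Union>NN" using p unfolding NN_def by blast
  moreover have "q \<in> \<Union>(faces G - NN)" using q assms(3) unfolding NN_def by blast
  ultimately obtain C where C: "simple_closed_curve C" "C \<subseteq> support G" "sep C p q"
    "\<And>z. z \<in> C \<Longrightarrow> (\<exists>F\<in>NN. z \<in> closure F) \<and> (\<exists>F\<in>faces G - NN. z \<in> closure F)"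
    using separating_loop_between_faces[of NN p q] NN_def by blast
  have "loop_at_level p k C"
    unfolding loop_at_level_def
  proof
    fix z assume "z \<in> C"
    then show "(\<exists>F\<in>faces G. (face_at G p, F) \<in> ((face_adj G)\<^sup>=) ^^ k \<and> z \<in> closure F) \<and>
     (\<exists>F\<in>faces G. (face_at G p, F) \<notin> ((face_adj G)\<^sup>=) ^^ k \<and> z \<in> closure F)"
      using C(4)[of z] unfolding NN_def by blast
  qed
  then show thesis using that C by blast
qed

text \<open>A common point would touch a face within distance \<open>j\<close> and a face beyond
  distance \<open>k\<close>. Faces that touch are adjacent or equal, so the second is within
  \<open>j + 1 \<le> k\<close>.\<close>

lemma loops_at_levels_disjoint:
  assumes "loop_at_level p j C" "loop_at_level p k D" "j < k"
  shows "C \<inter> D = {}"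
proof (rule ccontr)
  assume "C \<inter> D \<noteq> {}"
  then obtain z where z: "z \<in> C" "z \<in> D" by blast
  obtain F where F: "F \<in> faces G" "(face_at G p, F) \<in> ((face_adj G)\<^sup>=) ^^ j" "z \<in> closure F"
    using assms(1) z unfolding loop_at_level_def by blast
  obtain F' where F': "F' \<in> faces G" "(face_at G p, F') \<notin> ((face_adj G)\<^sup>=) ^^ k" "z \<in> closure F'"
    using assms(2) z unfolding loop_at_level_def by blast
  have "(F, F') \<in> (face_adj G)\<^sup>=" using face_adj_reflclI F F' by blast
  then have "(face_at G p, F') \<in> ((face_adj G)\<^sup>=) ^^ Suc j" using F(2) by auto
  then show False using F'(2) relpow_reflcl_mono assms(3) by (metis Suc_leI)
qed

text \<open>Consecutive faces are joined through one point of both closures. Their union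
  \<open>Y\<close> is connected and meets the drawing only in these points.\<close>

lemma face_chain:
  assumes "(F, F') \<in> (face_adj G) ^^ n" "F \<in> faces G"
  obtains f z Y where "f 0 = F" "f n = F'" "\<forall>i<n. (f i, f (Suc i)) \<in> face_adj G"
    "\<forall>i<n. z i \<in> closure (f i) \<and> z i \<in> closure (f (Suc i))"
    "connected Y" "F \<subseteq> Y" "F' \<subseteq> Y" "Y \<subseteq> S2" "Y \<inter> support G \<subseteq> z ` {..<n}"
proof -
  obtain f where f: "f 0 = F" "f n = F'" "\<And>i. i < n \<Longrightarrow> (f i, f (Suc i)) \<in> face_adj G"
    using assms(1) unfolding relpow_fun_conv by blast
  have "\<forall>i\<in>{..<n}. \<exists>z. z \<in> closure (f i) \<and> z \<in> closure (f (Suc i))"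
    using f(3) unfolding face_adj_def by blast
  then obtain z where z: "\<And>i. i < n \<Longrightarrow> z i \<in> closure (f i) \<and> z i \<in> closure (f (Suc i))"
    by (metis lessThan_iff)
  have ff: "f i \<in> faces G" if "i \<le> n" for i
    using that f(1,3) assms(2) unfolding face_adj_def by (cases i) auto
  define Y where "Y m = (\<Union>i\<le>m. f i) \<union> z ` {..<m}" for m
  have con: "connected (Y m)" if "m \<le> n" for m
    using that
  proof (induction m)
    case 0
    then show ?case using faceD(2)[OF emb ff[of 0]] by (simp add: Y_def)
  next
    case (Suc m)
    have eq: "Y (Suc m) = Y m \<union> (insert (z m) (f m) \<union> insert (z m) (f (Suc m)))"
      unfolding Y_def by (auto simp: lessThan_Suc atMost_Suc)
    have 1: "connected (insert (z m) (f m))"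
      by (rule connected_intermediate_closure[OF faceD(2)[OF emb ff[of m]]])
        (use Suc z[of m] closure_subset in auto)
    have 2: "connected (insert (z m) (f (Suc m)))"
      by (rule connected_intermediate_closure[OF faceD(2)[OF emb ff[of "Suc m"]]])
        (use Suc z[of m] closure_subset in auto)
    have 3: "connected (insert (z m) (f m) \<union> insert (z m) (f (Suc m)))"
      by (rule connected_Un[OF 1 2]) auto
    have "f m \<noteq> {}" using faceD(3)[OF emb ff[of m]] Suc by simp
    moreover have "f m \<subseteq> Y m" unfolding Y_def by blast
    ultimately have "Y m \<inter> (insert (z m) (f m) \<union> insert (z m) (f (Suc m))) \<noteq> {}" by blast
    then show ?case unfolding eq using connected_Un[OF Suc.IH 3] Suc.prems by simp
  qed
  show thesis
  proof (rule that)
    show "f 0 = F" "f n = F'" by (rule f(1), rule f(2))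
    show "\<forall>i<n. (f i, f (Suc i)) \<in> face_adj G" using f(3) by blast
    show "\<forall>i<n. z i \<in> closure (f i) \<and> z i \<in> closure (f (Suc i))" using z by blast
    show "connected (Y n)" using con by simp
    show "F \<subseteq> Y n" "F' \<subseteq> Y n" using f(1,2) unfolding Y_def by auto
    have zS: "z i \<in> S2" if "i < n" for i
      using z[OF that] faceD(5)[OF emb ff[of i]] that by auto
    show "Y n \<subseteq> S2" unfolding Y_def using faceD(4)[OF emb ff] zS by blast
    show "Y n \<inter> support G \<subseteq> z ` {..<n}" unfolding Y_def using faceD(4)[OF emb ff] by blast
  qed
qed

lemma packing_le_face_chain:
  assumes p: "p \<in> S2 - support G" and q: "q \<in> S2 - support G"
    and R: "(face_at G p, face_at G q) \<in> (face_adj G) ^^ n"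
    and L: "packing (support G) (\<lambda>C. sep C p q) L"
  shows "card L \<le> n"
proof -
  have pq: "face_at G p \<in> faces G" "p \<in> face_at G p" "q \<in> face_at G q" using p q face_atD by auto
  obtain f z Y where Y: "f 0 = face_at G p" "f n = face_at G q"
    "\<forall>i<n. (f i, f (Suc i)) \<in> face_adj G"
    "\<forall>i<n. z i \<in> closure (f i) \<and> z i \<in> closure (f (Suc i))"
    "connected Y" "face_at G p \<subseteq> Y" "face_at G q \<subseteq> Y" "Y \<subseteq> S2" "Y \<inter> support G \<subseteq> z ` {..<n}"
    by (rule face_chain[OF R pq(1)])
  have "card L \<le> card (z ` {..<n})"
    by (rule packing_le_connected[OF L Y(5) _ _ Y(8,9)]) (use Y pq in auto)
  also have "\<dots> \<le> n" by (metis card_image_le card_lessThan finite_lessThan)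
  finally show ?thesis .
qed

text \<open>If there is no walk shorter than \<open>n\<close>, the levels \<open>0\<close> to
  \<open>n - 1\<close> give \<open>n\<close> disjoint separating curves; a walk of length
  \<open>n\<close> permits no more.\<close>

lemma face_dist_packing:
  assumes p: "p \<in> S2 - support G" and q: "q \<in> S2 - support G"
  obtains n where "face_dist G (face_at G p) (face_at G q) = enat n"
    "max_packing (support G) (\<lambda>C. sep C p q) n"
    "(face_at G p, face_at G q) \<in> (face_adj G) ^^ n"
    "\<And>k. (face_at G p, face_at G q) \<in> ((face_adj G)\<^sup>=) ^^ k \<Longrightarrow> n \<le> k"
proof -
  let ?R = "face_adj G" and ?p = "face_at G p" and ?q = "face_at G q"
  have loops: "\<exists>L. packing (support G) (\<lambda>C. sep C p q) L \<and> card L = n"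
    if n: "\<And>k. k < n \<Longrightarrow> (?p, ?q) \<notin> ?R ^^ k" for n
  proof -
    have "\<exists>C. simple_closed_curve C \<and> C \<subseteq> support G \<and> sep C p q \<and> loop_at_level p k C" if "k < n" for k
    proof -
      have "(?p, ?q) \<notin> (?R\<^sup>=) ^^ k" using n that unfolding relpow_reflcl_iff by auto
      then show ?thesis using loop_at_level_exists[OF p q] by metis
    qed
    then obtain c where c: "\<And>k. k < n \<Longrightarrow> simple_closed_curve (c k) \<and> c k \<subseteq> support G \<and> sep (c k) p q \<and>
      loop_at_level p k (c k)" by metis
    show ?thesis
      using packing_family[of n c "support G" "\<lambda>C. sep C p q"] c loops_at_levels_disjoint by (meson less_trans)
  qed
  \<comment> \<open>Otherwise packings of every size would exist, but the support contains only
    finitely many closed curves.\<close>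
  have "\<exists>n. (?p, ?q) \<in> ?R ^^ n"
  proof (rule ccontr)
    assume "\<nexists>n. (?p, ?q) \<in> ?R ^^ n"
    then obtain L where L: "packing (support G) (\<lambda>C. sep C p q) L"
      "card L = Suc (card {C. simple_closed_curve C \<and> C \<subseteq> support G})"
      using loops by blast
    have "L \<subseteq> {C. simple_closed_curve C \<and> C \<subseteq> support G}" using L(1) unfolding packing_def by blast
    then have "card L \<le> card {C. simple_closed_curve C \<and> C \<subseteq> support G}"
      by (rule card_mono[OF finite_loops[OF emb]])
    then show False using L(2) by simp
  qed
  define n where "n = (LEAST n. (?p, ?q) \<in> ?R ^^ n)"
  have n: "(?p, ?q) \<in> ?R ^^ n" "\<And>k. (?p, ?q) \<in> ?R ^^ k \<Longrightarrow> n \<le> k"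
    unfolding n_def using \<open>\<exists>n. (?p, ?q) \<in> ?R ^^ n\<close> by (auto intro: LeastI_ex Least_le)
  show thesis
  proof (rule that[of n])
    show "face_dist G ?p ?q = enat n"
      unfolding face_dist_def face_adj_eq[OF emb]
      by (rule antisym) (use n in \<open>auto intro!: INF_lower2[of n] INF_greatest\<close>)
    have "\<not> k < n" if "(?p, ?q) \<in> ?R ^^ k" for k using n(2)[OF that] by simp
    then show "max_packing (support G) (\<lambda>C. sep C p q) n"
      unfolding max_packing_def using loops[of n] packing_le_face_chain[OF p q n(1)] by blast
    show "(?p, ?q) \<in> ?R ^^ n" by (rule n(1))
    show "n \<le> k" if "(?p, ?q) \<in> (?R\<^sup>=) ^^ k" for k
      using that n(2) unfolding relpow_reflcl_iff by (meson le_trans)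
  qed
qed

text \<open>The bounds on the distances keep the points where a geodesic from \<open>y\<close> to \<open>z\<close> crosses the graph
  away from the level curves \<open>0, \<dots>, m\<close> around \<open>x\<close>. These curves thus have \<open>y\<close> and \<open>z\<close> on the same side,
  and there are \<open>m + 1\<close> of them.\<close>

lemma tripod_inequality:
  assumes x: "x \<in> S2 - support G" and y: "y \<in> S2 - support G" and z: "z \<in> S2 - support G"
    and xy: "max_packing (support G) (\<lambda>C. sep C x y) a"
    and xz: "max_packing (support G) (\<lambda>C. sep C x z) b"
    and yz: "max_packing (support G) (\<lambda>C. sep C y z) c"
    and m: "max_packing (support G) (\<lambda>C. sep C x y \<and> sep C x z) m"
  shows "a + b \<le> 2 * m + c + 1"
proof (rule ccontr)
  assume neg: "\<not> a + b \<le> 2 * m + c + 1"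
  let ?R = "face_adj G"
  have xya: "a \<le> k" if "(face_at G x, face_at G y) \<in> (?R\<^sup>=) ^^ k" for k
    using face_dist_packing[OF x y] max_packing_unique[OF xy] that by metis
  have xzb: "b \<le> k" if "(face_at G x, face_at G z) \<in> (?R\<^sup>=) ^^ k" for k
    using face_dist_packing[OF x z] max_packing_unique[OF xz] that by metis
  have yzc: "(face_at G y, face_at G z) \<in> ?R ^^ c"
    using face_dist_packing[OF y z] max_packing_unique[OF yz] by metis
  have F: "face_at G x \<in> faces G" "face_at G y \<in> faces G" "y \<in> face_at G y" "z \<in> face_at G z"
    using x y z face_atD by auto
  obtain f w Y where Y: "f 0 = face_at G y" "f c = face_at G z"
    "\<forall>i<c. (f i, f (Suc i)) \<in> face_adj G"
    "\<forall>i<c. w i \<in> closure (f i) \<and> w i \<in> closure (f (Suc i))"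
    "connected Y" "face_at G y \<subseteq> Y" "face_at G z \<subseteq> Y" "Y \<subseteq> S2" "Y \<inter> support G \<subseteq> w ` {..<c}"
    by (rule face_chain[OF yzc F(2)])
  have left: "(face_at G y, f i) \<in> (?R\<^sup>=) ^^ i" if "i \<le> c" for i
    using that
  proof (induction i)
    case (Suc i)
    then show ?case using Y(3) by auto
  qed (simp add: Y(1))
  have right: "(f i, face_at G z) \<in> (?R\<^sup>=) ^^ (c - i)" if "i \<le> c" for i
    using that
  proof (induction "c - i" arbitrary: i)
    case 0
    then show ?case using Y(2) by auto
  next
    case (Suc k)
    then have "(f (Suc i), face_at G z) \<in> (?R\<^sup>=) ^^ (c - Suc i)" by auto
    moreover have "(f i, f (Suc i)) \<in> ?R\<^sup>=" using Y(3) Suc by auto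
    moreover have "c - i = Suc (c - Suc i)" using Suc by auto
    ultimately show ?case by (metis relpow_Suc_I2)
  qed
  have loop: "\<exists>C. simple_closed_curve C \<and> C \<subseteq> support G \<and> (sep C x y \<and> sep C x z) \<and> loop_at_level x k C"
    if k: "k < Suc m" for k
  proof -
    have large: "2 * k + c + 1 < a + b" using neg k by simp
    \<comment> \<open>If \<open>y\<close> were in the ball of radius \<open>k\<close>, the geodesic
      to \<open>z\<close> would give \<open>a \<le> k\<close> and
      \<open>b \<le> k + c\<close>.\<close>
    have "(face_at G x, face_at G y) \<notin> (?R\<^sup>=) ^^ k"
    proof
      assume r: "(face_at G x, face_at G y) \<in> (?R\<^sup>=) ^^ k"
      then have "(face_at G x, face_at G z) \<in> (?R\<^sup>=) ^^ (k + (c - 0))"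
        using relpow_reflcl_trans[OF r] right[of 0] Y(1) by simp
      then show False using xya[OF r] xzb large by fastforce
    qed
    then obtain C where C: "simple_closed_curve C" "C \<subseteq> support G" "sep C x y" "loop_at_level x k C"
      using loop_at_level_exists[OF x y] by metis
    \<comment> \<open>The point \<open>w i\<close> touches both \<open>f i\<close> and
      \<open>f (Suc i)\<close>. If it lay on the level curve, these faces would be within
      \<open>k + 1\<close> of \<open>x\<close>, hence \<open>a \<le> k + 1 + i\<close> and
      \<open>b \<le> k + 1 + (c - i - 1)\<close>. The sum \<open>2 * k + c + 1\<close> is the source
      of the constant 1 in (2).\<close>
    have "w i \<notin> C" if i: "i < c" for i
    proof
      assume "w i \<in> C"
      then obtain F where F: "F \<in> faces G" "(face_at G x, F) \<in> (?R\<^sup>=) ^^ k" "w i \<in> closure F"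
        using C(4) unfolding loop_at_level_def by blast
      have fi: "f i \<in> faces G" "f (Suc i) \<in> faces G" "w i \<in> closure (f i)" "w i \<in> closure (f (Suc i))"
        using Y(3,4) i unfolding face_adj_def by auto
      have "(face_at G x, f i) \<in> (?R\<^sup>=) ^^ Suc k" "(face_at G x, f (Suc i)) \<in> (?R\<^sup>=) ^^ Suc k"
        using face_adj_reflclI[OF F(1) fi(1) F(3) fi(3)] face_adj_reflclI[OF F(1) fi(2) F(3) fi(4)] F(2)
        by auto
      moreover have "(f i, face_at G y) \<in> (?R\<^sup>=) ^^ i"
        using sym_relpow_reflcl[OF sym_face_adj left] i by simp
      ultimately have "(face_at G x, face_at G y) \<in> (?R\<^sup>=) ^^ (Suc k + i)"
        "(face_at G x, face_at G z) \<in> (?R\<^sup>=) ^^ (Suc k + (c - Suc i))"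
        using relpow_reflcl_trans right[of "Suc i"] i by (metis Suc_leI)+
      then show False using xya xzb large i by fastforce
    qed
    then have "Y \<subseteq> S2 - C" using Y(8,9) C(2) by blast
    then have "\<not> sep C y z" using not_sep_connected[OF Y(5)] Y(6,7) F by blast
    then have "sep C x z"
      using sep_cases[OF C(3), of z] z C(2) sep_commute by blast
    then show ?thesis using C by blast
  qed
  then obtain d where d: "\<And>k. k < Suc m \<Longrightarrow> simple_closed_curve (d k) \<and> d k \<subseteq> support G \<and>
      (sep (d k) x y \<and> sep (d k) x z) \<and> loop_at_level x k (d k)" by metis
  have "packing (support G) (\<lambda>C. sep C x y \<and> sep C x z) (d ` {..<Suc m})" "card (d ` {..<Suc m}) = Suc m"
    using packing_family[of "Suc m" d "support G" "\<lambda>C. sep C x y \<and> sep C x z"] d loops_at_levels_disjoint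
    by (meson less_trans)+
  then show False using m unfolding max_packing_def by (metis Suc_n_not_le_n)
qed

text \<open>Vertex-disjoint loops are disjoint as point sets. There are only finitely many loops, so
  \<open>Max\<close> is taken over a finite set, and the empty family makes that set
  nonempty.\<close>

lemma M_sigma_packing:
  assumes "range P \<subseteq> S2"
  shows "max_packing (support G) (encircles P i) (M_sigma P G i)"
proof -
  define S where "S = {card L | L. (\<forall>C\<in>L. simple_loop G C \<and> curve_of_type P i C) \<and>
     pairwise (\<lambda>C D. C \<inter> D \<inter> verts G = {}) L}"
  let ?A = "{C. simple_closed_curve C \<and> C \<subseteq> support G}"
  have iff: "(\<forall>C\<in>L. simple_loop G C \<and> curve_of_type P i C) \<and> pairwise (\<lambda>C D. C \<inter> D \<inter> verts G = {}) L
     \<longleftrightarrow> packing (support G) (encircles P i) L" for L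
  proof -
    have 1: "(\<forall>C\<in>L. simple_loop G C \<and> curve_of_type P i C) \<longleftrightarrow>
      (\<forall>C\<in>L. simple_closed_curve C \<and> C \<subseteq> support G \<and> encircles P i C)"
      using simple_loop_iff[OF emb] curve_of_type_iff[OF _ assms] by blast
    have 2: "pairwise (\<lambda>C D. C \<inter> D \<inter> verts G = {}) L \<longleftrightarrow> pairwise disjnt L"
      if "\<forall>C\<in>L. simple_loop G C"
      using that loops_disjoint_iff[OF emb] unfolding pairwise_def disjnt_def by metis
    have 3: "finite L" if "\<forall>C\<in>L. simple_closed_curve C \<and> C \<subseteq> support G \<and> encircles P i C"
      using that finite_subset[OF _ finite_loops[OF emb]] by blast
    show ?thesis unfolding packing_def using 1 2 3 by blast
  qed
  have S: "S = {card L | L. packing (support G) (encircles P i) L}" unfolding S_def iff ..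
  have "S \<subseteq> {..card ?A}"
  proof
    fix n assume "n \<in> S"
    then obtain L where "n = card L" "packing (support G) (encircles P i) L" unfolding S by blast
    moreover have "L \<subseteq> ?A" using calculation(2) unfolding packing_def by blast
    ultimately show "n \<in> {..card ?A}" using card_mono[OF finite_loops[OF emb]] by simp
  qed
  then have "finite S" using finite_subset by blast
  moreover have "packing (support G) (encircles P i) {}" unfolding packing_def by simp
  then have "S \<noteq> {}" unfolding S by blast
  ultimately have "Max S \<in> S" "\<And>n. n \<in> S \<Longrightarrow> n \<le> Max S" by (auto intro: Max_in)
  moreover have "M_sigma P G i = Max S" unfolding M_sigma_def S_def ..
  ultimately show ?thesis unfolding max_packing_def S by auto
qed

end

section \<open>Drawings and insertion of loops\<close>

text \<open>All quantities in question depend on the support alone, so constructions deal with point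
  sets and leave the choice of vertices and edges open.\<close>

definition drawable :: "(real^3) set \<Rightarrow> bool" where
  "drawable K \<longleftrightarrow> (\<exists>G. embedded_graph G \<and> support G = K)"

lemma drawable_empty: "drawable {}"
  unfolding drawable_def
  by (rule exI[of _ "\<lparr>verts = {}, edges = {}\<rparr>"]) (auto simp: embedded_graph_def support_def)

lemma drawable_point: "x \<in> S2 \<Longrightarrow> drawable {x}"
  unfolding drawable_def
  by (rule exI[of _ "\<lparr>verts = {x}, edges = {}\<rparr>"]) (auto simp: embedded_graph_def support_def)

section \<open>Subdivision of edges and addition of arcs\<close>

lemma Int_pair_eq: "a \<in> X \<Longrightarrow> (b \<in> X \<Longrightarrow> b = a) \<Longrightarrow> X \<inter> {a, b} = {a}"
  by auto

lemma Int_pair_notin: "X \<inter> {a, b} = {a} \<Longrightarrow> a \<noteq> b \<Longrightarrow> b \<notin> X"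
  by auto

text \<open>For a closed \<open>g\<close> the two pieces also meet in \<open>g 0 = g 1\<close>,
  hence the second point in the bound on their intersection.\<close>

lemma subpath_split:
  assumes "simple_path g" "0 < t" "t < 1"
  shows "arc (subpath 0 t g)" "arc (subpath t 1 g)"
    "path_image (subpath 0 t g) \<union> path_image (subpath t 1 g) = path_image g"
    "path_image (subpath 0 t g) \<inter> path_image (subpath t 1 g) \<subseteq> {g t, g 0}"
    "path_image (subpath 0 t g) \<inter> {g 0, g 1} = {g 0}"
    "path_image (subpath t 1 g) \<inter> {g 0, g 1} = {g 1}"
proof -
  have inj: "\<And>x y. x \<in> {0..1} \<Longrightarrow> y \<in> {0..1} \<Longrightarrow> g x = g y \<Longrightarrow>
      x = y \<or> x = 0 \<and> y = 1 \<or> x = 1 \<and> y = 0"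
    using assms unfolding simple_path_def loop_free_def by auto
  show "arc (subpath 0 t g)" "arc (subpath t 1 g)"
    using assms by (auto intro!: arc_simple_path_subpath_interior)
  have im: "path_image (subpath 0 t g) = g ` {0..t}" "path_image (subpath t 1 g) = g ` {t..1}"
    using assms by (auto simp: path_image_subpath)
  show "path_image (subpath 0 t g) \<union> path_image (subpath t 1 g) = path_image g"
    unfolding im by (simp add: path_image_def image_Un[symmetric] ivl_disj_un_two_touch(4) less_imp_le assms(2,3))
  show "path_image (subpath 0 t g) \<inter> path_image (subpath t 1 g) \<subseteq> {g t, g 0}"
  proof
    fix x assume "x \<in> path_image (subpath 0 t g) \<inter> path_image (subpath t 1 g)"
    then obtain s s' where s: "0 \<le> s" "s \<le> t" "x = g s" "t \<le> s'" "s' \<le> 1" "g s = g s'"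
      unfolding im by auto
    then have "s = s' \<or> s = 0" using inj[of s s'] assms by auto
    then show "x \<in> {g t, g 0}" using s by auto
  qed
  show "path_image (subpath 0 t g) \<inter> {g 0, g 1} = {g 0}"
  proof -
    have "g 1 = g 0" if "g 1 = g s" "0 \<le> s" "s \<le> t" for s using inj[of 1 s] that assms by auto
    then have "g 1 \<in> g ` {0..t} \<Longrightarrow> g 1 = g 0" by fastforce
    moreover have "g 0 \<in> g ` {0..t}" using assms by auto
    ultimately show ?thesis unfolding im by (intro Int_pair_eq)
  qed
  show "path_image (subpath t 1 g) \<inter> {g 0, g 1} = {g 1}"
  proof -
    have "g 0 = g 1" if "g 0 = g s" "t \<le> s" "s \<le> 1" for s using inj[of 0 s] that assms by auto
    then have "g 0 \<in> g ` {t..1} \<Longrightarrow> g 0 = g 1" by fastforce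
    moreover have "g 1 \<in> g ` {t..1}" using assms by auto
    ultimately show ?thesis unfolding im insert_commute[of "g 0"] by (intro Int_pair_eq)
  qed
qed

lemma subdivide:
  assumes emb: "embedded_graph G" and w: "w \<in> support G"
  obtains G' where "embedded_graph G'" "support G' = support G" "verts G' = insert w (verts G)"
proof (cases "w \<in> verts G")
  case True
  then show thesis using that[of G] emb by (simp add: insert_absorb)
next
  case False
  then obtain e where e: "e \<in> edges G" "w \<in> e" using w unfolding support_def by blast
  define g where "g = edge_path G e"
  note ed = edge_pathD[OF emb e(1), folded g_def]
  have "w \<in> path_image g - {pathstart g, pathfinish g}" using False e(2) ed(2,3) by blast
  then obtain t where t: "0 < t" "t < 1" "w = g t"
    unfolding open_arc_of_simple_path(1)[OF ed(1)] by auto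
  define e1 e2 where "e1 = path_image (subpath 0 t g)" and "e2 = path_image (subpath t 1 g)"
  note sp = subpath_split[OF ed(1) t(1,2), folded e1_def e2_def]
  have ends: "pathstart g = g 0" "pathfinish g = g 1" by (simp_all add: pathstart_def pathfinish_def)
  have wi: "w \<in> e1" "w \<in> e2" "g 0 \<in> e1" "g 1 \<in> e2"
    using t sp(5,6) unfolding e1_def e2_def by (auto simp: path_image_subpath)
  have e12: "e1 \<union> e2 = e" using sp(3) ed(2) by simp
  define V E where "V = insert w (verts G)" and "E = (edges G - {e}) \<union> {e1, e2}"
  define G' where "G' = \<lparr>verts = V, edges = E\<rparr>"
  have w': "w \<notin> e'" if "e' \<in> edges G" "e' \<noteq> e" for e'
    using that edges_meet_in_verts[OF emb e(1)] e(2) False by blast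
  have v1: "e1 \<inter> V = {g 0, w}"
  proof -
    have "e1 \<inter> verts G = e1 \<inter> (e \<inter> verts G)" using e12 by blast
    then have "e1 \<inter> verts G = e1 \<inter> {g 0, g 1}" unfolding ed(3) ends .
    then show ?thesis using sp(5) wi unfolding V_def by blast
  qed
  have v2: "e2 \<inter> V = {w, g 1}"
  proof -
    have "e2 \<inter> verts G = e2 \<inter> (e \<inter> verts G)" using e12 by blast
    then have "e2 \<inter> verts G = e2 \<inter> {g 0, g 1}" unfolding ed(3) ends .
    then show ?thesis using sp(6) wi unfolding V_def by blast
  qed
  have "support G' = support G"
    using e e12 unfolding G'_def support_def V_def E_def by auto
  moreover have "embedded_graph G'"
    unfolding embedded_graph_def G'_def sphere_graph.simps
  proof (intro conjI ballI impI)
    show "finite V" "finite E" using graph_finite[OF emb] unfolding V_def E_def by auto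
    show "V \<subseteq> S2" using verts_S2[OF emb] e ed(4) unfolding V_def by blast
    fix f assume f: "f \<in> E"
    show "f \<subseteq> S2" using f edge_pathD(4)[OF emb] e(1) e12 unfolding E_def by blast
    show "\<exists>g. simple_path g \<and> path_image g = f \<and> f \<inter> V = {pathstart g, pathfinish g}"
    proof (cases "f \<in> edges G - {e}")
      case True
      then have "f \<inter> V = f \<inter> verts G" using w' unfolding V_def by blast
      then show ?thesis using edge_pathD(1-3)[OF emb, of f] True by auto
    next
      case False
      then consider "f = e1" | "f = e2" using f unfolding E_def by blast
      then show ?thesis
      proof cases
        case 1
        then show ?thesis
          using v1 sp(1) t(3) e1_def by (intro exI[of _ "subpath 0 t g"]) (auto simp: arc_imp_simple_path)
      next
        case 2
        then show ?thesis
          using v2 sp(2) t(3) e2_def by (intro exI[of _ "subpath t 1 g"]) (auto simp: arc_imp_simple_path)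
      qed
    qed
    fix f' assume f': "f' \<in> E" "f \<noteq> f'"
    have m: "e \<inter> f'' \<subseteq> V" if "f'' \<in> edges G - {e}" for f''
      using that edges_meet_in_verts[OF emb e(1), of f''] unfolding V_def by blast
    have m12: "e1 \<inter> e2 \<subseteq> V" using sp(4) t(3) ed(3) ends unfolding V_def by auto
    consider "f \<in> edges G - {e}" "f' \<in> edges G - {e}" | "f \<in> edges G - {e}" "f' \<subseteq> e"
      | "f \<subseteq> e" "f' \<in> edges G - {e}" | "f = e1" "f' = e2" | "f = e2" "f' = e1"
      using f f' e12 unfolding E_def by blast
    then show "f \<inter> f' \<subseteq> V"
    proof cases
      case 1
      then show ?thesis using edges_meet_in_verts[OF emb, of f f'] f'(2) unfolding V_def by blast
    qed (use m m12 in blast)+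
  qed
  ultimately show thesis using that[of G'] unfolding G'_def V_def by simp
qed

lemma subdivide_finite:
  assumes "finite W" "embedded_graph G" "W \<subseteq> support G"
  shows "\<exists>G'. embedded_graph G' \<and> support G' = support G \<and> W \<subseteq> verts G'"
  using assms
proof (induction W rule: finite_induct)
  case (insert w W)
  then obtain G' where G': "embedded_graph G'" "support G' = support G" "W \<subseteq> verts G'" by auto
  moreover have "w \<in> support G'" using insert.prems G'(2) by blast
  ultimately obtain G'' where "embedded_graph G''" "support G'' = support G'" "verts G'' = insert w (verts G')"
    using subdivide by blast
  then show ?case using G' by (intro exI[of _ G'']) auto
qed auto

lemma add_edge:
  assumes emb: "embedded_graph G" and g: "simple_path g" "path_image g \<subseteq> S2"
    and i: "path_image g \<inter> support G \<subseteq> {pathstart g, pathfinish g}" "path_image g \<inter> support G \<subseteq> verts G"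
  shows "drawable (support G \<union> path_image g)"
proof -
  let ?V = "verts G \<union> {pathstart g, pathfinish g}" and ?E = "insert (path_image g) (edges G)"
  have ends: "pathstart g \<in> path_image g" "pathfinish g \<in> path_image g" by auto
  have sub: "verts G \<subseteq> support G" "\<And>e. e \<in> edges G \<Longrightarrow> e \<subseteq> support G" unfolding support_def by auto
  have "embedded_graph \<lparr>verts = ?V, edges = ?E\<rparr>"
    unfolding embedded_graph_def sphere_graph.simps
  proof (intro conjI ballI impI)
    show "finite ?V" "finite ?E" using graph_finite[OF emb] by auto
    show "?V \<subseteq> S2" using verts_S2[OF emb] g(2) ends by blast
    fix f assume f: "f \<in> ?E"
    show "f \<subseteq> S2" using f edge_pathD(4)[OF emb] g(2) by blast
    show "\<exists>g. simple_path g \<and> path_image g = f \<and> f \<inter> ?V = {pathstart g, pathfinish g}"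
    proof (cases "f = path_image g")
      case True
      then show ?thesis using g(1) i(1) sub(1) ends by (intro exI[of _ g]) blast
    next
      case False
      then have fe: "f \<in> edges G" using f by blast
      then have "f \<inter> ?V = f \<inter> verts G" using i(2) sub(2)[OF fe] ends by blast
      then show ?thesis using edge_pathD(1-3)[OF emb fe] by auto
    qed
    fix f' assume f': "f' \<in> ?E" "f \<noteq> f'"
    show "f \<inter> f' \<subseteq> ?V"
    proof (cases "f \<in> edges G \<and> f' \<in> edges G")
      case True
      then show ?thesis using edges_meet_in_verts[OF emb, of f f'] f'(2) by blast
    next
      case False
      then show ?thesis using f f' i(2) sub(2) by blast
    qed
  qed
  moreover have "support \<lparr>verts = ?V, edges = ?E\<rparr> = support G \<union> path_image g"
    using ends unfolding support_def by auto
  ultimately show ?thesis unfolding drawable_def by blast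
qed

text \<open>Induction on the number of inner points of the arc that lie on \<open>K\<close>. The arc
  is cut at one of them and the halves are added in turn. If there is none, \<open>K\<close> is
  subdivided where an end of the arc lies on it, and the arc becomes a single edge.\<close>

lemma drawable_Un_arc:
  assumes "drawable K" "arc g" "path_image g \<subseteq> S2" "finite (path_image g \<inter> K)"
  shows "drawable (K \<union> path_image g)"
  using assms
proof (induction "card (path_image g \<inter> K - {g 0, g 1})" arbitrary: K g rule: less_induct)
  case less
  have sp: "simple_path g" using less.prems(2) arc_imp_simple_path by blast
  show ?case
  proof (cases "path_image g \<inter> K \<subseteq> {g 0, g 1}")
    case True
    obtain G0 where G0: "embedded_graph G0" "support G0 = K"
      using less.prems(1) unfolding drawable_def by blast
    obtain G where G: "embedded_graph G" "support G = K" "path_image g \<inter> K \<subseteq> verts G"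
      using subdivide_finite[OF less.prems(4) G0(1)] G0(2) by auto
    show ?thesis
      using add_edge[OF G(1) sp less.prems(3)] True G unfolding pathstart_def pathfinish_def by auto
  next
    case False
    then obtain w where w: "w \<in> path_image g" "w \<in> K" "w \<noteq> g 0" "w \<noteq> g 1" by blast
    then have "w \<in> g ` {0<..<1}"
      using open_arc_of_simple_path(1)[OF sp] unfolding pathstart_def pathfinish_def by blast
    then obtain t where t: "0 < t" "t < 1" "w = g t" by auto
    define g1 g2 where "g1 = subpath 0 t g" and "g2 = subpath t 1 g"
    note sb = subpath_split[OF sp t(1,2), folded g1_def g2_def]
    have g01: "g 0 \<noteq> g 1" using arc_distinct_ends[OF less.prems(2)] by (simp add: pathstart_def pathfinish_def)
    have e: "g1 0 = g 0" "g1 1 = w" "g2 0 = w" "g2 1 = g 1"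
      using t by (auto simp: g1_def g2_def subpath_def)
    have n: "g 0 \<notin> path_image g2" "g 1 \<notin> path_image g1"
      using Int_pair_notin[OF sb(5) g01] Int_pair_notin[of "path_image g2" "g 1" "g 0"] sb(6) g01
      by (auto simp: insert_commute)
    have i12: "path_image g1 \<inter> path_image g2 \<subseteq> {w}" using sb(4) t(3) n by blast
    have fin: "finite (path_image g \<inter> K - {g 0, g 1})" using less.prems(4) by blast
    have mem: "w \<in> path_image g \<inter> K - {g 0, g 1}" using w by blast
    have K1: "drawable (K \<union> path_image g1)"
    proof (rule less.hyps)
      have "path_image g1 \<inter> K - {g1 0, g1 1} \<subset> path_image g \<inter> K - {g 0, g 1}"
        unfolding e using sb(3) n mem by blast
      then show "card (path_image g1 \<inter> K - {g1 0, g1 1}) < card (path_image g \<inter> K - {g 0, g 1})"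
        by (rule psubset_card_mono[OF fin])
      show "finite (path_image g1 \<inter> K)"
        by (rule finite_subset[OF _ less.prems(4)]) (use sb(3) in blast)
    qed (use less.prems sb in auto)
    \<comment> \<open>The second half meets the first only in \<open>w\<close>. As an end,
      \<open>w\<close> is no longer counted, so the induction measure drops.\<close>
    have "drawable ((K \<union> path_image g1) \<union> path_image g2)"
    proof (rule less.hyps[OF _ K1])
      have "path_image g2 \<inter> (K \<union> path_image g1) - {g2 0, g2 1} \<subset> path_image g \<inter> K - {g 0, g 1}"
        unfolding e using sb(3) n mem i12 by blast
      then show "card (path_image g2 \<inter> (K \<union> path_image g1) - {g2 0, g2 1}) < card (path_image g \<inter> K - {g 0, g 1})"
        by (rule psubset_card_mono[OF fin])
      have "path_image g2 \<inter> (K \<union> path_image g1) \<subseteq> insert w (path_image g \<inter> K)" using sb(3) i12 by blast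
      then show "finite (path_image g2 \<inter> (K \<union> path_image g1))"
        using less.prems(4) by (meson finite_insert finite_subset)
    qed (use less.prems sb in auto)
    then show ?thesis using sb(3) by (simp add: Un_assoc)
  qed
qed

text \<open>The vertices reachable from \<open>u\<close> with the edges at them, and all other
  vertices and edges, form two disjoint closed sets that cover the support.\<close>

lemma connected_support_imp_graph_connected:
  assumes emb: "embedded_graph G" and con: "connected (support G)"
  shows "graph_connected G"
  unfolding graph_connected_def
proof (intro ballI)
  fix u v assume u: "u \<in> verts G" and v: "v \<in> verts G"
  define R where "R = {v \<in> verts G. (u, v) \<in> (graph_adj G)\<^sup>*}"
  define X where "X = R \<union> \<Union>{e \<in> edges G. e \<inter> R \<noteq> {}}"
  define Y where "Y = (verts G - R) \<union> \<Union>{e \<in> edges G. e \<inter> R = {}}"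
  have fin: "finite R" "finite (verts G - R)" using graph_finite[OF emb] unfolding R_def by auto
  have clE: "closed (\<Union>A)" if "A \<subseteq> edges G" for A
    using that graph_finite(2)[OF emb] edge_pathD(5)[OF emb] compact_imp_closed
    by (intro closed_Union) (auto intro: finite_subset)
  have cl: "closed X" "closed Y"
    unfolding X_def Y_def using fin
    by (intro closed_Un[OF finite_imp_closed clE]; auto)+
  have cov: "support G \<subseteq> X \<union> Y" unfolding support_def X_def Y_def by blast
  have RX: "z \<in> R" if ze: "z \<in> verts G" "z \<in> e" "e \<in> edges G" "e \<inter> R \<noteq> {}" for z e
  proof -
    obtain y where y: "y \<in> e" "y \<in> R" using ze(4) by blast
    have "(y, z) \<in> graph_adj G" using y ze unfolding graph_adj_def R_def by blast
    then show ?thesis using y(2) ze(1) unfolding R_def by (auto intro: rtrancl_into_rtrancl)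
  qed
  have disj: "X \<inter> Y = {}"
  proof (rule ccontr)
    assume "X \<inter> Y \<noteq> {}"
    then obtain z where z: "z \<in> X" "z \<in> Y" by blast
    have 1: "z \<in> R \<or> z \<notin> verts G" using z(1) RX unfolding X_def by blast
    have 2: "z \<notin> R" using z(2) unfolding Y_def by blast
    then have nv: "z \<notin> verts G" using 1 by blast
    obtain e where e: "e \<in> edges G" "z \<in> e" "e \<inter> R \<noteq> {}" using z(1) 2 unfolding X_def by blast
    obtain e' where e': "e' \<in> edges G" "z \<in> e'" "e' \<inter> R = {}" using z(2) nv unfolding Y_def by blast
    have "e \<noteq> e'" using e(3) e'(3) by blast
    then show False using edges_meet_in_verts[OF emb e(1) e'(1)] e(2) e'(2) nv by blast
  qed
  have "u \<in> X \<inter> support G" using u unfolding X_def R_def support_def by auto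
  then have "Y \<inter> support G = {}"
    using connected_closedD[OF con _ cov cl] disj by blast
  moreover have "v \<in> support G" using v unfolding support_def by blast
  ultimately have "v \<in> R" using v unfolding Y_def by blast
  then show "(u, v) \<in> (graph_adj G)\<^sup>*" unfolding R_def by blast
qed

text \<open>By compactness there is a shortest parameter interval leading from \<open>X\<close> to
  \<open>Y\<close>. On it \<open>g\<close> meets the two sets only at the ends, and an arc can be
  extracted from this part of the path.\<close>

lemma arc_between_closed_sets:
  fixes g :: "real \<Rightarrow> 'a::euclidean_space"
  assumes g: "path g" "pathstart g \<in> X" "pathfinish g \<in> Y" and cl: "closed X" "closed Y" and "X \<inter> Y = {}"
  obtains f where "arc f" "path_image f \<subseteq> path_image g"
    "path_image f \<inter> X = {pathstart f}" "path_image f \<inter> Y = {pathfinish f}"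
proof -
  have cont: "continuous_on {0..1} g" using g(1) path_def by blast
  define A B where "A = {0..1} \<inter> g -` X" and "B = {0..1} \<inter> g -` Y"
  have "closed A" "closed B"
    unfolding A_def B_def using cont cl by (auto intro!: continuous_closed_preimage)
  then have cp: "compact A" "compact B"
    unfolding A_def B_def by (metis compact_Icc compact_Int_closed inf_left_idem)+
  define S where "S = (A \<times> B) \<inter> {p. fst p \<le> snd p}"
  have "closed {p::real \<times> real. fst p \<le> snd p}" by (intro closed_Collect_le continuous_intros)
  then have "compact S" unfolding S_def using cp by (intro compact_Int_closed compact_Times)
  moreover have "(0, 1) \<in> S"
    using g unfolding S_def A_def B_def pathstart_def pathfinish_def by auto
  moreover have "continuous_on S (\<lambda>p. snd p - fst p)" by (intro continuous_intros)
  ultimately obtain p where p: "p \<in> S" "\<And>q. q \<in> S \<Longrightarrow> snd p - fst p \<le> snd q - fst q"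
    using continuous_attains_inf[of S "\<lambda>p. snd p - fst p"] by (metis empty_iff)
  define s t where "s = fst p" and "t = snd p"
  have st: "0 \<le> s" "s \<le> t" "t \<le> 1" "g s \<in> X" "g t \<in> Y"
    using p(1) unfolding S_def A_def B_def s_def t_def by auto
  have only: "(g r \<in> X \<longrightarrow> r = s) \<and> (g r \<in> Y \<longrightarrow> r = t)" if "s \<le> r" "r \<le> t" for r
  proof -
    have "r \<le> s" if "g r \<in> X"
      using p(2)[of "(r, t)"] that st \<open>s \<le> r\<close> \<open>r \<le> t\<close> unfolding S_def A_def B_def s_def t_def by auto
    moreover have "t \<le> r" if "g r \<in> Y"
      using p(2)[of "(s, r)"] that st \<open>s \<le> r\<close> \<open>r \<le> t\<close> unfolding S_def A_def B_def s_def t_def by auto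
    ultimately show ?thesis using that by auto
  qed
  have ne: "g s \<noteq> g t" using st(4,5) assms(6) by auto
  have pp: "path (subpath s t g)" using g(1) st by (intro path_subpath) auto
  obtain f where f: "arc f" "path_image f \<subseteq> path_image (subpath s t g)" "pathstart f = g s" "pathfinish f = g t"
    by (rule path_contains_arc[OF pp, of "g s" "g t"]) (use ne in auto)
  have im: "path_image (subpath s t g) = g ` {s..t}" using st by (auto simp: path_image_subpath)
  have sub: "path_image f \<subseteq> g ` {s..t}" using f(2) im by simp
  show thesis
  proof (rule that[OF f(1)])
    show "path_image f \<subseteq> path_image g"
      using sub st unfolding path_image_def by fastforce
    show "path_image f \<inter> X = {pathstart f}"
      using sub only st f(3) pathstart_in_path_image[of f] by fastforce
    show "path_image f \<inter> Y = {pathfinish f}"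
      using sub only st f(4) pathfinish_in_path_image[of f] by fastforce
  qed
qed

section \<open>Curves drawn in a chart, and insertion of a small loop\<close>

lemma chart_simple_path:
  assumes "homeomorphism (S2 - {q}) (UNIV :: complex set) k h"
  shows "simple_path c \<Longrightarrow> simple_path (h \<circ> c)" "arc c \<Longrightarrow> arc (h \<circ> c)"
proof -
  note ch = chartD[OF assms]
  have cont: "path c \<Longrightarrow> path (h \<circ> c)"
    by (intro path_continuous_image continuous_on_subset[OF ch(5)]) auto
  show "simple_path (h \<circ> c)" if "simple_path c"
    using that cont inj_eq[OF ch(7)] unfolding simple_path_def loop_free_def by simp
  show "arc (h \<circ> c)" if "arc c"
    using that cont inj_eq[OF ch(7)] unfolding arc_def inj_on_def by simp
qed

lemma chart_simple_closed_curve: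
  assumes "homeomorphism (S2 - {q}) (UNIV :: complex set) k h" "simple_path c" "pathfinish c = pathstart c"
  shows "simple_closed_curve (h ` path_image c)"
  unfolding simple_closed_curve_def
proof (intro conjI exI[of _ "h \<circ> c"])
  show "h ` path_image c \<subseteq> S2" using chartD(1)[OF assms(1)] by blast
  show "simple_path (h \<circ> c)" using chart_simple_path(1)[OF assms(1)] assms(2) by blast
  show "pathfinish (h \<circ> c) = pathstart (h \<circ> c)" using assms(3) by (simp add: pathfinish_def pathstart_def)
  show "path_image (h \<circ> c) = h ` path_image c" by (rule path_image_compose)
qed

text \<open>A small rectangle in the chart at \<open>P (i + 1)\<close> serves: this point is at
  infinity, hence outside, and the rectangle is chosen to miss \<open>K\<close> and
  \<open>P (i + 2)\<close>.\<close>

lemma small_curve_around: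
  assumes P: "range P \<subseteq> S2" "inj P" and K: "closed K" "\<And>j. P j \<notin> K"
  obtains Z where "simple_closed_curve Z" "Z \<inter> K = {}" "encircles P i Z"
proof -
  have PS: "P j \<in> S2" for j using P(1) by blast
  have Pd: "P (i + 1) \<noteq> P i" "P (i + 2) \<noteq> P i" "P (i + 2) \<noteq> P (i + 1)"
    using P(2) index3(8-10) by (metis injD)+
  obtain h k where hk: "homeomorphism (S2 - {P (i + 1)}) (UNIV :: complex set) k h"
    using sphere_chart[OF PS] by blast
  note ch = chartD[OF hk]
  define U where "U = h -` (- (K \<union> {P (i + 2)}))"
  have "open U" unfolding U_def using ch(5) K(1) by (intro open_vimage) auto
  moreover have hp: "h (k (P i)) = P i" using ch(4)[OF PS] Pd by auto
  then have "k (P i) \<in> U" unfolding U_def using K(2) Pd by auto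
  ultimately obtain a b where ab: "cbox a b \<subseteq> U" "k (P i) \<in> box a b"
    using open_contains_cbox[of U "k (P i)"] by metis
  have Re: "Re a < Re b" "Im a < Im b" using ab(2) by (auto simp: in_box_complex_iff)
  define Z where "Z = h ` path_image (rectpath a b)"
  have Z: "Z = h ` (cbox a b - box a b)"
    unfolding Z_def using Re by (simp add: path_image_rectpath_cbox_minus_box)
  have scc: "simple_closed_curve Z"
    unfolding Z_def using Re by (intro chart_simple_closed_curve[OF hk]) auto
  have ZK: "Z \<inter> K = {}" using ab(1) unfolding Z U_def by blast
  have "closed (h ` cbox a b)"
    using ch(5) by (meson compact_cbox compact_continuous_image compact_imp_closed continuous_on_subset subset_UNIV)
  then have oB: "openin (top_of_set S2) (S2 - h ` cbox a b)" by (rule openin_S2_Diff)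
  have oA: "openin (top_of_set S2) (h ` box a b)" by (rule chart_open_image[OF hk open_box])
  have bc: "box a b \<subseteq> cbox a b" by (rule box_subset_cbox)
  have "sep Z (P i) y" if y: "y \<in> S2" "y \<notin> h ` cbox a b" for y
  proof (rule sep_openI[OF oA oB])
    show "h ` box a b \<inter> (S2 - h ` cbox a b) = {}" using bc by blast
    show "S2 - Z \<subseteq> h ` box a b \<union> (S2 - h ` cbox a b)" unfolding Z by blast
    show "P i \<in> h ` box a b" using ab(2) hp by (metis imageI)
    then show "P i \<notin> Z" unfolding Z using ch(7) by (auto dest: injD)
    show "y \<in> S2 - h ` cbox a b" using y by blast
    show "y \<notin> Z" unfolding Z using y by blast
  qed
  moreover have "P (i + 1) \<notin> h ` cbox a b" using ch(2) by (metis imageE)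
  moreover have "P (i + 2) \<notin> h ` cbox a b"
  proof
    assume "P (i + 2) \<in> h ` cbox a b"
    then obtain z where "z \<in> cbox a b" "P (i + 2) = h z" by blast
    then show False using subsetD[OF ab(1), of z] unfolding U_def by simp
  qed
  ultimately have "encircles P i Z" unfolding encircles_def using PS by blast
  then show thesis using that scc ZK by blast
qed

text \<open>\<open>\<delta>\<close> is recorded as a packing number, which is the face distance by
  \<open>face_dist_packing\<close>. Zero values are permitted, so that a drawing can start from a
  single point.\<close>

definition realizes :: "(3 \<Rightarrow> real^3) \<Rightarrow> (real^3) set \<Rightarrow> (3 \<Rightarrow> nat) \<Rightarrow> (3 \<Rightarrow> nat) \<Rightarrow> bool" where
  "realizes P K \<mu> \<delta> \<longleftrightarrow> drawable K \<and> connected K \<and> K \<noteq> {} \<and> (\<forall>j. P j \<notin> K) \<and>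
     (\<forall>i. max_packing K (encircles P i) (\<mu> i) \<and> max_packing K (\<lambda>C. sep C (P (i + 1)) (P (i + 2))) (\<delta> i))"

text \<open>Removing \<open>Z\<close> from a packing in \<open>K'\<close> leaves a packing in
  \<open>K\<close>, so a maximum grows by at most one, and it does so exactly if \<open>Z\<close>
  qualifies.\<close>

lemma max_packing_add_curve:
  assumes mp: "max_packing K Q n" and Z: "simple_closed_curve Z" "Z \<subseteq> K'" "Z \<inter> K = {}" and KK: "K \<subseteq> K'"
    and only: "\<And>C. simple_closed_curve C \<Longrightarrow> C \<subseteq> K' \<Longrightarrow> C \<subseteq> K \<or> C = Z"
  shows "max_packing K' Q (if Q Z then Suc n else n)"
proof -
  obtain L where L: "packing K Q L" "card L = n" using mp unfolding max_packing_def by blast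
  have ZL: "Z \<notin> L" if "packing K Q L" for L
    using that Z(3) simple_closed_curveD(5)[OF Z(1)] unfolding packing_def by blast
  have L1: "packing K' Q L" using L(1) KK unfolding packing_def by blast
  have L2: "packing K' Q (insert Z L)" if "Q Z"
  proof -
    have "Z \<inter> C = {}" if "C \<in> L" for C using that L(1) Z(3) unfolding packing_def by blast
    then show ?thesis
      using L1 Z(1,2) that unfolding packing_def by (auto simp: pairwise_insert disjnt_def)
  qed
  have "\<exists>L'. packing K' Q L' \<and> card L' = (if Q Z then Suc n else n)"
  proof (cases "Q Z")
    case True
    have "card (insert Z L) = Suc n" using ZL[OF L(1)] L unfolding packing_def by simp
    then show ?thesis using L2[OF True] True by auto
  qed (use L1 L(2) in auto)
  moreover have "card L' \<le> (if Q Z then Suc n else n)" if L': "packing K' Q L'" for L'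
  proof -
    have "packing K Q (L' - {Z})"
      using L' only unfolding packing_def by (auto intro: pairwise_subset)
    then have "card (L' - {Z}) \<le> n" using mp unfolding max_packing_def by blast
    moreover have "finite L'" "Z \<in> L' \<Longrightarrow> Q Z" using L' unfolding packing_def by auto
    ultimately show ?thesis by (cases "Z \<in> L'") (auto simp: card_Diff_singleton_if split: if_splits)
  qed
  ultimately show ?thesis unfolding max_packing_def by blast
qed

lemma drawable_facts: "drawable K \<Longrightarrow> closed K \<and> K \<subseteq> S2"
  unfolding drawable_def using support_facts by blast

text \<open>The connecting arc \<open>St\<close> meets \<open>K\<close> and \<open>Z\<close> in one
  point each. No closed curve passes these cut points, so \<open>Z\<close> is the only curve that is
  new in \<open>K'\<close>.\<close>

lemma realizes_add_loop:
  assumes P: "range P \<subseteq> S2" "inj P" and r: "realizes P K \<mu> \<delta>"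
  shows "\<exists>K'. realizes P K' (\<lambda>j. if j = i then Suc (\<mu> j) else \<mu> j) (\<lambda>j. if j = i then \<delta> j else Suc (\<delta> j))"
proof -
  have K: "drawable K" "connected K" "K \<noteq> {}" "\<And>j. P j \<notin> K"
    using r unfolding realizes_def by auto
  have Kc: "closed K" "K \<subseteq> S2" using drawable_facts K(1) by auto
  obtain Z where Z: "simple_closed_curve Z" "Z \<inter> K = {}" "encircles P i Z"
    using small_curve_around[OF P Kc(1) K(4)] by blast
  note ZD = simple_closed_curveD[OF Z(1)]
  have PZ: "P j \<notin> Z" for j
    using Z(3) index3(11)[of j i] sepD unfolding encircles_def by blast
  have finP: "finite (range P)" by simp
  have o: "openin (top_of_set S2) (S2 - range P)"
    by (rule openin_S2_Diff[OF finite_imp_closed[OF finP]])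
  \<comment> \<open>The three points do not disconnect the sphere, so the connecting arc can avoid
    them.\<close>
  have conP: "connected (S2 - range P)"
    by (rule connected_openin_S2_diff_finite[OF _ _ finP]) (auto intro: connected_sphere)
  have "locally path_connected (S2 - range P)"
    by (rule locally_open_subset[OF locally_path_connected_sphere o])
  note eq = path_component_eq_connected_component[OF this]
  have pc: "path_connected (S2 - range P)"
    unfolding path_connected_component eq using conP connected_iff_connected_component by blast
  obtain x y where xy: "x \<in> Z" "y \<in> K" using ZD(5) K(3) by blast
  then have "x \<in> S2 - range P" "y \<in> S2 - range P" using PZ K(4) ZD(1) Kc(2) by auto
  then obtain g where g: "path g" "path_image g \<subseteq> S2 - range P" "pathstart g = x" "pathfinish g = y"
    using pc unfolding path_connected_def by metis
  obtain f where f: "arc f" "path_image f \<subseteq> path_image g"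
    "path_image f \<inter> Z = {pathstart f}" "path_image f \<inter> K = {pathfinish f}"
    by (rule arc_between_closed_sets[OF g(1), of Z K]) (use g xy ZD Kc Z(2) in auto)
  define St where "St = path_image f"
  have St: "St \<subseteq> S2" "\<And>j. P j \<notin> St" "closed St" "connected St"
    using f(1,2) g(2) closed_arc_image connected_arc_image unfolding St_def by auto
  define K' where "K' = K \<union> St \<union> Z"
  have d1: "drawable (K \<union> St)"
    unfolding St_def by (rule drawable_Un_arc[OF K(1) f(1)]) (use St f in \<open>auto simp: St_def\<close>)
  obtain c where c: "simple_path c" "pathfinish c = pathstart c" "path_image c = Z"
    using Z(1) unfolding simple_closed_curve_def by blast
  have "c 0 \<in> path_image c" "c (1/2) \<in> path_image c" unfolding path_image_def by auto
  \<comment> \<open>The loop is cut into two arcs, because \<open>drawable_Un_arc\<close> adds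
    arcs.\<close>
  then obtain u v where uv: "arc u" "arc v" "path_image u \<inter> path_image v = {c 0, c (1/2)}"
    "path_image u \<union> path_image v = Z"
    using exists_double_arc[OF c(1,2) _ _ simple_path_start_neq_half[OF c(1)]] c(3) by metis
  have ZK: "Z \<inter> (K \<union> St) \<subseteq> {pathstart f}" using Z(2) f(3) unfolding St_def by blast
  have d2: "drawable (K \<union> St \<union> path_image u)"
  proof (rule drawable_Un_arc[OF d1 uv(1)])
    show "path_image u \<subseteq> S2" using uv(4) ZD(1) by blast
    have "path_image u \<inter> (K \<union> St) \<subseteq> {pathstart f}" using ZK uv(4) by blast
    then show "finite (path_image u \<inter> (K \<union> St))" using finite_subset by blast
  qed
  have d3: "drawable (K \<union> St \<union> path_image u \<union> path_image v)"
  proof (rule drawable_Un_arc[OF d2 uv(2)])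
    show "path_image v \<subseteq> S2" using uv(4) ZD(1) by blast
    have "path_image v \<inter> (K \<union> St \<union> path_image u) \<subseteq> {pathstart f, c 0, c (1/2)}" using ZK uv(3,4) by blast
    then show "finite (path_image v \<inter> (K \<union> St \<union> path_image u))" using finite_subset by blast
  qed
  have eqK: "K \<union> St \<union> path_image u \<union> path_image v = K'"
    unfolding K'_def using uv(4) by (simp add: Un_assoc)
  have dK: "drawable K'" using d3 eqK by simp
  have KS: "K \<inter> St \<noteq> {}" "(K \<union> St) \<inter> Z \<noteq> {}" using f(3,4) unfolding St_def by blast+
  have conK: "connected K'"
    unfolding K'_def by (intro connected_Un K(2) St(4) ZD(4) KS)
  have only: "C \<subseteq> K \<or> C = Z" if C: "simple_closed_curve C" "C \<subseteq> K'" for C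
  proof -
    have "C \<subseteq> K \<or> C \<subseteq> St \<union> Z"
    proof (rule simple_closed_curve_cut_point[OF C(1) Kc(1)])
      show "closed (St \<union> Z)" using St(3) ZD(3) by blast
      show "C \<subseteq> K \<union> (St \<union> Z)" using C(2) unfolding K'_def by blast
      show "K \<inter> (St \<union> Z) \<subseteq> {pathfinish f}" using f(4) Z(2) unfolding St_def by blast
    qed
    moreover have "C \<subseteq> St \<or> C \<subseteq> Z" if "C \<subseteq> St \<union> Z"
      by (rule simple_closed_curve_cut_point[OF C(1) St(3) ZD(3) that, of "pathstart f"])
        (use f(3) St_def in auto)
    moreover have "\<not> C \<subseteq> St" using no_curve_in_arc[OF f(1)] St(1) C(1) unfolding St_def by blast
    moreover have "C = Z" if "C \<subseteq> Z" using curve_in_curve_eq[OF C(1) Z(1) that] .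
    ultimately show ?thesis by blast
  qed
  have mp: "max_packing K' Q (if Q Z then Suc n else n)" if "max_packing K Q n" for Q n
    by (rule max_packing_add_curve[OF that Z(1) _ Z(2) _ only]) (auto simp: K'_def)
  have s1: "sep Z (P i) (P (i + 1))" "sep Z (P i) (P (i + 2))" using Z(3) unfolding encircles_def by auto
  have s2: "\<not> sep Z (P (i + 1)) (P (i + 2))" by (rule sep_side_unique[OF Z(1) s1])
  note sc = sep_commute[of Z]
  have e: "encircles P j Z \<longleftrightarrow> j = i" for j
    using index3(11)[of j i] s1 s2 sc index3(1-10)[of i] unfolding encircles_def by metis
  have d: "sep Z (P (j + 1)) (P (j + 2)) \<longleftrightarrow> j \<noteq> i" for j
    using index3(11)[of j i] s1 s2 sc index3(1-10)[of i] by metis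
  have "realizes P K' (\<lambda>j. if j = i then Suc (\<mu> j) else \<mu> j) (\<lambda>j. if j = i then \<delta> j else Suc (\<delta> j))"
    unfolding realizes_def
  proof (intro conjI allI)
    show "drawable K'" "connected K'" "K' \<noteq> {}" using dK conK K(3) K'_def by auto
    show "P j \<notin> K'" for j using K(4) St(2) PZ unfolding K'_def by blast
    fix j
    have m: "max_packing K (encircles P j) (\<mu> j)" "max_packing K (\<lambda>C. sep C (P (j + 1)) (P (j + 2))) (\<delta> j)"
      using r unfolding realizes_def by auto
    show "max_packing K' (encircles P j) (if j = i then Suc (\<mu> j) else \<mu> j)"
      using mp[OF m(1)] unfolding e .
    show "max_packing K' (\<lambda>C. sep C (P (j + 1)) (P (j + 2))) (if j = i then \<delta> j else Suc (\<delta> j))"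
      using mp[OF m(2)] unfolding d by (simp split: if_splits)
  qed
  then show ?thesis by blast
qed

lemma realizes_add_loops:
  assumes P: "range P \<subseteq> S2" "inj P" and r: "realizes P K \<mu> \<delta>"
  shows "\<exists>K'. realizes P K' (\<lambda>j. if j = i then \<mu> j + n else \<mu> j) (\<lambda>j. if j = i then \<delta> j else \<delta> j + n)"
proof (induction n)
  case 0
  have "(\<lambda>j. if j = i then \<mu> j + 0 else \<mu> j) = \<mu>" "(\<lambda>j. if j = i then \<delta> j else \<delta> j + 0) = \<delta>" by auto
  then show ?case using r by auto
next
  case (Suc n)
  then obtain K' where K': "realizes P K' (\<lambda>j. if j = i then \<mu> j + n else \<mu> j) (\<lambda>j. if j = i then \<delta> j else \<delta> j + n)"
    by blast
  have e: "(\<lambda>j. if j = i then Suc (if j = i then \<mu> j + n else \<mu> j) else (if j = i then \<mu> j + n else \<mu> j)) =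
      (\<lambda>j. if j = i then \<mu> j + Suc n else \<mu> j)"
    "(\<lambda>j. if j = i then (if j = i then \<delta> j else \<delta> j + n) else Suc (if j = i then \<delta> j else \<delta> j + n)) =
      (\<lambda>j. if j = i then \<delta> j else \<delta> j + Suc n)"
    by auto
  show ?case using realizes_add_loop[OF P K', of i] unfolding e .
qed

section \<open>Triangles\<close>

definition segments :: "complex set set \<Rightarrow> bool" where
  "segments S \<longleftrightarrow> finite S \<and> (\<forall>T\<in>S. \<exists>a b. a \<noteq> b \<and> T = closed_segment a b)"

text \<open>Two common points put both segments on one line, where the connected compact union is
  again a segment.\<close>

lemma segment_union:
  fixes a b c d :: complex
  assumes "infinite (closed_segment a b \<inter> closed_segment c d)"
  shows "\<exists>x y. x \<noteq> y \<and> closed_segment a b \<union> closed_segment c d = closed_segment x y"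
proof -
  let ?T = "closed_segment a b" and ?T' = "closed_segment c d"
  obtain u where u: "u \<in> ?T \<inter> ?T'" using assms by (metis finite.emptyI all_not_in_conv)
  have "infinite (?T \<inter> ?T' - {u})" using assms by simp
  then obtain v where v: "v \<in> ?T \<inter> ?T'" "v \<noteq> u" by (metis Diff_iff finite.emptyI all_not_in_conv singletonI)
  have line: "X \<subseteq> affine hull {u, v}" if "collinear X" "u \<in> X" "v \<in> X" for X
  proof
    fix x assume "x \<in> X"
    then have "collinear {u, v, x}" using that collinear_subset by (metis empty_subsetI insert_subset)
    then show "x \<in> affine hull {u, v}" using v(2) collinear_3_affine_hull by metis
  qed
  have "?T \<union> ?T' \<subseteq> affine hull {u, v}" using line collinear_closed_segment u v by blast
  moreover have "collinear (affine hull {u, v})" by (simp add: collinear_affine_hull_collinear)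
  ultimately have "collinear (?T \<union> ?T')" using collinear_subset by blast
  moreover have "connected (?T \<union> ?T')" using u by (intro connected_Un) auto
  moreover have "compact (?T \<union> ?T')" by (intro compact_Un) auto
  ultimately obtain x y where xy: "?T \<union> ?T' = closed_segment x y"
    using compact_convex_collinear_segment_alt[of "?T \<union> ?T'"] u by (metis IntD1 UnI1 empty_iff)
  moreover have "x \<noteq> y"
  proof
    assume "x = y"
    then have "?T \<union> ?T' = {x}" using xy by simp
    then show False using u v by (metis IntD1 UnI1 singletonD)
  qed
  ultimately show ?thesis by blast
qed

text \<open>Merging two segments with infinite intersection lowers their number. This is necessary
  because vertical sides of different triangles may lie on the same line, while
  \<open>drawable_Un_arc\<close> asks for finite intersections.\<close>

lemma segments_with_finite_intersections:
  assumes "segments S"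
  shows "\<exists>S'. segments S' \<and> \<Union>S' = \<Union>S \<and> (\<forall>T\<in>S'. \<forall>T'\<in>S'. T \<noteq> T' \<longrightarrow> finite (T \<inter> T'))"
  using assms
proof (induction "card S" arbitrary: S rule: less_induct)
  case less
  show ?case
  proof (cases "\<forall>T\<in>S. \<forall>T'\<in>S. T \<noteq> T' \<longrightarrow> finite (T \<inter> T')")
    case True
    then show ?thesis using less.prems by blast
  next
    case False
    then obtain T T' where T: "T \<in> S" "T' \<in> S" "T \<noteq> T'" "infinite (T \<inter> T')" by blast
    obtain a b where ab: "T = closed_segment a b"
      using less.prems T(1) unfolding segments_def by metis
    obtain c d where cd: "T' = closed_segment c d"
      using less.prems T(2) unfolding segments_def by metis
    obtain x y where xy: "x \<noteq> y" "T \<union> T' = closed_segment x y"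
      using segment_union[of a b c d] T(4) unfolding ab cd by metis
    define R where "R = insert (T \<union> T') (S - {T, T'})"
    have fin: "finite S" using less.prems segments_def by blast
    have "card R \<le> Suc (card (S - {T, T'}))" unfolding R_def by (rule card_insert_le_m1) (auto simp: fin)
    also have "card (S - {T, T'}) = card S - 2" using T fin by (simp add: card_Diff_subset)
    also have "Suc (card S - 2) < card S"
    proof -
      have "card {T, T'} \<le> card S" using T fin by (intro card_mono) auto
      then show ?thesis using T(3) by simp
    qed
    finally have cR: "card R < card S" .
    have "segments R" using less.prems xy fin unfolding segments_def R_def by auto
    from less.hyps[OF cR this] obtain S' where
      S': "segments S'" "\<Union>S' = \<Union>R" "\<forall>T\<in>S'. \<forall>T'\<in>S'. T \<noteq> T' \<longrightarrow> finite (T \<inter> T')"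
      by metis
    moreover have "\<Union>R = \<Union>S" using T unfolding R_def by auto
    ultimately show ?thesis by (metis)
  qed
qed

lemma drawable_segments:
  assumes hk: "homeomorphism (S2 - {q}) (UNIV :: complex set) k h" and S: "segments S"
  shows "drawable (h ` \<Union>S)"
proof -
  obtain R where R: "segments R" "\<Union>R = \<Union>S" "\<And>T T'. T \<in> R \<Longrightarrow> T' \<in> R \<Longrightarrow> T \<noteq> T' \<Longrightarrow> finite (T \<inter> T')"
    using segments_with_finite_intersections[OF S] by metis
  have "finite R" using R(1) segments_def by blast
  have "drawable (h ` \<Union>Q)" if "finite Q" "Q \<subseteq> R" for Q
    using that
  proof (induction Q rule: finite_induct)
    case empty
    then show ?case using drawable_empty by simp
  next
    case (insert T Q)
    have "T \<in> R" using insert.prems by simp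
    then obtain a b where ab: "a \<noteq> b" "T = closed_segment a b"
      using R(1) unfolding segments_def by metis
    have im: "path_image (h \<circ> linepath a b) = h ` T" using ab(2) by (simp add: path_image_compose)
    have "drawable (h ` \<Union>Q \<union> path_image (h \<circ> linepath a b))"
    proof (rule drawable_Un_arc)
      show "drawable (h ` \<Union>Q)" using insert by simp
      show "arc (h \<circ> linepath a b)" by (rule chart_simple_path(2)[OF hk arc_linepath[OF ab(1)]])
      show "path_image (h \<circ> linepath a b) \<subseteq> S2" unfolding im using chartD(1)[OF hk] by blast
      have "T \<inter> \<Union>Q = (\<Union>T'\<in>Q. T \<inter> T')" by auto
      then have "h ` T \<inter> h ` \<Union>Q = h ` (\<Union>T'\<in>Q. T \<inter> T')"
        using image_Int[OF chartD(7)[OF hk], of T "\<Union>Q"] by metis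
      moreover have "finite (\<Union>T'\<in>Q. T \<inter> T')"
        using insert by (intro finite_UN_I R(3)) auto
      ultimately show "finite (path_image (h \<circ> linepath a b) \<inter> h ` \<Union>Q)" unfolding im by simp
    qed
    then show ?case unfolding im by (simp add: image_Un Un_commute)
  qed
  then have "drawable (h ` \<Union>R)" using \<open>finite R\<close> by blast
  then show ?thesis using R(2) by simp
qed

text \<open>\<open>{z. tri \<sigma> a c z = r}\<close> is the isosceles triangle with tip \<open>c + \<sigma> r\<close> on the real axis and
  opposite side on the vertical line through \<open>c - \<sigma> r\<close>. Straight triangles are used so that all
  intersections with lines can be computed by linear arithmetic.\<close>

definition tri :: "real \<Rightarrow> real \<Rightarrow> real \<Rightarrow> complex \<Rightarrow> real" where
  "tri \<sigma> a c z = max (- \<sigma> * (Re z - c)) (\<sigma> * (Re z - c) + a * \<bar>Im z\<bar>)"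

lemma continuous_tri: "continuous_on UNIV (tri \<sigma> a c)"
  unfolding tri_def by (intro continuous_intros)

context
  fixes \<sigma> a c r :: real
  assumes \<sigma>: "\<sigma> = 1 \<or> \<sigma> = -1" and a: "a > 0" and r: "r > 0"
begin

abbreviation "tipv \<equiv> Complex (c + \<sigma> * r) 0"
abbreviation "topv \<equiv> Complex (c - \<sigma> * r) (2 * r / a)"
abbreviation "botv \<equiv> Complex (c - \<sigma> * r) (- 2 * r / a)"

lemma tri_neq: "tipv \<noteq> topv" "topv \<noteq> botv" "botv \<noteq> tipv"
  using a r by (auto simp: complex_eq_iff)

lemma mem_top_side: "z \<in> closed_segment tipv topv \<longleftrightarrow> (\<exists>t. 0 \<le> t \<and> t \<le> 1 \<and> Re z = c + \<sigma> * r - 2 * t * \<sigma> * r \<and> Im z = t * (2 * r / a))"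
  unfolding in_segment complex_eq_iff by (simp add: algebra_simps)

lemma mem_bot_side: "z \<in> closed_segment botv tipv \<longleftrightarrow> (\<exists>t. 0 \<le> t \<and> t \<le> 1 \<and> Re z = c - \<sigma> * r + 2 * t * \<sigma> * r \<and> Im z = - (1 - t) * (2 * r / a))"
  unfolding in_segment complex_eq_iff by (simp add: algebra_simps diff_divide_distrib)

lemma mem_base: "z \<in> closed_segment topv botv \<longleftrightarrow> Re z = c - \<sigma> * r \<and> \<bar>Im z\<bar> \<le> 2 * r / a"
proof -
  have "z \<in> closed_segment topv botv \<longleftrightarrow> Re z = c - \<sigma> * r \<and> Im z \<in> closed_segment (2 * r / a) (- 2 * r / a)"
    using closed_segment_same_Re[of topv botv] by auto
  then show ?thesis using a r by (auto simp: closed_segment_eq_real_ivl abs_le_iff divide_le_0_iff)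
qed

lemma tri_level: "{z. tri \<sigma> a c z = r} = closed_segment tipv topv \<union> closed_segment topv botv \<union> closed_segment botv tipv"
proof (intro equalityI subsetI)
  fix z assume "z \<in> {z. tri \<sigma> a c z = r}"
  then have z: "max (- \<sigma> * (Re z - c)) (\<sigma> * (Re z - c) + a * \<bar>Im z\<bar>) = r" by (simp add: tri_def)
  define x where "x = \<sigma> * (Re z - c)"
  have Rez: "Re z = c + \<sigma> * x" using \<sigma> unfolding x_def by auto
  have z': "max (- x) (x + a * \<bar>Im z\<bar>) = r" using z unfolding x_def by simp
  show "z \<in> closed_segment tipv topv \<union> closed_segment topv botv \<union> closed_segment botv tipv"
  proof (cases "- x = r")
    case True
    then have "a * \<bar>Im z\<bar> \<le> 2 * r" using z' by linarith
    then have "\<bar>Im z\<bar> \<le> 2 * r / a" using a by (simp add: pos_le_divide_eq mult.commute)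
    moreover have "x = - r" using True by simp
    then have "Re z = c - \<sigma> * r" using Rez by simp
    ultimately show ?thesis using mem_base by blast
  next
    case False
    then have xr: "x + a * \<bar>Im z\<bar> = r" "- x \<le> r" using z' by linarith+
    define t where "t = a * \<bar>Im z\<bar> / (2 * r)"
    have ta: "2 * r * t = a * \<bar>Im z\<bar>" using r by (simp add: t_def)
    have t: "0 \<le> t" "t \<le> 1" using xr r a by (auto simp: t_def pos_divide_le_eq)
    have Im: "\<bar>Im z\<bar> = t * (2 * r / a)" using a r by (simp add: t_def)
    have x: "x = r - 2 * t * r" using xr(1) ta by (simp add: algebra_simps)
    show ?thesis
    proof (cases "Im z \<ge> 0")
      case True
      then have "z \<in> closed_segment tipv topv"
        unfolding mem_top_side using t Im by (intro exI[of _ t]) (simp add: Rez x algebra_simps)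
      then show ?thesis by blast
    next
      case False
      then have "z \<in> closed_segment botv tipv"
        unfolding mem_bot_side using t Im by (intro exI[of _ "1 - t"]) (simp add: Rez x algebra_simps)
      then show ?thesis by blast
    qed
  qed
next
  fix z assume "z \<in> closed_segment tipv topv \<union> closed_segment topv botv \<union> closed_segment botv tipv"
  then consider "z \<in> closed_segment tipv topv" | "z \<in> closed_segment topv botv" | "z \<in> closed_segment botv tipv" by blast
  then show "z \<in> {z. tri \<sigma> a c z = r}"
  proof cases
    case 1
    then obtain t where t: "0 \<le> t" "t \<le> 1" "Re z = c + \<sigma> * r - 2 * t * \<sigma> * r" "Im z = t * (2 * r / a)"
      unfolding mem_top_side by blast
    have "\<sigma> * (Re z - c) = r - 2 * (t * r)" using \<sigma> t(3) by (auto simp: algebra_simps)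
    moreover have "a * \<bar>Im z\<bar> = 2 * (t * r)" using t a r by (simp add: abs_mult)
    moreover have "0 \<le> t * r" "t * r \<le> r" using t r by (auto simp: mult_left_le_one_le)
    ultimately show ?thesis unfolding tri_def mem_Collect_eq mult_minus_left by linarith
  next
    case 2
    then have t: "Re z = c - \<sigma> * r" "\<bar>Im z\<bar> \<le> 2 * r / a" unfolding mem_base by auto
    have "\<sigma> * (Re z - c) = - r" using \<sigma> t(1) by auto
    moreover have "a * \<bar>Im z\<bar> \<le> 2 * r" using t(2) a by (simp add: pos_le_divide_eq mult.commute)
    ultimately show ?thesis unfolding tri_def mem_Collect_eq mult_minus_left by linarith
  next
    case 3
    then obtain t where t: "0 \<le> t" "t \<le> 1" "Re z = c - \<sigma> * r + 2 * t * \<sigma> * r" "Im z = - (1 - t) * (2 * r / a)"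
      unfolding mem_bot_side by blast
    have "\<sigma> * (Re z - c) = 2 * (t * r) - r" using \<sigma> t(3) by (auto simp: algebra_simps)
    moreover have "\<bar>Im z\<bar> = (1 - t) * (2 * r / a)"
      unfolding t(4) using t(1,2) a r by (subst minus_mult_left[symmetric], subst abs_minus) (simp add: abs_mult)
    then have "a * \<bar>Im z\<bar> = 2 * r - 2 * (t * r)" using a by (simp add: field_simps)
    moreover have "0 \<le> t * r" "t * r \<le> r" using t r by (auto simp: mult_left_le_one_le)
    ultimately show ?thesis unfolding tri_def mem_Collect_eq mult_minus_left by linarith
  qed
qed

lemma tri_simple_path:
  "simple_path (linepath tipv topv +++ linepath topv botv +++ linepath botv tipv)"
proof (rule simple_path_join3I)
  have ra: "2 * r / a > 0" using a r by simp
  have *: "t = 1" if "z \<in> closed_segment topv botv" "Re z = c + \<sigma> * r - 2 * t * \<sigma> * r" for z t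
    using that \<sigma> r unfolding mem_base by auto
  have **: "t = 0" if "z \<in> closed_segment topv botv" "Re z = c - \<sigma> * r + 2 * t * \<sigma> * r" for z t
    using that \<sigma> r unfolding mem_base by auto
  show "arc (linepath tipv topv)" "arc (linepath topv botv)" "arc (linepath botv tipv)"
    using tri_neq by (auto intro: arc_linepath)
  show "path_image (linepath tipv topv) \<inter> path_image (linepath topv botv) \<subseteq> {pathstart (linepath topv botv)}"
  proof
    fix z assume "z \<in> path_image (linepath tipv topv) \<inter> path_image (linepath topv botv)"
    then have z: "z \<in> closed_segment tipv topv" "z \<in> closed_segment topv botv" by auto
    obtain t where t: "Re z = c + \<sigma> * r - 2 * t * \<sigma> * r" "Im z = t * (2 * r / a)"
      using z(1) unfolding mem_top_side by blast
    then show "z \<in> {pathstart (linepath topv botv)}" using *[OF z(2) t(1)] by (simp add: complex_eq_iff)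
  qed
  show "path_image (linepath topv botv) \<inter> path_image (linepath botv tipv) \<subseteq> {pathstart (linepath botv tipv)}"
  proof
    fix z assume "z \<in> path_image (linepath topv botv) \<inter> path_image (linepath botv tipv)"
    then have z: "z \<in> closed_segment botv tipv" "z \<in> closed_segment topv botv" by auto
    obtain t where t: "Re z = c - \<sigma> * r + 2 * t * \<sigma> * r" "Im z = - (1 - t) * (2 * r / a)"
      using z(1) unfolding mem_bot_side by blast
    then show "z \<in> {pathstart (linepath botv tipv)}" using **[OF z(2) t(1)] by (simp add: complex_eq_iff)
  qed
  show "path_image (linepath tipv topv) \<inter> path_image (linepath botv tipv)
      \<subseteq> {pathstart (linepath tipv topv)} \<inter> {pathfinish (linepath botv tipv)}"
  proof
    fix z assume "z \<in> path_image (linepath tipv topv) \<inter> path_image (linepath botv tipv)"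
    then have z: "z \<in> closed_segment tipv topv" "z \<in> closed_segment botv tipv" by auto
    obtain t where t: "0 \<le> t" "Re z = c + \<sigma> * r - 2 * t * \<sigma> * r" "Im z = t * (2 * r / a)"
      using z(1) unfolding mem_top_side by blast
    obtain t' where t': "t' \<le> 1" "Im z = - ((1 - t') * (2 * r / a))"
      using z(2) unfolding mem_bot_side by (metis mult_minus_left)
    have "0 \<le> t * (2 * r / a)" "0 \<le> (1 - t') * (2 * r / a)"
      using t(1) t'(1) ra by (auto intro!: mult_nonneg_nonneg simp del: times_divide_eq_right)
    then have "t * (2 * r / a) = 0" using t(3) t'(2) by linarith
    then have "t = 0" using ra by auto
    then show "z \<in> {pathstart (linepath tipv topv)} \<inter> {pathfinish (linepath botv tipv)}"
      using t by (simp add: complex_eq_iff)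
  qed
qed auto

lemma tri_path_image:
  "path_image (linepath tipv topv +++ linepath topv botv +++ linepath botv tipv) = {z. tri \<sigma> a c z = r}"
  unfolding tri_level by (simp add: path_image_join Un_assoc)

lemma segments_tri: "\<exists>S. segments S \<and> {z. tri \<sigma> a c z = r} = \<Union>S"
proof (intro exI conjI)
  show "segments {closed_segment tipv topv, closed_segment topv botv, closed_segment botv tipv}"
    unfolding segments_def
  proof (intro conjI ballI)
    fix T assume "T \<in> {closed_segment tipv topv, closed_segment topv botv, closed_segment botv tipv}"
    then show "\<exists>a b. a \<noteq> b \<and> T = closed_segment a b" using tri_neq by (metis insertE empty_iff)
  qed simp
  show "{z. tri \<sigma> a c z = r} = \<Union>{closed_segment tipv topv, closed_segment topv botv, closed_segment botv tipv}"
    unfolding tri_level by auto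
qed

lemma tri_curve:
  assumes hk: "homeomorphism (S2 - {q}) (UNIV :: complex set) k h"
  shows "simple_closed_curve (h ` {z. tri \<sigma> a c z = r})"
  unfolding tri_path_image[symmetric]
  by (rule chart_simple_closed_curve[OF hk tri_simple_path]) simp

text \<open>The open sublevel set is one side. The closed one is compact, so its complement, which
  contains the point at infinity, is open in the sphere.\<close>

lemma tri_sep:
  assumes hk: "homeomorphism (S2 - {q}) (UNIV :: complex set) k h"
    and z: "tri \<sigma> a c z < r" and y: "y \<in> S2" "y \<notin> h ` {z. tri \<sigma> a c z \<le> r}"
  shows "sep (h ` {z. tri \<sigma> a c z = r}) (h z) y"
proof (rule sep_openI)
  note ch = chartD[OF hk]
  have "open {z. tri \<sigma> a c z < r}"
    by (rule open_Collect_less[OF continuous_tri continuous_on_const])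
  then show "openin (top_of_set S2) (h ` {z. tri \<sigma> a c z < r})" by (rule chart_open_image[OF hk])
  have "closed {z. tri \<sigma> a c z \<le> r}"
    by (rule closed_Collect_le[OF continuous_tri continuous_on_const])
  moreover have "{z. tri \<sigma> a c z \<le> r} \<subseteq> cbox (Complex (c - r) (- 2 * r / a)) (Complex (c + r) (2 * r / a))"
  proof
    fix z assume "z \<in> {z. tri \<sigma> a c z \<le> r}"
    then have *: "- (\<sigma> * (Re z - c)) \<le> r" "\<sigma> * (Re z - c) + a * \<bar>Im z\<bar> \<le> r" by (auto simp: tri_def)
    have "0 \<le> a * \<bar>Im z\<bar>" using a by simp
    note nn = this
    have 1: "\<bar>Re z - c\<bar> \<le> r"
    proof (rule disjE[OF \<sigma>])
      assume "\<sigma> = 1"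
      then have "- (Re z - c) \<le> r" "(Re z - c) + a * \<bar>Im z\<bar> \<le> r" using * by simp_all
      then show ?thesis using nn by linarith
    next
      assume "\<sigma> = -1"
      then have "Re z - c \<le> r" "- (Re z - c) + a * \<bar>Im z\<bar> \<le> r" using * by simp_all
      then show ?thesis using nn by linarith
    qed
    have "a * \<bar>Im z\<bar> \<le> 2 * r" using * by linarith
    then have "\<bar>Im z\<bar> \<le> 2 * r / a" using a by (simp add: pos_le_divide_eq mult.commute)
    then show "z \<in> cbox (Complex (c - r) (- 2 * r / a)) (Complex (c + r) (2 * r / a))"
      using 1 by (auto simp: in_cbox_complex_iff abs_le_iff)
  qed
  ultimately have "compact {z. tri \<sigma> a c z \<le> r}"
    by (meson bounded_cbox bounded_subset compact_eq_bounded_closed)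
  then have "closed (h ` {z. tri \<sigma> a c z \<le> r})"
    using ch(5) by (meson compact_continuous_image compact_imp_closed continuous_on_subset subset_UNIV)
  then show "openin (top_of_set S2) (S2 - h ` {z. tri \<sigma> a c z \<le> r})" by (rule openin_S2_Diff)
  show "h ` {z. tri \<sigma> a c z < r} \<inter> (S2 - h ` {z. tri \<sigma> a c z \<le> r}) = {}" by auto
  show "S2 - h ` {z. tri \<sigma> a c z = r} \<subseteq> h ` {z. tri \<sigma> a c z < r} \<union> (S2 - h ` {z. tri \<sigma> a c z \<le> r})"
  proof
    fix x assume x: "x \<in> S2 - h ` {z. tri \<sigma> a c z = r}"
    show "x \<in> h ` {z. tri \<sigma> a c z < r} \<union> (S2 - h ` {z. tri \<sigma> a c z \<le> r})"
    proof (cases "x \<in> h ` {z. tri \<sigma> a c z \<le> r}")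
      case True
      then obtain w where "x = h w" "tri \<sigma> a c w \<le> r" by blast
      moreover have "tri \<sigma> a c w \<noteq> r" using x calculation by blast
      ultimately show ?thesis by auto
    qed (use x in auto)
  qed
  show "h z \<in> h ` {z. tri \<sigma> a c z < r}" using z by blast
  show "h z \<notin> h ` {z. tri \<sigma> a c z = r}" using z inj_eq[OF ch(7)] by auto
  show "y \<in> S2 - h ` {z. tri \<sigma> a c z \<le> r}" using y by blast
  show "y \<notin> h ` {z. tri \<sigma> a c z = r}" using y by auto
qed

end

text \<open>Otherwise \<open>X\<close> would lie in the image under \<open>k\<close> of a compact
  set. Applied to rays, this lets them end in \<open>q\<close>.\<close>

lemma chart_unbounded_closure:
  assumes hk: "homeomorphism (S2 - {q}) (UNIV :: complex set) k h" and X: "\<not> bounded X"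
  shows "q \<in> closure (h ` X)"
proof (rule ccontr)
  assume q: "q \<notin> closure (h ` X)"
  note ch = chartD[OF hk]
  have "closure (h ` X) \<subseteq> S2" by (rule closure_minimal[OF image_subsetI[OF ch(1)] closed_sphere])
  then have sub: "closure (h ` X) \<subseteq> S2 - {q}" using q by blast
  have "compact (closure (h ` X))"
    using \<open>closure (h ` X) \<subseteq> S2\<close> by (meson bounded_sphere bounded_subset closed_closure compact_eq_bounded_closed)
  then have "compact (k ` closure (h ` X))"
    using sub ch(6) by (meson compact_continuous_image continuous_on_subset)
  moreover have "X \<subseteq> k ` closure (h ` X)"
  proof
    fix x assume "x \<in> X"
    then have "h x \<in> closure (h ` X)" by (intro subsetD[OF closure_subset] imageI)
    then show "x \<in> k ` closure (h ` X)" using ch(3)[of x] by (metis imageI)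
  qed
  ultimately show False using X by (meson bounded_subset compact_imp_bounded)
qed

section \<open>Drawings made of triangles\<close>

lemma segments_Union:
  assumes "finite A" "\<And>Y. Y \<in> A \<Longrightarrow> \<exists>S. segments S \<and> Y = \<Union>S"
  shows "\<exists>S. segments S \<and> \<Union>A = \<Union>S"
proof -
  obtain f where f: "\<And>Y. Y \<in> A \<Longrightarrow> segments (f Y) \<and> Y = \<Union>(f Y)" using assms(2) by metis
  have "segments (\<Union>(f ` A))" using f assms(1) unfolding segments_def by auto
  moreover have "\<Union>A = \<Union>(\<Union>(f ` A))"
  proof -
    have "\<Union>(\<Union>(f ` A)) = (\<Union>Y\<in>A. \<Union>(f Y))" by auto
    also have "\<dots> = \<Union>A" using f by auto
    finally show ?thesis by simp
  qed
  ultimately show ?thesis by blast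
qed

text \<open>Here \<open>x\<close> and \<open>\<eta>\<close> are \<open>Re z\<close> and
  \<open>\<bar>Im z\<bar>\<close> for a point of the noose defined below, and the three maxima tell
  on which triangle \<open>al\<close>, \<open>be\<close>, \<open>ga\<close> the point lies. Above
  the axis the noose has a steep side starting at \<open>- D\<close>, a horizontal side at height 1
  ending at \<open>x = - R - 1\<close>, and a slanted side down to \<open>x = R\<close>. The steep
  side meets no triangle, and the horizontal one meets them at integer abscissae only. On the
  slanted side \<open>be\<close> and \<open>ga\<close> have the levels \<open>R + w\<close> and
  \<open>R - w\<close> with \<open>0 \<le> w < 1\<close>, which are integers only at its end
  \<open>w = 0\<close>, while \<open>al\<close> is too far to the left.\<close>

lemma noose_arith:
  fixes x \<eta> R S D w :: real and s \<rho> T :: nat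
  assumes R: "R = real \<rho>" "S = real s" "D = S + R + 1" "\<rho> \<ge> 1" "\<rho> \<le> s + 1" "T \<le> s + \<rho>"
    and w: "w = (R - x) / (2 * R + 1)" and \<eta>: "\<eta> = min (min (2 * x + 2 * D) 1) w" "0 \<le> \<eta>"
  shows "max (x + D) (- (x + D) + \<eta>) = real k \<Longrightarrow> 1 \<le> k \<Longrightarrow> k \<le> s \<Longrightarrow> x = - D + real k \<and> \<eta> = 1"
    and "max (- x) (x + (2 * R + 2) * \<eta>) = real l \<Longrightarrow> 1 \<le> l \<Longrightarrow> l \<le> T \<Longrightarrow>
      x = R \<and> \<eta> = 0 \<or> (\<exists>k. 1 \<le> k \<and> k \<le> s \<and> x = - D + real k \<and> \<eta> = 1)"
    and "max (- x - D) (x + 2 * R * \<eta>) = real j \<Longrightarrow> 1 \<le> j \<Longrightarrow>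
      x = R \<and> \<eta> = 0 \<or> (\<exists>k. 1 \<le> k \<and> k \<le> s \<and> x = - D + real k \<and> \<eta> = 1)"
proof -
  have R1: "R \<ge> 1" and RS: "R \<le> S + 1" and TS: "real T \<le> S + R" using R by auto
  have ww: "2 * (R * w) + w = R - x"
  proof -
    have "(2 * R + 1) * w = R - x" using R1 w by simp
    then show ?thesis by (simp add: algebra_simps)
  qed
  have le: "\<eta> \<le> 2 * x + 2 * D" "\<eta> \<le> 1" "\<eta> \<le> w" unfolding \<eta>(1) by (simp_all add: min_le_iff_disj)
  have eq: "\<eta> = 2 * x + 2 * D \<or> \<eta> = 1 \<or> \<eta> = w" unfolding \<eta>(1) by (simp add: min_def)
  have xD: "0 \<le> x + D" using \<eta>(2) le(1) by linarith
  \<comment> \<open>The horizontal, the slanted and the steep side of the noose, in this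
    order.\<close>
  consider (1) "\<eta> = 1" "1 \<le> 2 * x + 2 * D" "1 \<le> w" | (2) "\<eta> = w" "w < 1" "w \<le> 2 * x + 2 * D"
    | (3) "\<eta> = 2 * x + 2 * D" "2 * x + 2 * D < 1"
    using le eq by linarith
  note cases = this
  have w1: "x \<le> - R - 1" if "1 \<le> w"
  proof -
    have "R * 1 \<le> R * w" using that R1 by (intro mult_left_mono) auto
    then show ?thesis using ww that by linarith
  qed
  have w2: "x > - R - 1" if "w < 1"
  proof -
    have "R * w \<le> R * 1" using that R1 by (intro mult_left_mono) auto
    then show ?thesis using ww that by linarith
  qed
  have w3: "x = R" if "w = 0" using ww that by simp
  show "x = - D + real k \<and> \<eta> = 1"
    if k: "max (x + D) (- (x + D) + \<eta>) = real k" "1 \<le> k" "k \<le> s"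
  proof -
    have "1 \<le> real k" "real k \<le> S" using k R by auto
    note kk = this
    show ?thesis using cases
    proof cases
      case 1
      then show ?thesis using k(1) \<open>1 \<le> real k\<close> by linarith
    next
      case 2
      then have "x + D = real k" using k(1) by linarith
      then show ?thesis using w2[OF 2(2)] \<open>real k \<le> S\<close> R(3) by linarith
    next
      case 3
      then show ?thesis using k(1) \<open>1 \<le> real k\<close> by linarith
    qed
  qed
  show "x = R \<and> \<eta> = 0 \<or> (\<exists>k. 1 \<le> k \<and> k \<le> s \<and> x = - D + real k \<and> \<eta> = 1)"
    if l: "max (- x) (x + (2 * R + 2) * \<eta>) = real l" "1 \<le> l" "l \<le> T"
  proof -
    have lT: "real l \<le> S + R" using l(3) TS by simp
    have e: "x + (2 * R + 2) * \<eta> = x + 2 * (R * \<eta>) + 2 * \<eta>" by (simp add: algebra_simps)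
    show ?thesis using cases
    proof cases
      case 1
      have x: "x \<le> - R - 1" by (rule w1[OF 1(3)])
      have "x = - real l" using l(1) x 1(1) unfolding e by simp
      then have "R + 1 \<le> real l" "real l \<le> S + R + 1 / 2" using lT x 1(2) R(3) by linarith+
      then have "l < s + \<rho> + 1" "\<rho> + 1 \<le> l" using R by linarith+
      then have "1 \<le> s + \<rho> + 1 - l" "s + \<rho> + 1 - l \<le> s" "x = - D + real (s + \<rho> + 1 - l)"
        using \<open>x = - real l\<close> R by (auto simp: of_nat_diff)
      then show ?thesis using 1(1) by blast
    next
      case 2
      show ?thesis
      proof (cases "w = 0")
        case True
        then show ?thesis using w3 2(1) by simp
      next
        case False
        then have "w > 0" using \<eta>(2) 2(1) by simp
        have "x + (2 * R + 2) * \<eta> = x + 2 * (R * w) + 2 * w" using e unfolding 2(1) .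
        then have "x + (2 * R + 2) * \<eta> = R + w" using ww by linarith
        then have "R < real l" "real l < R + 1" using l(1) w2[OF 2(2)] 2(2) \<open>w > 0\<close> by linarith+
        then have "real \<rho> < real l" "real l < real (\<rho> + 1)" using R(1) by simp_all
        then have "\<rho> < l" "l < \<rho> + 1" by (simp_all only: of_nat_less_iff)
        then show ?thesis by simp
      qed
    next
      case 3
      then have "- x > S + R" using R(3) by linarith
      then show ?thesis using l(1) lT by linarith
    qed
  qed
  show "x = R \<and> \<eta> = 0 \<or> (\<exists>k. 1 \<le> k \<and> k \<le> s \<and> x = - D + real k \<and> \<eta> = 1)"
    if j: "max (- x - D) (x + 2 * R * \<eta>) = real j" "1 \<le> j"
  proof -
    have j1: "1 \<le> real j" using j(2) by simp
    then have jx: "x + 2 * (R * \<eta>) = real j" using j(1) xD by (simp add: mult.assoc)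
    show ?thesis using cases
    proof cases
      case 1
      have x: "x \<le> - R - 1" by (rule w1[OF 1(3)])
      have "x = real j - 2 * R" using jx 1(1) by simp
      moreover have "real (s + 1 - \<rho> + j) = S + 1 - R + real j" using R by (simp add: of_nat_diff)
      ultimately have "x = - D + real (s + 1 - \<rho> + j)" using R(3) by simp
      moreover have "real (s + 1 - \<rho> + j) \<le> real s" using calculation x R by linarith
      then have "s + 1 - \<rho> + j \<le> s" by (simp only: of_nat_le_iff)
      moreover have "1 \<le> s + 1 - \<rho> + j" using j(2) by simp
      ultimately show ?thesis using 1(1) by blast
    next
      case 2
      show ?thesis
      proof (cases "w = 0")
        case True
        then show ?thesis using w3 2(1) by simp
      next
        case False
        then have "w > 0" using \<eta>(2) 2(1) by simp
        have "R - w = real j" using jx ww unfolding 2(1) by linarith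
        then have "real j < R" "R < real j + 1" using 2(2) \<open>w > 0\<close> by linarith+
        then have "real j < real \<rho>" "real \<rho> < real (j + 1)" using R(1) by simp_all
        then have "j < \<rho>" "\<rho> < j + 1" by (simp_all only: of_nat_less_iff)
        then show ?thesis by simp
      qed
    next
      case 3
      have "R * \<eta> \<le> R * 1" using 3 R1 by (intro mult_left_mono) auto
      then show ?thesis using 3(2) jx j1 R(3) RS by linarith
    qed
  qed
qed

text \<open>The triangle with centre \<open>- (D / 2)\<close> and level \<open>r + D / 2\<close> has
  its tip at \<open>r\<close> and its base over \<open>- D - r\<close>. The shift lets the third
  family be indexed by the distance from the segment between \<open>- D\<close> and
  \<open>0\<close>.\<close>

lemma tri_axis:
  "tri (-1) 1 (- D) z = max (Re z + D) (- (Re z + D) + \<bar>Im z\<bar>)"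
  "tri 1 b 0 z = max (- Re z) (Re z + b * \<bar>Im z\<bar>)"
  "tri 1 a (- (D / 2)) z = max (- Re z - D) (Re z + a * \<bar>Im z\<bar>) + D / 2"
  by (auto simp: tri_def max_def field_simps)

text \<open>The three points are \<open>h (- D)\<close>, \<open>h 0\<close> and the point at infinity \<open>q\<close>. The triangles \<open>al\<close> and \<open>be\<close>
  are nested around \<open>- D\<close> and \<open>0\<close>, and the triangles \<open>ga\<close> surround both. With \<open>D = s + \<rho> + 1\<close> all
  triangles meet the segment from \<open>- D\<close> to \<open>0\<close> at integer
  distance from \<open>0\<close>, that is, in only \<open>s + \<rho>\<close> points.
  The slopes \<open>a\<close> and \<open>b\<close> serve the noose below: at height \<open>1\<close> the slanted sides of \<open>ga\<close> have integer
  abscissae, and the slanted sides of the noose run between two consecutive triangles \<open>ga\<close> and between two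
  consecutive triangles \<open>be\<close>.\<close>

context
  fixes s \<rho> T :: nat and D a b :: real and h :: "complex \<Rightarrow> real^3" and k q
    and al be ga :: "nat \<Rightarrow> complex set"
  assumes sT: "s \<le> T" and \<rho>T: "\<rho> \<le> T" and Ts: "T \<le> s + \<rho>" and \<rho>s: "\<rho> \<le> s + 1" and T1: "1 \<le> T"
    and hk: "homeomorphism (S2 - {q}) (UNIV :: complex set) k h" and qS: "q \<in> S2"
    and D: "D = real s + real \<rho> + 1" and a: "a = 2 * max 1 (real \<rho>)" and b: "b = a + 2"
  defines "al j \<equiv> {z. tri (-1) 1 (- D) z = real j}"
    and "be j \<equiv> {z. tri 1 b 0 z = real j}"
    and "ga j \<equiv> {z. tri 1 a (- (D / 2)) z = real j + D / 2}"
begin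

definition "fam = al ` {1..s} \<union> be ` {1..T} \<union> ga ` {1..T}"

lemma ab0: "a > 0" "b > 0" using a b by auto

lemma DT: "real T + 1 \<le> D" "real s + 1 \<le> D" using D Ts by auto

lemma mem_al: "z \<in> al j \<longleftrightarrow> max (Re z + D) (- (Re z + D) + \<bar>Im z\<bar>) = real j"
  and mem_be: "z \<in> be j \<longleftrightarrow> max (- Re z) (Re z + b * \<bar>Im z\<bar>) = real j"
  and mem_ga: "z \<in> ga j \<longleftrightarrow> max (- Re z - D) (Re z + a * \<bar>Im z\<bar>) = real j"
  unfolding al_def be_def ga_def by (auto simp: tri_axis)

lemma mem_fam: "z \<in> \<Union>fam \<longleftrightarrow> (\<exists>j. 1 \<le> j \<and> j \<le> s \<and> z \<in> al j) \<or> (\<exists>j. 1 \<le> j \<and> j \<le> T \<and> (z \<in> be j \<or> z \<in> ga j))"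
  unfolding fam_def by auto

lemma rpos: "1 \<le> j \<Longrightarrow> 0 < real j" "1 \<le> j \<Longrightarrow> 0 < real j + D / 2"
proof -
  have "D > 0" using D by linarith
  then show "1 \<le> j \<Longrightarrow> 0 < real j" "1 \<le> j \<Longrightarrow> 0 < real j + D / 2" by (auto intro: add_pos_pos)
qed

lemma curves:
  assumes "1 \<le> j"
  shows "simple_closed_curve (h ` al j)" "simple_closed_curve (h ` be j)" "simple_closed_curve (h ` ga j)"
  unfolding al_def be_def ga_def using ab0 rpos[OF assms] hk by (auto intro!: tri_curve)

lemma connected_fam:
  assumes "1 \<le> j"
  shows "connected (al j)" "connected (be j)" "connected (ga j)"
proof -
  have "connected {z. tri \<sigma> a c z = r}" if "\<sigma> = 1 \<or> \<sigma> = -1" "a > 0" "r > 0" for \<sigma> a c r :: real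
    using tri_path_image[OF that] tri_simple_path[OF that] connected_simple_path_image by metis
  then show "connected (al j)" "connected (be j)" "connected (ga j)"
    unfolding al_def be_def ga_def using ab0 rpos[OF assms] by auto
qed

lemma segments_fam: "\<exists>S. segments S \<and> \<Union>fam = \<Union>S"
proof (rule segments_Union)
  show "finite fam" unfolding fam_def by simp
  fix Y assume "Y \<in> fam"
  then obtain j where "1 \<le> j" "Y = al j \<or> Y = be j \<or> Y = ga j" unfolding fam_def by auto
  then show "\<exists>S. segments S \<and> Y = \<Union>S"
    using segments_tri[of "-1" 1 "real j" "- D"] segments_tri[of 1 b "real j" 0]
      segments_tri[of 1 a "real j + D / 2" "- (D / 2)"] ab0 rpos[of j]
    unfolding al_def be_def ga_def by auto
qed

lemma h_mem: "h z \<in> h ` A \<longleftrightarrow> z \<in> A"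
  using chartD(7)[OF hk] by (rule inj_image_mem_iff)

lemma hS: "h z \<in> S2" "q \<notin> h ` A" using chartD(1,2)[OF hk] by auto

lemma separations:
  assumes "1 \<le> j"
  shows "j \<le> s \<Longrightarrow> sep (h ` al j) (h (- D)) (h 0) \<and> sep (h ` al j) (h (- D)) q"
    and "j \<le> T \<Longrightarrow> sep (h ` be j) (h 0) (h (- D)) \<and> sep (h ` be j) (h 0) q"
    and "sep (h ` ga j) (h (- D)) q \<and> sep (h ` ga j) (h 0) q"
proof -
  note r = rpos[OF assms]
  show "sep (h ` al j) (h (- D)) (h 0) \<and> sep (h ` al j) (h (- D)) q" if "j \<le> s"
    unfolding al_def using that r DT ab0 hS qS
    by (intro conjI tri_sep[OF _ _ _ hk]) (auto simp: tri_axis h_mem)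
  show "sep (h ` be j) (h 0) (h (- D)) \<and> sep (h ` be j) (h 0) q" if "j \<le> T"
    unfolding be_def using that r DT ab0 hS qS
    by (intro conjI tri_sep[OF _ _ _ hk]) (auto simp: tri_axis h_mem)
  show "sep (h ` ga j) (h (- D)) q \<and> sep (h ` ga j) (h 0) q"
    unfolding ga_def using r DT ab0 hS qS
    by (intro conjI tri_sep[OF _ _ _ hk]) (auto simp: tri_axis h_mem)
qed

lemma levels_disjoint:
  assumes "i \<noteq> j"
  shows "h ` al i \<inter> h ` al j = {}" "h ` be i \<inter> h ` be j = {}" "h ` ga i \<inter> h ` ga j = {}"
  using assms inj_eq[OF chartD(7)[OF hk]] unfolding al_def be_def ga_def by auto

text \<open>The bases over \<open>- D + i\<close> and \<open>- j\<close> keep the triangles apart,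
  because \<open>i + j \<le> s + \<rho> < D\<close>.\<close>

lemma al_be_disjoint:
  assumes "i \<le> s" "j \<le> \<rho>"
  shows "h ` al i \<inter> h ` be j = {}"
proof -
  have "False" if "z \<in> al i" "z \<in> be j" for z
  proof -
    have "Re z + D \<le> real i" "- Re z \<le> real j" using that unfolding mem_al mem_be by linarith+
    then show False using assms D by linarith
  qed
  then show ?thesis using inj_eq[OF chartD(7)[OF hk]] by auto
qed

text \<open>By the intermediate value theorem \<open>be T\<close> crosses every \<open>ga j\<close>.
  The other triangles are attached to these on the axis: \<open>al j\<close> and \<open>ga j\<close>
  share the point \<open>- D - j\<close>, and \<open>be j\<close> and \<open>ga j\<close> share
  \<open>j\<close>.\<close>

lemma connected_drawing: "connected (\<Union>fam)"
proof -
  have be_ga: "be T \<inter> ga j \<noteq> {}" if "1 \<le> j" "j \<le> T" for j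
  proof -
    have con: "connected (tri 1 a (- (D / 2)) ` be T)"
      by (rule connected_continuous_image[OF continuous_on_subset[OF continuous_tri] connected_fam(2)[OF T1]]) simp
    have "of_real (real T) \<in> be T" "of_real (- real T) \<in> be T" unfolding mem_be by auto
    then have 1: "tri 1 a (- (D / 2)) (of_real (real T)) \<in> tri 1 a (- (D / 2)) ` be T"
      "tri 1 a (- (D / 2)) (of_real (- real T)) \<in> tri 1 a (- (D / 2)) ` be T" by blast+
    have "tri 1 a (- (D / 2)) (of_real (- real T)) \<le> real j + D / 2"
      "real j + D / 2 \<le> tri 1 a (- (D / 2)) (of_real (real T))"
      unfolding tri_axis using that DT T1 by auto
    then have "real j + D / 2 \<in> tri 1 a (- (D / 2)) ` be T"
      using connectedD_interval[OF con 1(2,1)] by simp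
    then show ?thesis unfolding ga_def by auto
  qed
  have c1: "connected (be T \<union> \<Union>(ga ` {1..T}))"
    by (rule connected_Un_UN) (use be_ga connected_fam T1 in auto)
  have c2: "connected ((be T \<union> \<Union>(ga ` {1..T})) \<union> \<Union>(al ` {1..s} \<union> be ` {1..T}))"
  proof (rule connected_Un_UN[OF c1])
    show "connected X" if "X \<in> al ` {1..s} \<union> be ` {1..T}" for X using that connected_fam by auto
    fix X assume "X \<in> al ` {1..s} \<union> be ` {1..T}"
    then consider j where "1 \<le> j" "j \<le> s" "X = al j" | j where "1 \<le> j" "j \<le> T" "X = be j" by auto
    then show "(be T \<union> \<Union>(ga ` {1..T})) \<inter> X \<noteq> {}"
    proof cases
      case 1
      have "of_real (- D - real j) \<in> al j" unfolding mem_al by auto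
      moreover have "of_real (- D - real j) \<in> ga j" unfolding mem_ga using DT 1 by auto
      ultimately show ?thesis using 1 sT by force
    next
      case 2
      have "of_real (real j) \<in> be j" unfolding mem_be by auto
      moreover have "of_real (real j) \<in> ga j" unfolding mem_ga using DT 2 by auto
      ultimately show ?thesis using 2 by force
    qed
  qed
  have "be T \<in> fam" unfolding fam_def using T1 by auto
  then have "(be T \<union> \<Union>(ga ` {1..T})) \<union> \<Union>(al ` {1..s} \<union> be ` {1..T}) = \<Union>fam"
    unfolding fam_def by auto
  then show ?thesis using c2 by simp
qed

definition "drawing = h ` \<Union>fam"

lemma drawing_drawable: "drawable drawing" "connected drawing" "drawing \<noteq> {}"
proof -
  obtain S where "segments S" "\<Union>fam = \<Union>S" using segments_fam by metis
  then show "drawable drawing" unfolding drawing_def using drawable_segments[OF hk] by simp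
  show "connected drawing" unfolding drawing_def
    by (rule connected_continuous_image[OF continuous_on_subset[OF chartD(5)[OF hk]] connected_drawing]) simp
  have "of_real (real T) \<in> be T" unfolding mem_be by auto
  then have "of_real (real T) \<in> \<Union>fam" using T1 unfolding mem_fam by auto
  then show "drawing \<noteq> {}" unfolding drawing_def by auto
qed

section \<open>Upper bounds from the real axis\<close>

lemma axis_meets_drawing:
  assumes "Im z = 0" "z \<in> \<Union>fam"
  shows "Re z \<ge> 0 \<Longrightarrow> \<exists>j\<in>{1..T}. z = of_real (real j)"
    and "- D \<le> Re z \<Longrightarrow> Re z \<le> 0 \<Longrightarrow> \<exists>j\<in>{1..s + \<rho>}. z = of_real (- D + real j)"
    and "Re z \<le> - D \<Longrightarrow> \<exists>j\<in>{1..T}. z = of_real (- D - real j)"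
proof -
  have z: "z = of_real (Re z)" using assms(1) by (simp add: complex_eq_iff)
  consider j where "1 \<le> j" "j \<le> s" "max (Re z + D) (- (Re z + D)) = real j"
    | j where "1 \<le> j" "j \<le> T" "max (- Re z) (Re z) = real j"
    | j where "1 \<le> j" "j \<le> T" "max (- Re z - D) (Re z) = real j"
    using assms(2) unfolding mem_fam mem_al mem_be mem_ga assms(1) by auto
  note cases = this
  show "\<exists>j\<in>{1..T}. z = of_real (real j)" if x: "Re z \<ge> 0"
    using cases
  proof cases
    case 1
    then have "Re z + D = real j" "real j \<le> real s" using x D by auto
    then show ?thesis using x DT by linarith
  next
    case 2
    then have "Re z = real j" using x by simp
    then show ?thesis using 2 z by (intro bexI[of _ j]) auto
  next
    case 3
    then have "Re z = real j" using x D by simp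
    then show ?thesis using 3 z by (intro bexI[of _ j]) auto
  qed
  show "\<exists>j\<in>{1..s + \<rho>}. z = of_real (- D + real j)" if x: "- D \<le> Re z" "Re z \<le> 0"
    using cases
  proof cases
    case 1
    then have "Re z = - D + real j" using x by auto
    then show ?thesis using 1 z by (intro bexI[of _ j]) auto
  next
    case 2
    then have "Re z = - real j" using x by auto
    \<comment> \<open>The base of \<open>be j\<close> at \<open>- j\<close> is one of the points
      \<open>- D + 1, \<dots>, - D + s + \<rho>\<close>; here
      \<open>j \<le> T \<le> s + \<rho>\<close> is used.\<close>
    moreover have "real (s + \<rho> + 1 - j) = D - real j" using 2 Ts D by (simp add: of_nat_diff)
    ultimately have "Re z = - D + real (s + \<rho> + 1 - j)" by simp
    then show ?thesis using 2 Ts z by (intro bexI[of _ "s + \<rho> + 1 - j"]) auto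
  next
    case 3
    then have "real j \<le> 0" using x by linarith
    then show ?thesis using 3 by simp
  qed
  show "\<exists>j\<in>{1..T}. z = of_real (- D - real j)" if x: "Re z \<le> - D"
    using cases
  proof cases
    case 1
    then have "Re z = - D - real j" using x by auto
    then show ?thesis using 1 z sT by (intro bexI[of _ j]) auto
  next
    case 2
    then have "- Re z \<le> real T" by linarith
    then show ?thesis using x DT by linarith
  next
    case 3
    then have "Re z = - D - real j" using x D by auto
    then show ?thesis using 3 z by (intro bexI[of _ j]) auto
  qed
qed

lemma connected_axis:
  assumes "connected A"
  shows "connected (h ` of_real ` A)"
  using assms chartD(5)[OF hk]
  by (intro connected_continuous_image) (auto intro: continuous_on_subset continuous_intros)

lemma connected_ray:
  assumes "connected A" "\<not> bounded A"
  shows "connected (insert q (h ` of_real ` A))"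
proof (rule connected_intermediate_closure[OF connected_axis[OF assms(1)]])
  have "\<not> bounded (complex_of_real ` A)"
  proof
    assume "bounded (complex_of_real ` A)"
    then have "bounded (Re ` complex_of_real ` A)" by (rule bounded_linear_image[OF _ bounded_linear_Re])
    then show False using assms(2) by (simp add: image_image)
  qed
  then have "q \<in> closure (h ` complex_of_real ` A)" by (rule chart_unbounded_closure[OF hk])
  then show "insert q (h ` complex_of_real ` A) \<subseteq> closure (h ` complex_of_real ` A)"
    using closure_subset[of "h ` complex_of_real ` A"] by blast
qed blast

lemma unbounded_rays: "\<not> bounded {c::real..}" "\<not> bounded {..c::real}"
proof -
  show "\<not> bounded {c..}"
  proof
    assume "bounded {c..}"
    then obtain B where B: "\<forall>x\<in>{c..}. \<bar>x\<bar> \<le> B" unfolding bounded_iff by auto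
    have "c \<le> \<bar>c\<bar> + \<bar>B\<bar> + 1" by linarith
    then have "\<bar>\<bar>c\<bar> + \<bar>B\<bar> + 1\<bar> \<le> B" using B by (metis atLeast_iff)
    then show False by linarith
  qed
  show "\<not> bounded {..c}"
  proof
    assume "bounded {..c}"
    then obtain B where B: "\<forall>x\<in>{..c}. \<bar>x\<bar> \<le> B" unfolding bounded_iff by auto
    have "- \<bar>c\<bar> - \<bar>B\<bar> - 1 \<le> c" by linarith
    then have "\<bar>- \<bar>c\<bar> - \<bar>B\<bar> - 1\<bar> \<le> B" using B by (metis atMost_iff)
    then show False by linarith
  qed
qed

lemma card_axis_points: "card (h ` (\<lambda>j. complex_of_real (f j)) ` {1..n}) \<le> n"
  by (metis card_atLeastAtMost card_image_le diff_Suc_1 finite_atLeastAtMost finite_imageI le_trans)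

lemma axis_bounds:
  shows "packing drawing (\<lambda>C. sep C (h 0) q) L \<Longrightarrow> card L \<le> T"
    and "packing drawing (\<lambda>C. sep C (h (- D)) q) L \<Longrightarrow> card L \<le> T"
    and "packing drawing (\<lambda>C. sep C (h (- D)) (h 0)) L \<Longrightarrow> card L \<le> s + \<rho>"
proof -
  have qK: "q \<notin> drawing" unfolding drawing_def by (rule hS(2))
  have sub: "h ` X \<subseteq> S2" for X using hS(1) by blast
  have ax: "z \<in> of_real ` A \<Longrightarrow> Im z = 0 \<and> Re z \<in> A" for z A by auto
  have K: "h ` Y \<inter> drawing \<subseteq> h ` (Y \<inter> \<Union>fam)" for Y
    unfolding drawing_def using image_Int[OF chartD(7)[OF hk], of Y "\<Union>fam"] by simp
  have 1: "complex_of_real ` {0..} \<inter> \<Union>fam \<subseteq> (\<lambda>j. complex_of_real (real j)) ` {1..T}"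
    using axis_meets_drawing(1) ax[of _ "{0..}"] by fastforce
  have 2: "complex_of_real ` {..- D} \<inter> \<Union>fam \<subseteq> (\<lambda>j. complex_of_real (- D - real j)) ` {1..T}"
    using axis_meets_drawing(3) ax[of _ "{..- D}"] by fastforce
  have 3: "complex_of_real ` {- D..0} \<inter> \<Union>fam \<subseteq> (\<lambda>j. complex_of_real (- D + real j)) ` {1..s + \<rho>}"
    using axis_meets_drawing(2) ax[of _ "{- D..0}"] by fastforce
  have D0: "D \<ge> 0" using D by linarith
  have p1: "h (- complex_of_real D) \<in> h ` complex_of_real ` {..- D}" "h (- complex_of_real D) \<in> h ` complex_of_real ` {- D..0}"
    using D0 by (metis atMost_iff imageI of_real_minus order_refl, metis atLeastAtMost_iff imageI neg_le_0_iff_le of_real_minus order_refl)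
  have p2: "h 0 \<in> h ` complex_of_real ` {0..}" "h 0 \<in> h ` complex_of_real ` {- D..0}"
    using D0 by (metis atLeast_iff imageI of_real_0 order_refl, metis atLeastAtMost_iff imageI neg_le_0_iff_le of_real_0 order_refl)
  show "card L \<le> T" if "packing drawing (\<lambda>C. sep C (h 0) q) L"
  proof -
    have "card L \<le> card (h ` (\<lambda>j. complex_of_real (real j)) ` {1..T})"
    proof (rule packing_le_connected[OF that connected_ray[of "{0..}"]])
      show "insert q (h ` complex_of_real ` {0..}) \<inter> drawing \<subseteq> h ` (\<lambda>j. complex_of_real (real j)) ` {1..T}"
        using K[of "complex_of_real ` {0..}"] image_mono[OF 1, of h] qK by blast
    qed (use p2 unbounded_rays sub qS in auto)
    then show ?thesis by (rule le_trans[OF _ card_axis_points])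
  qed
  show "card L \<le> T" if "packing drawing (\<lambda>C. sep C (h (- D)) q) L"
  proof -
    have "card L \<le> card (h ` (\<lambda>j. complex_of_real (- D - real j)) ` {1..T})"
    proof (rule packing_le_connected[OF that connected_ray[of "{..- D}"]])
      show "insert q (h ` complex_of_real ` {..- D}) \<inter> drawing \<subseteq> h ` (\<lambda>j. complex_of_real (- D - real j)) ` {1..T}"
        using K[of "complex_of_real ` {..- D}"] image_mono[OF 2, of h] qK by blast
    qed (use p1 unbounded_rays sub qS in auto)
    then show ?thesis by (rule le_trans[OF _ card_axis_points])
  qed
  show "card L \<le> s + \<rho>" if "packing drawing (\<lambda>C. sep C (h (- D)) (h 0)) L"
  proof -
    have "card L \<le> card (h ` (\<lambda>j. complex_of_real (- D + real j)) ` {1..s + \<rho>})"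
    proof (rule packing_le_connected[OF that connected_axis[of "{- D..0}"]])
      show "h ` complex_of_real ` {- D..0} \<inter> drawing \<subseteq> h ` (\<lambda>j. complex_of_real (- D + real j)) ` {1..s + \<rho>}"
        using K[of "complex_of_real ` {- D..0}"] image_mono[OF 3, of h] by blast
    qed (use p1 p2 sub in auto)
    then show ?thesis by (rule le_trans[OF _ card_axis_points])
  qed
qed

text \<open>The noose is the closed curve \<open>\<bar>Im z\<bar> = noose_height (Re z)\<close> through \<open>- D\<close>. On the real
  axis the part to the left of \<open>- D\<close> lies outside and the segment from \<open>- D\<close> to \<open>0\<close> inside. It meets the drawing in only \<open>2 s + 1\<close> points, while each curve that encircles
  \<open>- D\<close> uses at least two of them.\<close>

definition noose_height :: "real \<Rightarrow> real" where
  "noose_height x = min (min (2 * x + 2 * D) 1) ((real \<rho> - x) / (2 * real \<rho> + 1))"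

text \<open>The points over \<open>- D + j\<close> are those on the horizontal sides. For
  \<open>\<rho> \<ge> 1\<close> the remaining one is the right end of the noose, where
  \<open>be \<rho>\<close> and \<open>ga \<rho>\<close> have their common tip.\<close>

definition "noose_points = (\<lambda>j. Complex (- D + real j) 1) ` {1..s} \<union> (\<lambda>j. Complex (- D + real j) (-1)) ` {1..s} \<union> {of_real (real \<rho>)}"

lemma noose_points: "finite noose_points" "card (h ` noose_points) \<le> 2 * s + 1"
proof -
  show fin: "finite noose_points" unfolding noose_points_def by auto
  have "card noose_points \<le> card ((\<lambda>j. Complex (- D + real j) 1) ` {1..s}) + card ((\<lambda>j. Complex (- D + real j) (-1)) ` {1..s})
      + card {complex_of_real (real \<rho>)}"
    unfolding noose_points_def by (meson card_Un_le le_trans add_le_mono order_refl)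
  also have "\<dots> \<le> s + s + 1"
    by (intro add_le_mono) (auto intro: le_trans[OF card_image_le])
  finally have "card noose_points \<le> 2 * s + 1" by simp
  then show "card (h ` noose_points) \<le> 2 * s + 1" using card_image_le[OF fin, of h] by linarith
qed

lemma noose_meets_drawing:
  assumes "\<rho> \<ge> 1" "\<bar>Im z\<bar> = noose_height (Re z)" "z \<in> \<Union>fam"
  shows "z \<in> noose_points"
proof -
  \<comment> \<open>The maximum in \<open>a\<close> keeps the slope positive when
    \<open>\<rho> = 0\<close>; for \<open>\<rho> \<ge> 1\<close> it is \<open>\<rho>\<close>, which
    is what the arithmetic of the slanted sides is made for.\<close>
  have ab: "a = 2 * real \<rho>" "b = 2 * real \<rho> + 2" using a b assms(1) by auto
  note na = noose_arith[OF refl refl D assms(1) \<rho>s Ts refl assms(2)[unfolded noose_height_def] abs_ge_zero]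
  have "Re z = real \<rho> \<and> \<bar>Im z\<bar> = 0 \<or> (\<exists>k. 1 \<le> k \<and> k \<le> s \<and> Re z = - D + real k \<and> \<bar>Im z\<bar> = 1)"
  proof -
    have "(\<exists>j. 1 \<le> j \<and> j \<le> s \<and> max (Re z + D) (- (Re z + D) + \<bar>Im z\<bar>) = real j) \<or>
      (\<exists>j. 1 \<le> j \<and> j \<le> T \<and> (max (- Re z) (Re z + b * \<bar>Im z\<bar>) = real j \<or>
        max (- Re z - D) (Re z + a * \<bar>Im z\<bar>) = real j))"
      using assms(3) unfolding mem_fam mem_al mem_be mem_ga .
    then show ?thesis unfolding ab using na by blast
  qed
  then show ?thesis
  proof
    assume "Re z = real \<rho> \<and> \<bar>Im z\<bar> = 0"
    then have "z = of_real (real \<rho>)" by (simp add: complex_eq_iff)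
    then show ?thesis unfolding noose_points_def by blast
  next
    assume "\<exists>k. 1 \<le> k \<and> k \<le> s \<and> Re z = - D + real k \<and> \<bar>Im z\<bar> = 1"
    then obtain j where j': "1 \<le> j" "j \<le> s" "Re z = - D + real j" "\<bar>Im z\<bar> = 1" by blast
    then have j: "j \<in> {1..s}" "Re z = - D + real j" "Im z = 1 \<or> Im z = -1" by (simp, simp, linarith)
    then have "z = Complex (- D + real j) 1 \<or> z = Complex (- D + real j) (-1)" by (auto simp: complex_eq_iff)
    then show ?thesis using j(1) unfolding noose_points_def by blast
  qed
qed

lemma continuous_noose_height: "continuous_on UNIV (\<lambda>z. noose_height (Re z))"
proof -
  have "2 * real \<rho> + 1 \<noteq> 0" using of_nat_0_le_iff[of \<rho>, where 'a = real] by linarith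
  then show ?thesis unfolding noose_height_def by (intro continuous_intros) auto
qed

lemma connected_openin_cases:
  assumes "connected Y" "openin (top_of_set S2) U" "openin (top_of_set S2) V" "U \<inter> V = {}" "Y \<subseteq> U \<union> V"
  shows "Y \<subseteq> U \<or> Y \<subseteq> V"
proof -
  obtain U' V' where o: "open U'" "U = S2 \<inter> U'" "open V'" "V = S2 \<inter> V'"
    using assms(2,3) unfolding openin_open by blast
  have "U' \<inter> V' \<inter> Y = {}" "Y \<subseteq> U' \<union> V'" using o assms(4,5) by auto
  then have "U' \<inter> Y = {} \<or> V' \<inter> Y = {}" using connectedD[OF assms(1) o(1,3)] by blast
  then show ?thesis using o assms(5) by blast
qed

text \<open>If \<open>C\<close> meets the noose in at most one point \<open>v\<close>, the connected
  set \<open>C - {v}\<close> lies inside or outside. If inside, it leaves the ray from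
  \<open>- D\<close> to infinity free; if outside, it leaves the segment from \<open>- D\<close> to
  \<open>0\<close> free. Either way \<open>C\<close> fails to separate two points that it
  should.\<close>

lemma curve_meets_noose_twice:
  assumes \<rho>: "\<rho> \<ge> 1" and C: "simple_closed_curve C" "C \<subseteq> drawing"
    and sp: "sep C (h (- D)) (h 0)" "sep C (h (- D)) q"
  shows "2 \<le> card (C \<inter> h ` noose_points)"
proof (rule ccontr)
  assume "\<not> 2 \<le> card (C \<inter> h ` noose_points)"
  then have c1: "card (C \<inter> h ` noose_points) \<le> 1" by simp
  define N A AN where "N = {z. \<bar>Im z\<bar> = noose_height (Re z)}" and "A = {z. \<bar>Im z\<bar> < noose_height (Re z)}"
    and "AN = {z. \<bar>Im z\<bar> \<le> noose_height (Re z)}"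
  have AN: "AN = A \<union> N" "A \<inter> N = {}" unfolding N_def A_def AN_def by auto
  have D0: "D \<ge> 1" using D by linarith
  have im: "\<exists>t\<in>A. x = h (complex_of_real t)" if "x \<in> h ` complex_of_real ` A" for x A using that by auto
  let ?R = "real \<rho>"
  have R1: "?R \<ge> 1" using \<rho> by simp
  have hhD: "noose_height (- D) = 0"
  proof -
    have "0 \<le> (?R - - D) / (2 * ?R + 1)" using R1 D0 by (intro divide_nonneg_nonneg) auto
    then show ?thesis unfolding noose_height_def by simp
  qed
  have hhneg: "noose_height t < 0" if "t < - D" for t
    using that unfolding noose_height_def by (simp add: min_less_iff_disj)
  have hhpos: "0 < noose_height t" if "- D < t" "t \<le> 0" for t
  proof -
    have "0 < (?R - t) / (2 * ?R + 1)" using R1 that by (intro divide_pos_pos) auto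
    then show ?thesis unfolding noose_height_def using that by simp
  qed
  have p1N: "- complex_of_real D \<in> N" unfolding N_def using hhD by simp
  have CN: "C \<inter> h ` N \<subseteq> C \<inter> h ` noose_points"
  proof
    fix x assume x: "x \<in> C \<inter> h ` N"
    then obtain z where z: "z \<in> N" "x = h z" by blast
    moreover have "z \<in> \<Union>fam" using x z(2) C(2) h_mem unfolding drawing_def by blast
    ultimately have "z \<in> noose_points" using noose_meets_drawing[OF \<rho>] unfolding N_def by blast
    then show "x \<in> C \<inter> h ` noose_points" using x z(2) by blast
  qed
  have fin: "finite (C \<inter> h ` noose_points)" using noose_points(1) by blast
  \<comment> \<open>\<open>v\<close> is taken on the noose even if \<open>C\<close> misses it, where
    \<open>- D\<close> is a dummy. Hence \<open>v\<close> is never one of the other axis points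
    considered below.\<close>
  have "\<exists>v\<in>h ` N. C \<inter> h ` N \<subseteq> {v}"
  proof (cases "C \<inter> h ` N = {}")
    case True
    then show ?thesis using p1N by blast
  next
    case False
    then obtain v where v: "v \<in> C \<inter> h ` N" by blast
    have "w = v" if "w \<in> C \<inter> h ` N" for w
    proof (rule card_le_Suc0_iff_eq[OF fin, THEN iffD1, rule_format])
      show "card (C \<inter> h ` noose_points) \<le> Suc 0" using c1 by simp
      show "w \<in> C \<inter> h ` noose_points" "v \<in> C \<inter> h ` noose_points" using that v CN by auto
    qed
    then show ?thesis using v by blast
  qed
  then obtain v where v: "v \<in> h ` N" "C \<inter> h ` N \<subseteq> {v}" by blast
  have oA: "openin (top_of_set S2) (h ` A)"
  proof (rule chart_open_image[OF hk])
    show "open A" unfolding A_def by (rule open_Collect_less[OF _ continuous_noose_height]) (intro continuous_intros)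
  qed
  have "closed AN" unfolding AN_def by (rule closed_Collect_le[OF _ continuous_noose_height]) (intro continuous_intros)
  moreover have "AN \<subseteq> cbox (Complex (- D) (-1)) (Complex ?R 1)"
  proof
    fix z assume "z \<in> AN"
    then have "\<bar>Im z\<bar> \<le> 2 * Re z + 2 * D" "\<bar>Im z\<bar> \<le> 1" "\<bar>Im z\<bar> \<le> (?R - Re z) / (2 * ?R + 1)"
      unfolding AN_def noose_height_def by auto
    moreover have "0 \<le> \<bar>Im z\<bar>" by simp
    ultimately have "0 \<le> 2 * Re z + 2 * D" "0 \<le> (?R - Re z) / (2 * ?R + 1)" "\<bar>Im z\<bar> \<le> 1" by linarith+
    moreover have "Re z \<le> ?R" using calculation(2) R1 by (simp add: zero_le_divide_iff)
    ultimately show "z \<in> cbox (Complex (- D) (-1)) (Complex ?R 1)"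
      by (auto simp: in_cbox_complex_iff)
  qed
  ultimately have "compact AN" by (meson bounded_cbox bounded_subset compact_eq_bounded_closed)
  then have "closed (h ` AN)"
    using chartD(5)[OF hk] by (meson compact_continuous_image compact_imp_closed continuous_on_subset subset_UNIV)
  then have oB: "openin (top_of_set S2) (S2 - h ` AN)" by (rule openin_S2_Diff)
  have "C - {v} \<subseteq> h ` A \<or> C - {v} \<subseteq> S2 - h ` AN"
  proof (rule connected_openin_cases[OF connected_simple_closed_curve_delete[OF C(1)] oA oB])
    show "h ` A \<inter> (S2 - h ` AN) = {}" using AN by blast
    show "C - {v} \<subseteq> h ` A \<union> (S2 - h ` AN)"
    proof
      fix x assume x: "x \<in> C - {v}"
      then have "x \<in> S2" "x \<notin> h ` N" using simple_closed_curveD(1)[OF C(1)] v(2) by auto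
      then show "x \<in> h ` A \<union> (S2 - h ` AN)" unfolding AN(1) image_Un by blast
    qed
  qed
  then show False
  proof
    assume inA: "C - {v} \<subseteq> h ` A"
    have "x \<notin> C" if "x \<in> insert q (h ` complex_of_real ` {..- D})" for x
    proof (cases "x = q \<or> x = h (- D)")
      case True
      then show ?thesis using sepD[OF sp(2)] by auto
    next
      case False
      then have "x \<in> h ` complex_of_real ` {..- D}" using that by blast
      then obtain t where t: "t \<le> - D" "x = h (of_real t)" using im[of x "{..- D}"] by auto
      have "t \<noteq> - D" using False t by auto
      then have "noose_height t < 0" using t hhneg by simp
      then have "complex_of_real t \<notin> A" "complex_of_real t \<notin> N" unfolding A_def N_def by auto
      then have "x \<notin> h ` A" "x \<noteq> v" using t(2) v(1) h_mem by auto
      then show ?thesis using inA by blast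
    qed
    moreover have "connected (insert q (h ` complex_of_real ` {..- D}))"
      by (rule connected_ray) (auto simp: unbounded_rays)
    moreover have "h (- D) \<in> insert q (h ` complex_of_real ` {..- D})"
      by (metis atMost_iff imageI insertI2 of_real_minus order_refl)
    ultimately show False
      using not_sep_connected[of "insert q (h ` complex_of_real ` {..- D})" "h (- D)" q C] sp(2) hS qS by blast
  next
    assume inB: "C - {v} \<subseteq> S2 - h ` AN"
    have "x \<notin> C" if xin: "x \<in> h ` complex_of_real ` {- D..0}" for x
    proof (cases "x = h (- D)")
      case True
      then show ?thesis using sepD[OF sp(2)] by auto
    next
      case False
      obtain t where t: "- D \<le> t" "t \<le> 0" "x = h (of_real t)" using im[OF xin] by auto
      have "t \<noteq> - D" using False t by auto
      then have "0 < noose_height t" using t hhpos by simp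
      then have "complex_of_real t \<in> A" "complex_of_real t \<notin> N" unfolding A_def N_def by auto
      then have "x \<in> h ` AN" "x \<noteq> v" using t(3) v(1) h_mem AN by auto
      then show ?thesis using inB by blast
    qed
    moreover have "connected (h ` complex_of_real ` {- D..0})" by (rule connected_axis) auto
    moreover have "h (- D) \<in> h ` complex_of_real ` {- D..0}" "h 0 \<in> h ` complex_of_real ` {- D..0}"
      using D0 by (auto simp: h_mem image_iff intro: bexI[of _ "- D"] bexI[of _ 0])
    ultimately show False
      using not_sep_connected[of "h ` complex_of_real ` {- D..0}" "h (- D)" "h 0" C] sp(1) hS by blast
  qed
qed

text \<open>Disjoint curves use disjoint pairs of the at most \<open>2 * s + 1\<close> points, and
  the odd point remains without a partner.\<close>

lemma noose_bound:
  assumes \<rho>: "\<rho> \<ge> 1" and L: "packing drawing (\<lambda>C. sep C (h (- D)) (h 0) \<and> sep C (h (- D)) q) L"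
  shows "card L \<le> s"
proof -
  have fin: "finite (h ` noose_points)" "finite L" using noose_points(1) L unfolding packing_def by auto
  have two: "2 \<le> card (C \<inter> h ` noose_points)" if "C \<in> L" for C
    using that L unfolding packing_def by (intro curve_meets_noose_twice[OF \<rho>]) auto
  have "card L * 2 = (\<Sum>C\<in>L. 2)" by simp
  also have "\<dots> \<le> (\<Sum>C\<in>L. card (C \<inter> h ` noose_points))" by (rule sum_mono) (rule two)
  also have "\<dots> = card (\<Union>C\<in>L. C \<inter> h ` noose_points)"
  proof (rule card_UN_disjoint[symmetric])
    show "\<forall>C\<in>L. \<forall>D\<in>L. C \<noteq> D \<longrightarrow> C \<inter> h ` noose_points \<inter> (D \<inter> h ` noose_points) = {}"
      using L unfolding packing_def pairwise_def disjnt_def by blast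
  qed (use fin in auto)
  also have "\<dots> \<le> card (h ` noose_points)" using fin by (intro card_mono) auto
  also have "\<dots> \<le> 2 * s + 1" by (rule noose_points(2))
  finally show ?thesis by simp
qed

lemma drawing_avoids_points: "h (- D) \<notin> drawing" "h 0 \<notin> drawing" "q \<notin> drawing"
proof -
  show "q \<notin> drawing" unfolding drawing_def by (rule hS(2))
  have "- complex_of_real D \<notin> \<Union>fam" "0 \<notin> \<Union>fam"
    using DT unfolding mem_fam mem_al mem_be mem_ga by auto
  then show "h (- D) \<notin> drawing" "h 0 \<notin> drawing" unfolding drawing_def h_mem by auto
qed

lemma fam_subset: "1 \<le> j \<Longrightarrow> j \<le> s \<Longrightarrow> h ` al j \<subseteq> drawing" "1 \<le> j \<Longrightarrow> j \<le> T \<Longrightarrow> h ` be j \<subseteq> drawing"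
  "1 \<le> j \<Longrightarrow> j \<le> T \<Longrightarrow> h ` ga j \<subseteq> drawing"
  unfolding drawing_def fam_def by (intro image_mono Union_upper; simp)+

lemma family_packing:
  assumes "\<And>j. j < n \<Longrightarrow> simple_closed_curve (c j) \<and> c j \<subseteq> drawing \<and> Q (c j)"
    and "\<And>i j. i < j \<Longrightarrow> j < n \<Longrightarrow> c i \<inter> c j = {}"
    and "\<And>L. packing drawing Q L \<Longrightarrow> card L \<le> n"
  shows "max_packing drawing Q n"
  unfolding max_packing_def using packing_family[of n c drawing Q] assms by blast

lemma packing_weaken: "packing K Q L \<Longrightarrow> (\<And>C. Q C \<Longrightarrow> Q' C) \<Longrightarrow> packing K Q' L"
  unfolding packing_def by blast

lemma base_packings:
  shows "max_packing drawing (\<lambda>C. sep C (h (- D)) (h 0) \<and> sep C (h (- D)) q) s"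
    and "max_packing drawing (\<lambda>C. sep C (h 0) (h (- D)) \<and> sep C (h 0) q) T"
    and "max_packing drawing (\<lambda>C. sep C q (h (- D)) \<and> sep C q (h 0)) T"
    and "max_packing drawing (\<lambda>C. sep C (h 0) q) T"
    and "max_packing drawing (\<lambda>C. sep C (h (- D)) q) T"
    and "max_packing drawing (\<lambda>C. sep C (h (- D)) (h 0)) (s + \<rho>)"
proof -
  show "max_packing drawing (\<lambda>C. sep C (h (- D)) (h 0) \<and> sep C (h (- D)) q) s"
  proof (rule family_packing[of s "\<lambda>j. h ` al (Suc j)"])
    fix L assume L: "packing drawing (\<lambda>C. sep C (h (- D)) (h 0) \<and> sep C (h (- D)) q) L"
    show "card L \<le> s"
    proof (cases "\<rho> \<ge> 1")
      case True
      then show ?thesis using noose_bound L by blast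
    next
      case False
      \<comment> \<open>For \<open>\<rho> = 0\<close> the inequalities force \<open>s = T\<close>,
        and the bound from the axis replaces that from the noose.\<close>
      then have "s = T" using Ts sT by simp
      then show ?thesis using axis_bounds(2)[OF packing_weaken[OF L]] by simp
    qed
  qed (use curves separations fam_subset levels_disjoint in auto)
  show "max_packing drawing (\<lambda>C. sep C (h 0) (h (- D)) \<and> sep C (h 0) q) T"
  proof (rule family_packing[of T "\<lambda>j. h ` be (Suc j)"])
    show "card L \<le> T" if "packing drawing (\<lambda>C. sep C (h 0) (h (- D)) \<and> sep C (h 0) q) L" for L
      by (rule axis_bounds(1)[OF packing_weaken[OF that]]) simp
  qed (use curves separations fam_subset levels_disjoint in auto)
  show "max_packing drawing (\<lambda>C. sep C q (h (- D)) \<and> sep C q (h 0)) T"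
  proof (rule family_packing[of T "\<lambda>j. h ` ga (Suc j)"])
    show "card L \<le> T" if "packing drawing (\<lambda>C. sep C q (h (- D)) \<and> sep C q (h 0)) L" for L
      by (rule axis_bounds(1)[OF packing_weaken[OF that]]) (simp add: sep_commute)
    show "simple_closed_curve (h ` ga (Suc j)) \<and> h ` ga (Suc j) \<subseteq> drawing \<and>
        sep (h ` ga (Suc j)) q (h (- D)) \<and> sep (h ` ga (Suc j)) q (h 0)" if "j < T" for j
      using that curves(3)[of "Suc j"] separations(3)[of "Suc j"] fam_subset(3)[of "Suc j"]
        sep_commute[of "h ` ga (Suc j)"] by auto
  qed (use levels_disjoint in auto)
  show "max_packing drawing (\<lambda>C. sep C (h 0) q) T"
    by (rule family_packing[of T "\<lambda>j. h ` ga (Suc j)"])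
      (use curves separations fam_subset levels_disjoint axis_bounds in auto)
  show "max_packing drawing (\<lambda>C. sep C (h (- D)) q) T"
    by (rule family_packing[of T "\<lambda>j. h ` ga (Suc j)"])
      (use curves separations fam_subset levels_disjoint axis_bounds in auto)
  show "max_packing drawing (\<lambda>C. sep C (h (- D)) (h 0)) (s + \<rho>)"
  \<comment> \<open>All \<open>s\<close> triangles \<open>al\<close> are used, but only the first
    \<open>\<rho>\<close> triangles \<open>be\<close>, the range covered by
    \<open>al_be_disjoint\<close>.\<close>
  proof (rule family_packing[of "s + \<rho>" "\<lambda>j. if j < s then h ` al (Suc j) else h ` be (Suc (j - s))"])
    fix j assume "j < s + \<rho>"
    then show "simple_closed_curve (if j < s then h ` al (Suc j) else h ` be (Suc (j - s))) \<and>
        (if j < s then h ` al (Suc j) else h ` be (Suc (j - s))) \<subseteq> drawing \<and>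
        sep (if j < s then h ` al (Suc j) else h ` be (Suc (j - s))) (h (- D)) (h 0)"
      using curves(1,2)[of "Suc j"] curves(2)[of "Suc (j - s)"] separations(1)[of "Suc j"]
        separations(2)[of "Suc (j - s)"] fam_subset(1)[of "Suc j"] fam_subset(2)[of "Suc (j - s)"] \<rho>T
        sep_commute[of "h ` be (Suc (j - s))"] by auto
  next
    fix i j assume "i < j" "j < s + \<rho>"
    then show "(if i < s then h ` al (Suc i) else h ` be (Suc (i - s))) \<inter>
        (if j < s then h ` al (Suc j) else h ` be (Suc (j - s))) = {}"
      using levels_disjoint(1)[of "Suc i" "Suc j"] levels_disjoint(2)[of "Suc (i - s)" "Suc (j - s)"]
        al_be_disjoint[of "Suc i" "Suc (j - s)"] by auto
  qed (use axis_bounds in auto)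
qed

end

section \<open>Placing the drawing at the given three points\<close>

lemma sphere_chart_through:
  assumes "q \<in> S2" "x \<in> S2" "y \<in> S2" "x \<noteq> y" "x \<noteq> q" "y \<noteq> q" "D > 0"
  obtains h :: "complex \<Rightarrow> real^3" and k where "homeomorphism (S2 - {q}) UNIV k h" "h (of_real (- D)) = x" "h 0 = y"
proof -
  obtain h0 k0 where hk: "homeomorphism (S2 - {q}) (UNIV :: complex set) k0 h0"
    using sphere_chart[OF assms(1)] by blast
  note ch = chartD[OF hk]
  \<comment> \<open>With this factor the affine map \<open>z \<mapsto> k0 y + c * z\<close> sends
    \<open>0\<close> to \<open>k0 y\<close> and \<open>- D\<close> to \<open>k0 x\<close>.\<close>
  define c where "c = (k0 y - k0 x) / of_real D"
  have "k0 x \<noteq> k0 y" using ch(4)[OF assms(2,5)] ch(4)[OF assms(3,6)] assms(4) by metis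
  then have c0: "c \<noteq> 0" using assms(7) unfolding c_def by simp
  have A: "homeomorphism (UNIV :: complex set) UNIV (\<lambda>z. (z - k0 y) / c) (\<lambda>z. k0 y + c * z)"
    using c0 by (intro homeomorphismI continuous_intros) auto
  have "homeomorphism (S2 - {q}) (UNIV :: complex set) ((\<lambda>z. (z - k0 y) / c) \<circ> k0) (h0 \<circ> (\<lambda>z. k0 y + c * z))"
    by (rule homeomorphism_compose[OF hk A])
  moreover have "(h0 \<circ> (\<lambda>z. k0 y + c * z)) (of_real (- D)) = x"
    using ch(4)[OF assms(2,5)] assms(7) by (simp add: c_def)
  moreover have "(h0 \<circ> (\<lambda>z. k0 y + c * z)) 0 = y" using ch(4)[OF assms(3,6)] by simp
  ultimately show thesis using that by blast
qed

lemma distinct3_cases: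
  assumes "i \<noteq> j" "i \<noteq> k" "j \<noteq> (k::3)"
  shows "j = i + 1 \<and> k = i + 2 \<or> j = i + 2 \<and> k = i + 1" "x = i \<or> x = j \<or> x = k"
  using assms index3(11)[of j i] index3(11)[of k i] index3(11)[of x i] by metis+

text \<open>Both kinds of packing numbers are symmetric in the two points other than
  \<open>P x\<close>, so the three indices may be named in any order, cyclic or not.\<close>

lemma realizesI:
  assumes d: "i \<noteq> j" "i \<noteq> k" "j \<noteq> (k::3)" and K: "drawable K" "connected K" "K \<noteq> {}" "P i \<notin> K" "P j \<notin> K" "P k \<notin> K"
    and "max_packing K (\<lambda>C. sep C (P i) (P j) \<and> sep C (P i) (P k)) (\<mu> i)"
    and "max_packing K (\<lambda>C. sep C (P j) (P i) \<and> sep C (P j) (P k)) (\<mu> j)"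
    and "max_packing K (\<lambda>C. sep C (P k) (P i) \<and> sep C (P k) (P j)) (\<mu> k)"
    and "max_packing K (\<lambda>C. sep C (P j) (P k)) (\<delta> i)"
    and "max_packing K (\<lambda>C. sep C (P i) (P k)) (\<delta> j)"
    and "max_packing K (\<lambda>C. sep C (P i) (P j)) (\<delta> k)"
  shows "realizes P K \<mu> \<delta>"
proof -
  have 1: "max_packing K (encircles P x) (\<mu> x)" "max_packing K (\<lambda>C. sep C (P (x + 1)) (P (x + 2))) (\<delta> x)"
    if "x \<noteq> y" "x \<noteq> z" "y \<noteq> z" "max_packing K (\<lambda>C. sep C (P x) (P y) \<and> sep C (P x) (P z)) (\<mu> x)"
      "max_packing K (\<lambda>C. sep C (P y) (P z)) (\<delta> x)" for x y z
  proof -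
    have yz: "y = x + 1 \<and> z = x + 2 \<or> y = x + 2 \<and> z = x + 1" using distinct3_cases(1) that(1-3) by blast
    then have "encircles P x = (\<lambda>C. sep C (P x) (P y) \<and> sep C (P x) (P z))"
      unfolding encircles_def by auto
    then show "max_packing K (encircles P x) (\<mu> x)" using that(4) by simp
    have "(\<lambda>C. sep C (P (x + 1)) (P (x + 2))) = (\<lambda>C. sep C (P y) (P z))"
      using yz sep_commute by auto
    then show "max_packing K (\<lambda>C. sep C (P (x + 1)) (P (x + 2))) (\<delta> x)" using that(5) by simp
  qed
  have "max_packing K (encircles P x) (\<mu> x) \<and> max_packing K (\<lambda>C. sep C (P (x + 1)) (P (x + 2))) (\<delta> x)" for x
    using distinct3_cases(2)[OF d, of x] 1[of i j k] 1[of j i k] 1[of k i j] d assms(10-15) by auto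
  moreover have "P x \<notin> K" for x using distinct3_cases(2)[OF d, of x] K by auto
  ultimately show ?thesis unfolding realizes_def using K by blast
qed

text \<open>The chart puts \<open>P i\<close>, \<open>P j\<close>, \<open>P k\<close> at
  \<open>- D\<close>, \<open>0\<close> and infinity, so that \<open>al\<close>, \<open>be\<close>,
  \<open>ga\<close> encircle them in this order.\<close>

lemma base_realizes:
  assumes P: "range P \<subseteq> S2" "inj P" and d: "i \<noteq> j" "i \<noteq> k" "j \<noteq> (k::3)"
    and n: "s \<le> T" "\<rho> \<le> T" "T \<le> s + \<rho>" "\<rho> \<le> s + 1" "1 \<le> T"
  shows "\<exists>K. realizes P K (\<lambda>x. if x = i then s else T) (\<lambda>x. if x = k then s + \<rho> else T)"
proof -
  have PS: "P x \<in> S2" for x using P(1) by blast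
  have Pd: "P i \<noteq> P j" "P i \<noteq> P k" "P j \<noteq> P k" using P(2) d by (auto dest: injD)
  define D where "D = real s + real \<rho> + 1"
  have "D > 0" unfolding D_def by linarith
  then obtain h f where hk: "homeomorphism (S2 - {P k}) (UNIV :: complex set) f h"
    and h: "h (of_real (- D)) = P i" "h 0 = P j"
    using sphere_chart_through[OF PS PS PS Pd] by blast
  note c = n hk PS D_def refl refl
  let ?K = "drawing s T D (2 * max 1 (real \<rho>)) (2 * max 1 (real \<rho>) + 2) h"
  have "realizes P ?K (\<lambda>x. if x = i then s else T) (\<lambda>x. if x = k then s + \<rho> else T)"
    by (rule realizesI[OF d])
      (use drawing_drawable[OF c] drawing_avoids_points[OF c, unfolded h] base_packings[OF c, unfolded h] d in simp_all)
  then show ?thesis by blast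
qed

text \<open>A single point contains no closed curve. It serves as the nonempty starting set when
  \<open>T = 0\<close> and there are no triangles to draw.\<close>

lemma point_realizes:
  assumes P: "range P \<subseteq> S2" "inj P"
  shows "\<exists>K. realizes P K (\<lambda>_. 0) (\<lambda>_. 0)"
proof -
  have "infinite S2" using infinite_openin_S2[of S2 "P 0"] P(1) by auto
  then have "\<not> S2 \<subseteq> range P" using finite_subset by (metis finite_code finite_imageI)
  then obtain x where x: "x \<in> S2" "x \<notin> range P" by blast
  have "\<not> simple_closed_curve C" if "C \<subseteq> {x}" for C
    using that simple_closed_curveD(6) finite_subset by blast
  then have "packing {x} Q L \<longleftrightarrow> L = {}" for Q L unfolding packing_def by auto
  then have "max_packing {x} Q 0" for Q unfolding max_packing_def by auto
  then have "realizes P {x} (\<lambda>_. 0) (\<lambda>_. 0)"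
    unfolding realizes_def using drawable_point[OF x(1)] x(2) by auto
  then show ?thesis by blast
qed

section \<open>Characterization of the realizable values\<close>

lemma sigma_graph_necessary:
  assumes P: "range P \<subseteq> S2" and G: "sigma_graph P G"
    and v: "\<And>i. M_sigma P G i = \<mu> i" "\<And>i. d_sigma P G i = enat (\<delta> i)"
  shows "max (\<mu> (i + 1)) (\<mu> (i + 2)) \<le> \<delta> i" "\<delta> i \<le> \<mu> (i + 1) + \<mu> (i + 2)"
    "\<delta> (i + 1) + \<delta> (i + 2) \<le> 2 * \<mu> i + \<delta> i + 1"
proof -
  have emb: "embedded_graph G" using G unfolding sigma_graph_def by blast
  define K where "K = support G"
  have PK: "P j \<in> S2 - support G" for j
  proof -
    obtain F where "F \<in> faces G" "P j \<in> F" using G unfolding sigma_graph_def by blast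
    then show ?thesis using faceD(4)[OF emb] by blast
  qed
  have M: "max_packing K (encircles P j) (\<mu> j)" for j
    using M_sigma_packing[OF emb P, of j] v(1)[of j] unfolding K_def by simp
  have d: "max_packing K (\<lambda>C. sep C (P (j + 1)) (P (j + 2))) (\<delta> j)" for j
  proof -
    obtain n where "face_dist G (face_at G (P (j + 1))) (face_at G (P (j + 2))) = enat n"
      "max_packing (support G) (\<lambda>C. sep C (P (j + 1)) (P (j + 2))) n"
      using face_dist_packing[OF emb PK PK] by metis
    then show ?thesis using v(2)[of j] unfolding d_sigma_def sigma_face_def K_def by simp
  qed
  have sw: "(\<lambda>C. sep C x y) = (\<lambda>C. sep C y x)" for x y using sep_commute by auto
  have e1: "encircles P (i + 1) C \<longleftrightarrow> sep C (P (i + 1)) (P (i + 2)) \<and> sep C (P (i + 1)) (P i)"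
    and e2: "encircles P (i + 2) C \<longleftrightarrow> sep C (P (i + 1)) (P (i + 2)) \<and> sep C (P i) (P (i + 2))" for C
    unfolding encircles_def index3 using sep_commute[of C] by blast+
  show "max (\<mu> (i + 1)) (\<mu> (i + 2)) \<le> \<delta> i"
    using max_packing_le[OF M d] e1 e2 by (metis max.bounded_iff)
  obtain L where L: "packing K (\<lambda>C. sep C (P (i + 1)) (P (i + 2))) L" "card L = \<delta> i"
    using d unfolding max_packing_def by metis
  define L1 L2 where "L1 = {C \<in> L. encircles P (i + 1) C}" and "L2 = {C \<in> L. encircles P (i + 2) C}"
  have "L = L1 \<union> L2"
  proof -
    have "encircles P (i + 1) C \<or> encircles P (i + 2) C" if "C \<in> L" for C
    proof -
      have C: "sep C (P (i + 1)) (P (i + 2))" "C \<subseteq> K" using that L(1) unfolding packing_def by auto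
      moreover have "P i \<in> S2" "P i \<notin> C" using PK[of i] C(2) unfolding K_def by auto
      ultimately show ?thesis using sep_cases[OF C(1)] unfolding e1 e2 by blast
    qed
    then show ?thesis unfolding L1_def L2_def by blast
  qed
  moreover have "packing K (encircles P (i + 1)) L1" "packing K (encircles P (i + 2)) L2"
    using L(1) unfolding L1_def L2_def packing_def by (auto intro: pairwise_subset)
  then have "card L1 \<le> \<mu> (i + 1)" "card L2 \<le> \<mu> (i + 2)" using M unfolding max_packing_def by blast+
  ultimately show "\<delta> i \<le> \<mu> (i + 1) + \<mu> (i + 2)"
    using card_Un_le[of L1 L2] L(2) by (metis add_mono order_trans)
  have "\<delta> (i + 2) + \<delta> (i + 1) \<le> 2 * \<mu> i + \<delta> i + 1"
  proof (rule tripod_inequality[OF emb, of "P i" "P (i + 1)" "P (i + 2)", folded K_def])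
    show "max_packing K (\<lambda>C. sep C (P i) (P (i + 1))) (\<delta> (i + 2))" using d[of "i + 2"] unfolding index3 .
    show "max_packing K (\<lambda>C. sep C (P i) (P (i + 2))) (\<delta> (i + 1))"
      using d[of "i + 1"] unfolding index3 by (subst sw)
    show "max_packing K (\<lambda>C. sep C (P (i + 1)) (P (i + 2))) (\<delta> i)" by (rule d)
    show "max_packing K (\<lambda>C. sep C (P i) (P (i + 1)) \<and> sep C (P i) (P (i + 2))) (\<mu> i)"
      using M[of i] unfolding encircles_def .
  qed (use PK K_def in auto)
  then show "\<delta> (i + 1) + \<delta> (i + 2) \<le> 2 * \<mu> i + \<delta> i + 1" by simp
qed

text \<open>Positivity of \<open>\<delta> i\<close> provides a curve in \<open>K\<close> between
  \<open>P (i + 1)\<close> and \<open>P (i + 2)\<close>, which therefore lie in different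
  faces.\<close>

lemma realizes_imp_sigma_graph:
  assumes P: "range P \<subseteq> S2" and r: "realizes P K \<mu> \<delta>" and \<delta>: "\<And>i. \<delta> i \<ge> 1"
  shows "\<exists>G. sigma_graph P G \<and> (\<forall>i. M_sigma P G i = \<mu> i \<and> d_sigma P G i = enat (\<delta> i))"
proof -
  have K: "drawable K" "connected K" "K \<noteq> {}" "\<And>j. P j \<notin> K"
    and M: "\<And>i. max_packing K (encircles P i) (\<mu> i)"
    and d: "\<And>i. max_packing K (\<lambda>C. sep C (P (i + 1)) (P (i + 2))) (\<delta> i)"
    using r unfolding realizes_def by auto
  obtain G where G: "embedded_graph G" "support G = K" using K(1) unfolding drawable_def by blast
  have PK: "P j \<in> S2 - support G" for j using K(4) P G(2) by blast
  have "verts G \<noteq> {}"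
  proof
    assume "verts G = {}"
    moreover from this have "edges G = {}" using edge_has_vertex[OF G(1)] by blast
    ultimately show False using K(3) G(2) unfolding support_def by simp
  qed
  moreover have "graph_connected G"
    using connected_support_imp_graph_connected[OF G(1)] G(2) K(2) by simp
  moreover have "inj (\<lambda>i. face_at G (P i))"
  proof -
    have ne: "face_at G (P (i + 1)) \<noteq> face_at G (P (i + 2))" for i
    proof
      assume eq: "face_at G (P (i + 1)) = face_at G (P (i + 2))"
      obtain L where L: "packing K (\<lambda>C. sep C (P (i + 1)) (P (i + 2))) L" "card L = \<delta> i"
        using d unfolding max_packing_def by metis
      then have "L \<noteq> {}" using \<delta>[of i] by auto
      then obtain C where C: "sep C (P (i + 1)) (P (i + 2))" "C \<subseteq> K" using L(1) unfolding packing_def by blast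
      have "connected (face_at G (P (i + 1)))" by simp
      moreover have "face_at G (P (i + 1)) \<subseteq> S2 - C" using connected_component_subset C(2) G(2) by blast
      moreover have "P (i + 1) \<in> face_at G (P (i + 1))" "P (i + 2) \<in> face_at G (P (i + 1))"
        using PK eq by auto
      ultimately show False using not_sep_connected C(1) by blast
    qed
    have "face_at G (P i) \<noteq> face_at G (P j)" if "i \<noteq> j" for i j
      using index3(11)[of j i] that ne[of "i + 2"] ne[of "i + 1"] unfolding index3 by metis
    then show ?thesis by (meson injI)
  qed
  moreover have "\<forall>i. face_at G (P i) \<in> faces G \<and> P i \<in> face_at G (P i)"
    using face_atD[OF G(1)] PK by blast
  ultimately have "sigma_graph P G"
    unfolding sigma_graph_def using G(1) by blast
  moreover have "M_sigma P G i = \<mu> i" for i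
    using max_packing_unique[OF M_sigma_packing[OF G(1) P]] M G(2) by simp
  moreover have "d_sigma P G i = enat (\<delta> i)" for i
  proof -
    obtain n where "face_dist G (face_at G (P (i + 1))) (face_at G (P (i + 2))) = enat n"
      "max_packing (support G) (\<lambda>C. sep C (P (i + 1)) (P (i + 2))) n"
      using face_dist_packing[OF G(1) PK PK] by metis
    then show ?thesis
      using max_packing_unique[OF d[of i]] G(2) unfolding d_sigma_def sigma_face_def by simp
  qed
  ultimately show ?thesis by blast
qed

text \<open>The slacks \<open>t i = \<mu> (i + 1) + \<mu> (i + 2) - \<delta> i\<close> are not changed by inserting a small loop around one of the
  points. It therefore suffices to draw the case where \<open>\<mu>\<close> is as small as the slacks permit.\<close>

lemma realizes_exists:
  assumes P: "range P \<subseteq> S2" "inj P"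
    and c: "\<And>i. max (\<mu> (i + 1)) (\<mu> (i + 2)) \<le> \<delta> i" "\<And>i. \<delta> i \<le> \<mu> (i + 1) + \<mu> (i + 2)"
      "\<And>i. \<delta> (i + 1) + \<delta> (i + 2) \<le> 2 * \<mu> i + \<delta> i + (1::nat)"
  shows "\<exists>K. realizes P K \<mu> \<delta>"
proof -
  define t where "t i = \<mu> (i + 1) + \<mu> (i + 2) - \<delta> i" for i
  have c': "\<mu> y \<le> \<delta> x" "\<mu> z \<le> \<delta> x" "\<delta> x + t x = \<mu> y + \<mu> z" "\<delta> y + \<delta> z \<le> 2 * \<mu> x + \<delta> x + 1"
    if "x \<noteq> y" "x \<noteq> z" "y \<noteq> z" for x y z
    using distinct3_cases(1)[OF that] c[of x] unfolding t_def by auto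
  \<comment> \<open>The indices are sorted by slack, with the largest at \<open>i\<close> and the
    smallest at \<open>k\<close>.\<close>
  obtain i j k :: 3 where ijk: "i \<noteq> j" "i \<noteq> k" "j \<noteq> k" "t j \<le> t i" "t k \<le> t j"
  proof -
    have "(0::3) \<noteq> 1" "(0::3) \<noteq> 2" "(1::3) \<noteq> 2" by simp_all
    note n = this
    consider "t 1 \<le> t 0" "t 2 \<le> t 1" | "t 2 \<le> t 0" "t 1 \<le> t 2" | "t 0 \<le> t 1" "t 2 \<le> t 0"
      | "t 2 \<le> t 1" "t 0 \<le> t 2" | "t 0 \<le> t 2" "t 1 \<le> t 0" | "t 1 \<le> t 2" "t 0 \<le> t 1" by linarith
    then show thesis using that n by cases metis+
  qed
  define T s u where "T = t i" and "s = t j" and "u = t k"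
  note ci = c'[OF ijk(1-3)] and cj = c'[of j i k] and ck = c'[of k i j]
  have E: "\<delta> i + T = \<mu> j + \<mu> k" "\<delta> j + s = \<mu> i + \<mu> k" "\<delta> k + u = \<mu> i + \<mu> j"
    using ci(3) cj(3) ck(3) ijk(1-3) unfolding T_def s_def u_def by auto
  \<comment> \<open>By (1) a slack is at most each \<open>\<mu>\<close> of the two other indices.
    Hence \<open>(s, T, T)\<close> is the least possible \<open>\<mu>\<close> for the slacks
    \<open>(T, s, u)\<close>.\<close>
  have le: "T \<le> \<mu> j" "T \<le> \<mu> k" "s \<le> \<mu> i" "u \<le> s" "s \<le> T"
    using E ci(1,2) cj(1,2) ijk unfolding T_def s_def u_def by auto
  \<comment> \<open>Condition (2) at the index with the largest slack. In terms of
    \<open>\<rho> = T - u\<close> it becomes \<open>\<rho> \<le> s + 1\<close>.\<close>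
  have tri: "T \<le> s + u + 1" using ci(4) E by linarith
  define \<rho> where "\<rho> = T - u"
  have "\<exists>K. realizes P K (\<lambda>x. if x = i then s else T) (\<lambda>x. if x = k then s + \<rho> else T)"
  proof (cases "T = 0")
    case True
    then have "(\<lambda>x. if x = i then s else T) = (\<lambda>_. 0)" "(\<lambda>x. if x = k then s + \<rho> else T) = (\<lambda>_. 0)"
      using le unfolding \<rho>_def by auto
    then show ?thesis using point_realizes[OF P] by simp
  next
    case False
    show ?thesis
      by (rule base_realizes[OF P ijk(1-3)]) (use False le tri \<rho>_def in auto)
  qed
  then obtain K0 where K0: "realizes P K0 (\<lambda>x. if x = i then s else T) (\<lambda>x. if x = k then s + \<rho> else T)" by blast
  let ?a = "\<lambda>i n f x. if x = i then f x + n else f x" and ?b = "\<lambda>i n f x. if x = i then f x else f x + n"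
  \<comment> \<open>The deficits \<open>\<mu> i - s\<close>, \<open>\<mu> j - T\<close> and
    \<open>\<mu> k - T\<close> are the numbers of loops to insert; the value of
    \<open>\<delta>\<close> then follows from \<open>E\<close>.\<close>
  define \<mu>' where
    "\<mu>' = ?a k (\<mu> k - T) (?a j (\<mu> j - T) (?a i (\<mu> i - s) (\<lambda>x. if x = i then s else T)))"
  define \<delta>' where
    "\<delta>' = ?b k (\<mu> k - T) (?b j (\<mu> j - T) (?b i (\<mu> i - s) (\<lambda>x. if x = k then s + \<rho> else T)))"
  obtain K1 where K1: "realizes P K1 (?a i (\<mu> i - s) (\<lambda>x. if x = i then s else T))
    (?b i (\<mu> i - s) (\<lambda>x. if x = k then s + \<rho> else T))"
    using realizes_add_loops[OF P K0, of i "\<mu> i - s"] by (rule exE)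
  obtain K2 where K2: "realizes P K2 (?a j (\<mu> j - T) (?a i (\<mu> i - s) (\<lambda>x. if x = i then s else T)))
    (?b j (\<mu> j - T) (?b i (\<mu> i - s) (\<lambda>x. if x = k then s + \<rho> else T)))"
    using realizes_add_loops[OF P K1, of j "\<mu> j - T"] by (rule exE)
  obtain K3 where K3: "realizes P K3 \<mu>' \<delta>'"
    unfolding \<mu>'_def \<delta>'_def using realizes_add_loops[OF P K2, of k "\<mu> k - T"] by (rule exE)
  have "\<mu>' x = \<mu> x" "\<delta>' x = \<delta> x" for x
    using distinct3_cases(2)[OF ijk(1-3), of x] ijk(1-3) le E unfolding \<mu>'_def \<delta>'_def \<rho>_def by auto
  then have "\<mu>' = \<mu>" "\<delta>' = \<delta>" by auto
  then show ?thesis using K3 by blast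
qed

theorem theorem2p3:
  fixes P :: "3 \<Rightarrow> real^3" and \<mu> \<delta> :: "3 \<Rightarrow> nat"
  assumes "range P \<subseteq> S2" and "inj P" and "\<And>i. \<delta> i \<ge> 1"
  shows "(\<exists>G. sigma_graph P G \<and> (\<forall>i. M_sigma P G i = \<mu> i \<and> d_sigma P G i = enat (\<delta> i)))
     \<longleftrightarrow>
     (\<forall>i. max (\<mu> (i + 1)) (\<mu> (i + 2)) \<le> \<delta> i \<and> \<delta> i \<le> \<mu> (i + 1) + \<mu> (i + 2) \<and>
          \<delta> (i + 1) + \<delta> (i + 2) \<le> 2 * \<mu> i + \<delta> i + 1)"
proof (intro iffI allI conjI)
  fix i
  assume "\<exists>G. sigma_graph P G \<and> (\<forall>i. M_sigma P G i = \<mu> i \<and> d_sigma P G i = enat (\<delta> i))"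
  then obtain G where G: "sigma_graph P G" "\<And>i. M_sigma P G i = \<mu> i" "\<And>i. d_sigma P G i = enat (\<delta> i)"
    by blast
  note n = sigma_graph_necessary[OF assms(1) G, of i]
  show "max (\<mu> (i + 1)) (\<mu> (i + 2)) \<le> \<delta> i" "\<delta> i \<le> \<mu> (i + 1) + \<mu> (i + 2)"
    "\<delta> (i + 1) + \<delta> (i + 2) \<le> 2 * \<mu> i + \<delta> i + 1"
    by (rule n)+
next
  assume c: "\<forall>i. max (\<mu> (i + 1)) (\<mu> (i + 2)) \<le> \<delta> i \<and> \<delta> i \<le> \<mu> (i + 1) + \<mu> (i + 2) \<and>
    \<delta> (i + 1) + \<delta> (i + 2) \<le> 2 * \<mu> i + \<delta> i + 1"
  have "\<exists>K. realizes P K \<mu> \<delta>"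
    by (rule realizes_exists[OF assms(1,2)]) (use c in blast)+
  then obtain K where "realizes P K \<mu> \<delta>" ..
  then show "\<exists>G. sigma_graph P G \<and> (\<forall>i. M_sigma P G i = \<mu> i \<and> d_sigma P G i = enat (\<delta> i))"
    using realizes_imp_sigma_graph[OF assms(1)] assms(3) by blast
qed

end
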